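(* Let $a>0$, $\alpha>0$, $\beta>0$, let $b,c_o\in\mathbf{R}$, let $\underline{E}:=2\sqrt{\alpha\beta}-|b|$ and define $E_A:=4\pi\underline{E}=4\pi(2\sqrt{\alpha\beta}-|b|)$. Then: (i) If $\underline{E}\ge 0$, then $E_A$ is a lower bound for the energy $E=E_{a,c_o,b,\alpha,\beta}$ among all sufficiently smooth topological annuli (embedded) in $\mathbf{R}^3$. (ii) If $\underline{E}<0$ and $c_o>0$, then the infimum of the energy among all topological annuli is $-\infty$. (iii) If $\underline{E}<-a$, $c_o=0$ and $a+b<0$, then the infimum of the energy among all topological annuli is $-\infty$. (iv) If $\underline{E}<0$, $c_o=0$ and $b>0$, then the infimum of the energy among all topological annuli is $-\infty$. The result of cases (ii)-(iv) also holds for topological discs, i.e. under the hypotheses of (ii), (iii) or (iv) the infimum of the energy among all topological discs is $-\infty$.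
   Context: Let $\Sigma$ be a compact connected surface with boundary and $X:\Sigma\to\mathbf{R}^3$ an immersion; it is assumed throughout that $X(\Sigma)$ is an oriented surface of class $C^4$ embedded in $\mathbf{R}^3$ with sufficiently smooth boundary. The energy is $$E[\Sigma]=\int_\Sigma\left(a[H+c_o]^2+bK\right)d\Sigma+\oint_{\partial\Sigma}\left(\alpha\kappa^2+\beta\right)ds,$$ where $H$ is the mean curvature (average of the principal curvatures), $K$ the Gaussian curvature, $\kappa\ge 0$ the curvature of the boundary curve in $\mathbf{R}^3$ and $s$ arc length. Sign convention: the unit normal $\nu$ points out of a convex domain, so that a round sphere of radius $R$ has $H=-1/R$. A topological annulus (disc) means that $\Sigma$ is of annulus (disc) type. All topological annuli and discs in the claim are subject to the embeddedness and smoothness assumption above. *)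

theory Defs
  imports "HOL-Analysis.Analysis"
begin

text \<open>Meant for open \<open>S\<close>.\<close>
fun C_k_on :: "nat \<Rightarrow> ('a::real_normed_vector \<Rightarrow> 'b::real_normed_vector) \<Rightarrow> 'a set \<Rightarrow> bool" where
  "C_k_on 0 f S \<longleftrightarrow> continuous_on S f"
| "C_k_on (Suc k) f S \<longleftrightarrow>
     (\<forall>x\<in>S. f differentiable at x) \<and> (\<forall>v. C_k_on k (\<lambda>x. frechet_derivative f (at x) v) S)"


section \<open>Parametrised surfaces in space\<close>

definition dir_deriv :: "(real^2 \<Rightarrow> real^3) \<Rightarrow> real^2 \<Rightarrow> real^2 \<Rightarrow> real^3" where
  "dir_deriv X v p = frechet_derivative X (at p) v"

text \<open>
  The class of \<open>X\<close> up to the boundary of the (compact) parameter domain \<open>D\<close> is expressed by a \<open>C\<^sup>4\<close>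
  extension to a neighbourhood of \<open>D\<close>. All quantities below depend only on the values of \<open>X\<close> on \<open>D\<close>
  whenever \<open>D\<close> is the closure of its interior, since the derivatives at boundary points are then limits
  of derivatives at interior points.
\<close>
definition embedded_C4_surface :: "(real^2) set \<Rightarrow> (real^2 \<Rightarrow> real^3) \<Rightarrow> bool" where
  "embedded_C4_surface D X \<longleftrightarrow>
     (\<exists>U. open U \<and> D \<subseteq> U \<and> C_k_on 4 X U) \<and>
     (\<forall>p\<in>D. inj (frechet_derivative X (at p))) \<and>
     inj_on X D"

definition normal_field :: "(real^2 \<Rightarrow> real^3) \<Rightarrow> real^2 \<Rightarrow> real^3" where
  "normal_field X p = cross3 (dir_deriv X (axis 1 1) p) (dir_deriv X (axis 2 1) p)"

definition unit_normal :: "(real^2 \<Rightarrow> real^3) \<Rightarrow> real^2 \<Rightarrow> real^3" where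
  "unit_normal X p = sgn (normal_field X p)"

definition area_element :: "(real^2 \<Rightarrow> real^3) \<Rightarrow> real^2 \<Rightarrow> real" where
  "area_element X p = norm (normal_field X p)"

text \<open>
  Second over first fundamental form in the parameter direction \<open>v\<close>. The second fundamental form is
  \<open>D\<^sup>2X(v,v) \<bullet> \<nu>\<close>; with this sign a sphere of radius \<open>R\<close> with outward normal has normal curvature
  \<open>- 1 / R\<close>. The orientation of the surface is the one induced by the parametrisation, so the opposite
  one is obtained by precomposing \<open>X\<close> with a reflection of the parameter domain.
\<close>
definition normal_curvature :: "(real^2 \<Rightarrow> real^3) \<Rightarrow> real^2 \<Rightarrow> real^2 \<Rightarrow> real" where
  "normal_curvature X p v =
     (dir_deriv (dir_deriv X v) v p \<bullet> unit_normal X p) / (norm (dir_deriv X v p))\<^sup>2"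

definition principal_curvature_max :: "(real^2 \<Rightarrow> real^3) \<Rightarrow> real^2 \<Rightarrow> real" where
  "principal_curvature_max X p = (SUP v\<in>-{0}. normal_curvature X p v)"

definition principal_curvature_min :: "(real^2 \<Rightarrow> real^3) \<Rightarrow> real^2 \<Rightarrow> real" where
  "principal_curvature_min X p = (INF v\<in>-{0}. normal_curvature X p v)"

definition mean_curvature :: "(real^2 \<Rightarrow> real^3) \<Rightarrow> real^2 \<Rightarrow> real" where
  "mean_curvature X p = (principal_curvature_max X p + principal_curvature_min X p) / 2"

definition gauss_curvature :: "(real^2 \<Rightarrow> real^3) \<Rightarrow> real^2 \<Rightarrow> real" where
  "gauss_curvature X p = principal_curvature_max X p * principal_curvature_min X p"


section \<open>Closed space curves\<close>

definition speed :: "(real \<Rightarrow> real^3) \<Rightarrow> real \<Rightarrow> real" where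
  "speed \<gamma> t = norm (vector_derivative \<gamma> (at t))"

definition unit_tangent :: "(real \<Rightarrow> real^3) \<Rightarrow> real \<Rightarrow> real^3" where
  "unit_tangent \<gamma> t = sgn (vector_derivative \<gamma> (at t))"

text \<open>\<open>\<kappa> = |dT/ds|\<close>, where \<open>s\<close> is arc length.\<close>
definition curve_curvature :: "(real \<Rightarrow> real^3) \<Rightarrow> real \<Rightarrow> real" where
  "curve_curvature \<gamma> t = norm (vector_derivative (unit_tangent \<gamma>) (at t)) / speed \<gamma> t"

text \<open>Image under \<open>X\<close> of the circle of radius \<open>r\<close> about the origin, run through once on \<open>[0, 2\<pi>]\<close>.\<close>
definition circle_image :: "(real^2 \<Rightarrow> real^3) \<Rightarrow> real \<Rightarrow> real \<Rightarrow> real^3" where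
  "circle_image X r t = X (vector [r * cos t, r * sin t])"


section \<open>The energy\<close>

definition surface_energy ::
  "real \<Rightarrow> real \<Rightarrow> real \<Rightarrow> (real^2) set \<Rightarrow> (real^2 \<Rightarrow> real^3) \<Rightarrow> real" where
  "surface_energy a c\<^sub>o b D X =
     integral D (\<lambda>p. (a * (mean_curvature X p + c\<^sub>o)\<^sup>2 + b * gauss_curvature X p) * area_element X p)"

definition curve_energy :: "real \<Rightarrow> real \<Rightarrow> (real \<Rightarrow> real^3) \<Rightarrow> real" where
  "curve_energy \<alpha> \<beta> \<gamma> =
     integral {0..2*pi} (\<lambda>t. (\<alpha> * (curve_curvature \<gamma> t)\<^sup>2 + \<beta>) * speed \<gamma> t)"

text \<open>
  Every compact embedded \<open>C\<^sup>4\<close> surface with boundary that is of annulus (disc) type is the image of the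
  round closed annulus (disc) under an embedding of class \<open>C\<^sup>4\<close> up to the boundary, and the energy
  does not depend on the choice of such an (orientation compatible) embedding.
\<close>
definition std_annulus :: "(real^2) set" where
  "std_annulus = {p. 1 \<le> norm p \<and> norm p \<le> 2}"

definition std_disc :: "(real^2) set" where
  "std_disc = cball 0 1"

definition top_annuli :: "(real^2 \<Rightarrow> real^3) set" where
  "top_annuli = {X. embedded_C4_surface std_annulus X}"

definition top_discs :: "(real^2 \<Rightarrow> real^3) set" where
  "top_discs = {X. embedded_C4_surface std_disc X}"

definition annulus_energy ::
  "real \<Rightarrow> real \<Rightarrow> real \<Rightarrow> real \<Rightarrow> real \<Rightarrow> (real^2 \<Rightarrow> real^3) \<Rightarrow> real" where
  "annulus_energy a c\<^sub>o b \<alpha> \<beta> X =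
     surface_energy a c\<^sub>o b std_annulus X +
     curve_energy \<alpha> \<beta> (circle_image X 1) + curve_energy \<alpha> \<beta> (circle_image X 2)"

definition disc_energy ::
  "real \<Rightarrow> real \<Rightarrow> real \<Rightarrow> real \<Rightarrow> real \<Rightarrow> (real^2 \<Rightarrow> real^3) \<Rightarrow> real" where
  "disc_energy a c\<^sub>o b \<alpha> \<beta> X =
     surface_energy a c\<^sub>o b std_disc X + curve_energy \<alpha> \<beta> (circle_image X 1)"

definition E_under :: "real \<Rightarrow> real \<Rightarrow> real \<Rightarrow> real" where
  "E_under b \<alpha> \<beta> = 2 * sqrt (\<alpha> * \<beta>) - \<bar>b\<bar>"

definition E_A :: "real \<Rightarrow> real \<Rightarrow> real \<Rightarrow> real" where
  "E_A b \<alpha> \<beta> = 4 * pi * E_under b \<alpha> \<beta>"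

end

theory Submission
  imports Defs
begin

text \<open>
  For the lower bound, Gauss--Bonnet turns the total Gauss curvature of an annulus into the total
  geodesic curvature of its two boundary curves, which is bounded by their total curvature;
  \<open>\<alpha> \<kappa>\<^sup>2 + \<beta> \<ge> 2 sqrt (\<alpha> \<beta>) \<kappa>\<close> and Fenchel's theorem finish the argument. On an annulus given in polar
  coordinates the unit tangents of the concentric circles are part of a global moving frame, so
  Gauss--Bonnet is just Green's formula for its connection form.

  For the remaining claims, take a piece of a surface of revolution on which the area integrand is a
  multiple \<open>b' K\<close> of the Gauss curvature, bounded by parallels of radius about \<open>sqrt (\<alpha> / \<beta>)\<close>: a nodoid
  of mean curvature \<open>-c\<^sub>o\<close>, a large sphere, or a catenoid. Going around it \<open>n\<close> times gives an immersed
  strip, whose energy is a boundary integral by Gauss--Bonnet and hence an affine function of \<open>n\<close>,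
  with negative slope. Increasing the distance to the axis by \<open>\<epsilon>\<close> times the angle makes the strip
  embedded, and its energy converges as \<open>\<epsilon> \<rightarrow> 0\<close>.
\<close>

section \<open>Functions of class \<open>C\<^sup>k\<close>\<close>

text \<open>One extra turn changes the energy by 2 pi times the sum of \<alpha> / r + \<beta> r over
  both ends plus 2 pi b' (cos u0 - cos u1), where u0, u1 are the tangent angles of the profile at
  its ends. The first part is least for r = sqrt (\<alpha> / \<beta>), with sum 4 sqrt (\<alpha>
  \<beta>); to beat it, both end tangents should be nearly horizontal and K of sign opposite to b'.
  A nodoid has halves of either curvature sign with horizontal ends, so for \<open>c\<^sub>o\<close>
  > 0 any sign of b will do. For \<open>c\<^sub>o\<close> = 0 the sphere has K > 0 and b' = a + b,
  as H^2 = K, the catenoid K < 0 and b' = b; their ends are never quite horizontal, but the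
  inequalities are strict. The obstacle is that the maps must be defined on a round annulus or disc.
  There the plane is stretched only across a thin vertical band, which cuts the outer circle in arcs
  that are first straightened so as to lie on the two bounding parallels. To the right of the band
  the effect is a rotation by full turns. The unit circle around the hole avoids the band, so
  annulus and disc share one construction.\<close>

lemma C_k_on_cong:
  assumes "open S" "\<And>x. x \<in> S \<Longrightarrow> f x = g x" "C_k_on k f S"
  shows "C_k_on k g S"
  using assms(2,3)
proof (induction k arbitrary: f g)
  case 0
  then show ?case by (auto cong: continuous_on_cong)
next
  case (Suc k)
  have fr: "frechet_derivative f (at x) = frechet_derivative g (at x)" if "x \<in> S" for x
    using Suc.prems that assms(1) by (intro frechet_derivative_transform_within_open) auto
  have "g differentiable at x" if "x \<in> S" for x
    using Suc.prems that assms(1) has_derivative_transform_within_open[of f _ x UNIV S g]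
    unfolding C_k_on.simps differentiable_def by blast
  moreover have "C_k_on k (\<lambda>x. frechet_derivative g (at x) v) S" for v
    using Suc.IH[of "\<lambda>x. frechet_derivative f (at x) v" "\<lambda>x. frechet_derivative g (at x) v"] Suc.prems fr by auto
  ultimately show ?case by auto
qed

text \<open>Regularity is read off from any derivative formula, so that
  \<open>frechet_derivative\<close>, a choice operator, need not be evaluated by hand.\<close>

lemma C_k_on_SucI:
  assumes "open S" "\<And>x. x \<in> S \<Longrightarrow> (f has_derivative f' x) (at x)" "\<And>v. C_k_on k (\<lambda>x. f' x v) S"
  shows "C_k_on (Suc k) f S"
proof -
  have "C_k_on k (\<lambda>x. frechet_derivative f (at x) v) S" for v
    by (rule C_k_on_cong[OF assms(1) _ assms(3)[of v]]) (simp add: frechet_derivative_at[OF assms(2), symmetric])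
  then show ?thesis
    using assms(2) by (auto simp: differentiable_def)
qed

lemma C_k_on_has_derivative:
  assumes "C_k_on (Suc k) f S" "x \<in> S"
  shows "(f has_derivative frechet_derivative f (at x)) (at x)"
  using assms frechet_derivative_works by auto

lemma C_k_on_Suc_imp: "C_k_on (Suc k) f S \<Longrightarrow> C_k_on k f S"
proof (induction k arbitrary: f)
  case 0
  then show ?case
    by (simp add: differentiable_imp_continuous_on differentiable_at_imp_differentiable_on)
next
  case (Suc k)
  have "C_k_on k (\<lambda>x. frechet_derivative f (at x) v) S" for v
    using Suc.prems by (intro Suc.IH) auto
  then show ?case using Suc.prems by simp
qed

lemma C_k_on_le: "C_k_on k f S \<Longrightarrow> j \<le> k \<Longrightarrow> C_k_on j f S"
proof (induction k)
  case (Suc k)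
  show ?case
  proof (cases "j = Suc k")
    case False
    then show ?thesis using Suc.prems Suc.IH C_k_on_Suc_imp by (metis le_SucE)
  qed (use Suc.prems in simp)
qed simp

lemma C_k_on_continuous: "C_k_on k f S \<Longrightarrow> continuous_on S f"
  using C_k_on_le[of k f S 0] by simp

lemma C_k_on_subset: "C_k_on k f S \<Longrightarrow> T \<subseteq> S \<Longrightarrow> C_k_on k f T"
proof (induction k arbitrary: f)
  case 0
  then show ?case using continuous_on_subset by auto
next
  case (Suc k)
  then show ?case by (meson C_k_on.simps(2) subsetD)
qed

lemma C_k_on_const: "C_k_on k (\<lambda>x. c) S"
  by (induction k arbitrary: c) auto

lemma C_k_on_bounded_linear:
  assumes "open S" "bounded_linear f" shows "C_k_on k f S"
proof (cases k)
  case 0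
  then show ?thesis using assms by (simp add: linear_continuous_on)
next
  case (Suc j)
  show ?thesis unfolding Suc
    by (rule C_k_on_SucI[OF assms(1) bounded_linear_imp_has_derivative[OF assms(2)]]) (rule C_k_on_const)
qed

lemma C_k_on_add:
  assumes "open S" "C_k_on k f S" "C_k_on k g S" shows "C_k_on k (\<lambda>x. f x + g x) S"
  using assms(2,3)
proof (induction k arbitrary: f g)
  case 0
  then show ?case by (simp add: continuous_on_add)
next
  case (Suc k)
  show ?case
    by (rule C_k_on_SucI[OF assms(1)
        has_derivative_add[OF C_k_on_has_derivative[OF Suc.prems(1)] C_k_on_has_derivative[OF Suc.prems(2)]]])
       (use Suc in auto)
qed

lemma C_k_on_sum:
  assumes "open S" "finite A" "\<And>i. i \<in> A \<Longrightarrow> C_k_on k (f i) S"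
  shows "C_k_on k (\<lambda>x. \<Sum>i\<in>A. f i x) S"
  using assms(2,3) by (induction A) (simp_all add: C_k_on_const C_k_on_add assms(1))

text \<open>The product rule returns two products of the same kind with one factor differentiated,
  hence an induction over both factors at once. One proof covers products, scalar multiples, inner
  and cross products.\<close>

lemma C_k_on_bilinear:
  assumes "bounded_bilinear prd" "open S" "C_k_on k f S" "C_k_on k g S"
  shows "C_k_on k (\<lambda>x. prd (f x) (g x)) S"
  using assms(3,4)
proof (induction k arbitrary: f g)
  case 0
  then show ?case using bounded_bilinear.continuous_on[OF assms(1)] by auto
next
  case (Suc k)
  show ?case
    by (rule C_k_on_SucI[OF assms(2)
        bounded_bilinear.FDERIV[OF assms(1) C_k_on_has_derivative[OF Suc.prems(1)] C_k_on_has_derivative[OF Suc.prems(2)]]])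
       (assumption | intro C_k_on_add[OF assms(2)] Suc.IH C_k_on_Suc_imp[OF Suc.prems(1)] C_k_on_Suc_imp[OF Suc.prems(2)]
         | use Suc.prems in simp)+
qed

lemmas C_k_on_mult = C_k_on_bilinear[OF bounded_bilinear_mult]
lemmas C_k_on_scaleR = C_k_on_bilinear[OF bounded_bilinear_scaleR]
lemmas C_k_on_inner = C_k_on_bilinear[OF bounded_bilinear_inner]

lemma bounded_bilinear_cross3: "bounded_bilinear cross3"
  by (simp add: bilinear_conv_bounded_bilinear[symmetric] bilinear_cross)

lemmas C_k_on_cross3 = C_k_on_bilinear[OF bounded_bilinear_cross3]

lemma C_k_on_diff:
  assumes "open S" "C_k_on k f S" "C_k_on k g S"
  shows "C_k_on k (\<lambda>x. f x - g x :: 'a :: real_normed_vector) S"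
proof -
  have "C_k_on k (\<lambda>x. f x + (-1) *\<^sub>R g x) S"
    by (intro C_k_on_add C_k_on_scaleR C_k_on_const assms)
  then show ?thesis by simp
qed

text \<open>In f'(g x) (g' x v) the direction in which f is differentiated moves with x, whereas
  \<open>C_k_on\<close> controls only fixed directions. Expanding g' x v in \<open>Basis\<close>
  leaves sums of products of a coordinate of g' with a partial derivative of f, to which the
  induction applies.\<close>

lemma C_k_on_compose:
  fixes f :: "'b::euclidean_space \<Rightarrow> 'c::real_normed_vector" and g :: "'a::real_normed_vector \<Rightarrow> 'b"
  assumes "open S" "open T" "C_k_on k f T" "C_k_on k g S" "\<And>x. x \<in> S \<Longrightarrow> g x \<in> T"
  shows "C_k_on k (\<lambda>x. f (g x)) S"
  using assms(3,4)
proof (induction k arbitrary: f)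
  case 0
  then show ?case using assms(5) continuous_on_compose2[of T f S g] by auto
next
  case (Suc k)
  note g' = C_k_on_has_derivative[OF Suc.prems(2)] and f' = C_k_on_has_derivative[OF Suc.prems(1)]
  have der: "((\<lambda>x. f (g x)) has_derivative (\<lambda>v. \<Sum>b\<in>Basis. (frechet_derivative g (at x) v \<bullet> b) *\<^sub>R frechet_derivative f (at (g x)) b)) (at x)"
    if "x \<in> S" for x
  proof -
    have lin: "linear (frechet_derivative f (at (g x)))"
      using f'[OF assms(5)[OF that]] has_derivative_linear by blast
    have rep: "frechet_derivative f (at (g x)) w = (\<Sum>b\<in>Basis. (w \<bullet> b) *\<^sub>R frechet_derivative f (at (g x)) b)" for w
      using arg_cong[OF euclidean_representation[of w], of "frechet_derivative f (at (g x))"]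
      unfolding linear_sum[OF lin] linear_scale[OF lin] by (rule sym)
    have "frechet_derivative f (at (g x)) \<circ> frechet_derivative g (at x) =
        (\<lambda>v. \<Sum>b\<in>Basis. (frechet_derivative g (at x) v \<bullet> b) *\<^sub>R frechet_derivative f (at (g x)) b)"
      by (rule ext) (simp only: o_apply, rule rep)
    then show ?thesis
      using diff_chain_at[OF g'[OF that] f'[OF assms(5)[OF that]]] by (simp only: o_def)
  qed
  show ?case
  proof (rule C_k_on_SucI[OF assms(1) der])
    show "C_k_on k (\<lambda>x. \<Sum>b\<in>Basis. (frechet_derivative g (at x) v \<bullet> b) *\<^sub>R frechet_derivative f (at (g x)) b) S" for v
    proof (intro C_k_on_sum C_k_on_scaleR C_k_on_inner C_k_on_const assms(1) finite_Basis)
      show "C_k_on k (\<lambda>x. frechet_derivative g (at x) v) S" using Suc.prems(2) by simp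
      show "C_k_on k (\<lambda>x. frechet_derivative f (at (g x)) b) S" for b
        using Suc.prems(1) by (intro Suc.IH C_k_on_Suc_imp[OF Suc.prems(2)]) simp
    qed
  qed
qed

lemma C_k_on_real_SucI:
  fixes f :: "real \<Rightarrow> real"
  assumes "open S" "\<And>x. x \<in> S \<Longrightarrow> (f has_real_derivative f' x) (at x)" "C_k_on k f' S"
  shows "C_k_on (Suc k) f S"
  by (rule C_k_on_SucI[OF assms(1) assms(2)[unfolded has_field_derivative_def]])
     (auto intro: C_k_on_mult C_k_on_const assms)

lemma C_k_on_sin_cos:
  fixes S :: "real set" assumes "open S"
  shows "C_k_on k sin S \<and> C_k_on k cos S"
proof (induction k)
  case 0
  then show ?case by (simp add: continuous_on_sin continuous_on_cos)
next
  case (Suc k)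
  have "C_k_on k (\<lambda>x. (-1) * sin x) S" using Suc by (intro C_k_on_mult C_k_on_const assms) auto
  then have "C_k_on (Suc k) cos S"
    by (intro C_k_on_real_SucI[OF assms]) (auto intro!: derivative_eq_intros)
  moreover have "C_k_on (Suc k) sin S"
    using Suc by (intro C_k_on_real_SucI[OF assms]) (auto intro!: derivative_eq_intros)
  ultimately show ?case by blast
qed

text \<open>The exponent is arbitrary in the induction because differentiation lowers it by one. The
  exponents -1 and 1/2 then give reciprocals, square roots, norms and \<open>sgn\<close>.\<close>

lemma C_k_on_powr:
  fixes S :: "real set" assumes "open S" "S \<subseteq> {0<..}"
  shows "C_k_on k (\<lambda>x. x powr a) S"
proof (induction k arbitrary: a)
  case 0
  then show ?case using assms by (force intro!: continuous_on_powr' continuous_on_id continuous_on_const)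
next
  case (Suc k)
  have "C_k_on k (\<lambda>x. a * x powr (a - 1)) S" using Suc by (intro C_k_on_mult C_k_on_const assms)
  then show ?case
    using assms by (intro C_k_on_real_SucI[OF assms(1)]) (auto intro!: derivative_eq_intros)
qed

lemma C_k_on_inverse_pos:
  fixes f :: "'a::real_normed_vector \<Rightarrow> real"
  assumes "open S" "C_k_on k f S" "\<And>x. x \<in> S \<Longrightarrow> f x > 0"
  shows "C_k_on k (\<lambda>x. inverse (f x)) S" "C_k_on k (\<lambda>x. sqrt (f x)) S"
proof -
  have *: "C_k_on k (\<lambda>x. f x powr a) S" for a
    by (rule C_k_on_compose[OF assms(1) open_greaterThan[of 0] C_k_on_powr]) (use assms in auto)
  show "C_k_on k (\<lambda>x. inverse (f x)) S"
    by (rule C_k_on_cong[OF assms(1) _ *[of "-1"]])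
       (auto simp: powr_minus dest: assms(3))
  show "C_k_on k (\<lambda>x. sqrt (f x)) S"
    by (rule C_k_on_cong[OF assms(1) _ *[of "1/2"]])
       (auto simp: powr_half_sqrt dest: assms(3))
qed

lemma C_k_on_norm:
  fixes f :: "'a::real_normed_vector \<Rightarrow> 'b::real_inner"
  assumes "open S" "C_k_on k f S" "\<And>x. x \<in> S \<Longrightarrow> f x \<noteq> 0"
  shows "C_k_on k (\<lambda>x. norm (f x)) S"
  unfolding norm_eq_sqrt_inner
  by (intro C_k_on_inverse_pos(2) C_k_on_inner assms) (use assms in auto)

lemma C_k_on_sgn:
  fixes f :: "'a::real_normed_vector \<Rightarrow> 'b::real_inner"
  assumes "open S" "C_k_on k f S" "\<And>x. x \<in> S \<Longrightarrow> f x \<noteq> 0"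
  shows "C_k_on k (\<lambda>x. sgn (f x)) S"
  unfolding sgn_div_norm
  by (intro C_k_on_scaleR C_k_on_inverse_pos(1) C_k_on_norm assms) (use assms in auto)

section \<open>Coordinates in the plane and in space, partial derivatives\<close>

lemma vector_2_axis: "(vector [x, y] :: real^2) = x *\<^sub>R axis 1 1 + y *\<^sub>R axis 2 1"
  by (simp add: vec_eq_iff forall_2 axis_def)

lemma vector_3_axis: "(vector [x, y, z] :: real^3) = x *\<^sub>R axis 1 1 + y *\<^sub>R axis 2 1 + z *\<^sub>R axis 3 1"
  by (simp add: vec_eq_iff forall_3 axis_def)

lemma C_k_on_vector2:
  assumes "open S" "C_k_on k f S" "C_k_on k g S"
  shows "C_k_on k (\<lambda>x. vector [f x, g x] :: real^2) S"
  unfolding vector_2_axis by (intro C_k_on_add C_k_on_scaleR C_k_on_const assms)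

lemma C_k_on_vector3:
  assumes "open S" "C_k_on k f S" "C_k_on k g S" "C_k_on k h S"
  shows "C_k_on k (\<lambda>x. vector [f x, g x, h x] :: real^3) S"
  unfolding vector_3_axis by (intro C_k_on_add C_k_on_scaleR C_k_on_const assms)

lemma C_k_on_nth: "open S \<Longrightarrow> C_k_on k (\<lambda>x::real^'n. x $ i) S"
  by (rule C_k_on_bounded_linear) (auto intro: bounded_linear_vec_nth)

lemma has_derivative_vector2:
  assumes "(f has_derivative f') F" "(g has_derivative g') F"
  shows "((\<lambda>x. vector [f x, g x] :: real^2) has_derivative (\<lambda>v. vector [f' v, g' v])) F"
  unfolding vector_2_axis by (intro has_derivative_add has_derivative_scaleR_left assms)

lemma has_derivative_vector3:
  assumes "(f has_derivative f') F" "(g has_derivative g') F" "(h has_derivative h') F"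
  shows "((\<lambda>x. vector [f x, g x, h x] :: real^3) has_derivative (\<lambda>v. vector [f' v, g' v, h' v])) F"
  unfolding vector_3_axis by (intro has_derivative_add has_derivative_scaleR_left assms)

lemma has_vector_derivative_vector3:
  assumes "(f has_real_derivative f') F" "(g has_real_derivative g') F" "(h has_real_derivative h') F"
  shows "((\<lambda>x. vector [f x, g x, h x] :: real^3) has_vector_derivative (vector [f', g', h'])) F"
  using has_derivative_vector3[OF assms[unfolded has_field_derivative_def]]
  by (auto simp: has_vector_derivative_def vector_3_axis scaleR_add_right mult.commute)

abbreviation "e\<^sub>1 \<equiv> axis 1 1 :: real^2"
abbreviation "e\<^sub>2 \<equiv> axis 2 1 :: real^2"
abbreviation pd :: "'a::real_normed_vector \<Rightarrow> ('a \<Rightarrow> 'b::real_normed_vector) \<Rightarrow> 'a \<Rightarrow> 'b"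
  where "pd v f \<equiv> \<lambda>p. frechet_derivative f (at p) v"

lemma dir_deriv_eq_pd: "dir_deriv X v = pd v X"
  by (simp add: dir_deriv_def fun_eq_iff)

lemma C_k_on_pd: "C_k_on (Suc k) f S \<Longrightarrow> C_k_on k (pd v f) S"
  by simp

lemma pd_eqI: "(f has_derivative f') (at p) \<Longrightarrow> pd v f p = f' v"
  using frechet_derivative_at by metis

lemma vec2_eq: "(v::real^2) = v $ 1 *\<^sub>R e\<^sub>1 + v $ 2 *\<^sub>R e\<^sub>2"
  by (simp add: vec_eq_iff forall_2 axis_def)

lemma linear_vec2:
  fixes f :: "real^2 \<Rightarrow> 'b::real_vector"
  assumes "linear f" shows "f v = v $ 1 *\<^sub>R f e\<^sub>1 + v $ 2 *\<^sub>R f e\<^sub>2"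
  using arg_cong[OF vec2_eq[of v], of f] unfolding linear_add[OF assms] linear_scale[OF assms] .

lemma pd_vec2:
  fixes f :: "real^2 \<Rightarrow> 'b::real_normed_vector"
  assumes "f differentiable at p"
  shows "pd v f p = v $ 1 *\<^sub>R pd e\<^sub>1 f p + v $ 2 *\<^sub>R pd e\<^sub>2 f p"
  using linear_vec2[OF linear_frechet_derivative[OF assms]] .

lemma pd_cong:
  assumes "open S" "p \<in> S" "\<And>x. x \<in> S \<Longrightarrow> f x = g x"
  shows "pd v f p = pd v g p"
proof -
  have "(f has_derivative f') (at p) \<longleftrightarrow> (g has_derivative f') (at p)" for f'
    using has_derivative_transform_within_open[of f f' p UNIV S g]
      has_derivative_transform_within_open[of g f' p UNIV S f] assms by metis
  then show ?thesis by (simp add: frechet_derivative_def)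
qed

section \<open>Symmetry of second derivatives\<close>

text \<open>The mean value theorem is used twice: in direction v for the difference of f along two
  parallel segments, then in direction w for the derivative obtained.\<close>

lemma second_difference_mvt:
  fixes f :: "'a::real_normed_vector \<Rightarrow> real"
  assumes f: "C_k_on 2 f S" and "h > 0"
    and S: "\<And>s t. s \<in> {0..h} \<Longrightarrow> t \<in> {0..h} \<Longrightarrow> p + s *\<^sub>R v + t *\<^sub>R w \<in> S"
  shows "\<exists>s\<in>{0<..<h}. \<exists>t\<in>{0<..<h}.
    f (p + h *\<^sub>R v + h *\<^sub>R w) - f (p + h *\<^sub>R v) - f (p + h *\<^sub>R w) + f p
      = h * h * pd w (pd v f) (p + s *\<^sub>R v + t *\<^sub>R w)"
proof -
  have f': "(f has_derivative frechet_derivative f (at x)) (at x)"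
    and f'': "(pd v f has_derivative frechet_derivative (pd v f) (at x)) (at x)" if "x \<in> S" for x
    using f that by (auto simp: numeral_2_eq_2 frechet_derivative_works[symmetric])
  define \<phi> where "\<phi> s = f (p + s *\<^sub>R v + h *\<^sub>R w) - f (p + s *\<^sub>R v + 0 *\<^sub>R w)" for s
  have d1: "((\<lambda>s. f (p + s *\<^sub>R v + t *\<^sub>R w)) has_real_derivative pd v f (p + s *\<^sub>R v + t *\<^sub>R w)) (at s)"
    if "s \<in> {0..h}" "t \<in> {0..h}" for s t
  proof -
    have "((\<lambda>s. p + s *\<^sub>R v + t *\<^sub>R w) has_derivative (\<lambda>r. r *\<^sub>R v)) (at s)"
      by (auto intro!: derivative_eq_intros)
    from diff_chain_at[OF this f'[OF S[OF that]]]
    have "((\<lambda>s. f (p + s *\<^sub>R v + t *\<^sub>R w)) has_derivative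
        (\<lambda>r. frechet_derivative f (at (p + s *\<^sub>R v + t *\<^sub>R w)) (r *\<^sub>R v))) (at s)" by (simp add: o_def)
    then show ?thesis
      using linear_scale[OF has_derivative_linear[OF f'[OF S[OF that]]]]
      by (simp add: has_field_derivative_def mult_commute_abs)
  qed
  have d2: "((\<lambda>t. pd v f (p + s *\<^sub>R v + t *\<^sub>R w)) has_real_derivative pd w (pd v f) (p + s *\<^sub>R v + t *\<^sub>R w)) (at t)"
    if "s \<in> {0..h}" "t \<in> {0..h}" for s t
  proof -
    have "((\<lambda>t. p + s *\<^sub>R v + t *\<^sub>R w) has_derivative (\<lambda>r. r *\<^sub>R w)) (at t)"
      by (auto intro!: derivative_eq_intros)
    from diff_chain_at[OF this f''[OF S[OF that]]]
    have "((\<lambda>t. pd v f (p + s *\<^sub>R v + t *\<^sub>R w)) has_derivative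
        (\<lambda>r. frechet_derivative (pd v f) (at (p + s *\<^sub>R v + t *\<^sub>R w)) (r *\<^sub>R w))) (at t)" by (simp add: o_def)
    then show ?thesis
      using linear_scale[OF has_derivative_linear[OF f''[OF S[OF that]]]]
      by (simp add: has_field_derivative_def mult_commute_abs)
  qed
  have "\<exists>s>0. s < h \<and> \<phi> h - \<phi> 0 = (h - 0) *
      (pd v f (p + s *\<^sub>R v + h *\<^sub>R w) - pd v f (p + s *\<^sub>R v + 0 *\<^sub>R w))"
    unfolding \<phi>_def
    by (intro MVT2 \<open>h > 0\<close> DERIV_diff d1) (use \<open>h > 0\<close> in auto)
  then obtain s where s: "0 < s" "s < h" "\<phi> h - \<phi> 0 = h *
      (pd v f (p + s *\<^sub>R v + h *\<^sub>R w) - pd v f (p + s *\<^sub>R v + 0 *\<^sub>R w))" by auto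
  have "\<exists>t>0. t < h \<and> pd v f (p + s *\<^sub>R v + h *\<^sub>R w) - pd v f (p + s *\<^sub>R v + 0 *\<^sub>R w)
      = (h - 0) * pd w (pd v f) (p + s *\<^sub>R v + t *\<^sub>R w)"
    by (intro MVT2 \<open>h > 0\<close> d2) (use s in auto)
  then obtain t where "0 < t" "t < h" "pd v f (p + s *\<^sub>R v + h *\<^sub>R w) - pd v f (p + s *\<^sub>R v + 0 *\<^sub>R w)
      = h * pd w (pd v f) (p + s *\<^sub>R v + t *\<^sub>R w)" by auto
  with s show ?thesis
    by (intro bexI[of _ s] bexI[of _ t]) (auto simp: \<phi>_def)
qed

text \<open>The second difference is symmetric in v and w, so the two mixed derivatives share a
  value, taken at two points of an arbitrarily small parallelogram with corner p. Continuity at p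
  then excludes a gap between them.\<close>

lemma pd_commute_real:
  fixes f :: "'a::real_normed_vector \<Rightarrow> real"
  assumes "open S" "C_k_on 2 f S" "p \<in> S"
  shows "pd w (pd v f) p = pd v (pd w f) p"
proof (rule ccontr)
  define a where "a = pd w (pd v f)"
  define b where "b = pd v (pd w f)"
  assume ne: "pd w (pd v f) p \<noteq> pd v (pd w f) p"
  define e where "e = \<bar>a p - b p\<bar> / 2"
  have "e > 0" using ne by (simp add: e_def a_def b_def)
  have "continuous_on S a" "continuous_on S b"
    using assms(2) by (auto simp: a_def b_def numeral_2_eq_2)
  then have "isCont a p" "isCont b p"
    using assms(1,3) continuous_on_eq_continuous_at by blast+
  then obtain d1 d2 where d1: "d1 > 0" "\<And>x. dist x p < d1 \<Longrightarrow> \<bar>a x - a p\<bar> < e"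
    and d2: "d2 > 0" "\<And>x. dist x p < d2 \<Longrightarrow> \<bar>b x - b p\<bar> < e"
    using \<open>e > 0\<close> by (force simp: continuous_at_eps_delta dist_real_def)
  obtain d3 where d3: "d3 > 0" "ball p d3 \<subseteq> S"
    using assms(1,3) openE by blast
  define d where "d = min d1 (min d2 d3)"
  have "d > 0" using d1 d2 d3 by (simp add: d_def)
  \<comment> \<open>With this side length the whole parallelogram lies within d of p; the 1 in the
    denominator covers v = w = 0.\<close>
  define h where "h = d / (2 * (norm v + norm w + 1))"
  have "norm v + norm w + 1 > 0" by (smt (verit) norm_ge_zero)
  then have "h > 0" using \<open>d > 0\<close> by (simp add: h_def)
  have hd: "h * (norm v + norm w) < d"
  proof -
    have "h * (norm v + norm w) \<le> h * (norm v + norm w + 1)" using \<open>h > 0\<close> by simp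
    also have "\<dots> = d / 2" using \<open>norm v + norm w + 1 > 0\<close> by (simp add: h_def field_simps)
    finally show ?thesis using \<open>d > 0\<close> by simp
  qed
  have near: "dist (p + s *\<^sub>R v + t *\<^sub>R w) p < d" if "s \<in> {0..h}" "t \<in> {0..h}" for s t
  proof -
    have "norm (s *\<^sub>R v + t *\<^sub>R w) \<le> s * norm v + t * norm w"
      using norm_triangle_ineq[of "s *\<^sub>R v" "t *\<^sub>R w"] that by simp
    also have "\<dots> \<le> h * norm v + h * norm w"
      using that by (intro add_mono mult_right_mono) auto
    finally have "norm (s *\<^sub>R v + t *\<^sub>R w) < d" using hd by (simp add: algebra_simps)
    then show ?thesis by (simp add: dist_norm add.assoc)
  qed
  have inS: "p + s *\<^sub>R v + t *\<^sub>R w \<in> S" if "s \<in> {0..h}" "t \<in> {0..h}" for s t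
    using near[OF that] d3 by (auto simp: d_def dist_commute)
  have inS': "p + s *\<^sub>R w + t *\<^sub>R v \<in> S" if "s \<in> {0..h}" "t \<in> {0..h}" for s t
    using inS[OF that(2,1)] by (simp add: ac_simps)
  obtain s t where st: "s \<in> {0<..<h}" "t \<in> {0<..<h}"
    "f (p + h *\<^sub>R v + h *\<^sub>R w) - f (p + h *\<^sub>R v) - f (p + h *\<^sub>R w) + f p = h * h * a (p + s *\<^sub>R v + t *\<^sub>R w)"
    using second_difference_mvt[OF assms(2) \<open>h > 0\<close> inS] unfolding a_def by metis
  obtain s' t' where st': "s' \<in> {0<..<h}" "t' \<in> {0<..<h}"
    "f (p + h *\<^sub>R w + h *\<^sub>R v) - f (p + h *\<^sub>R w) - f (p + h *\<^sub>R v) + f p = h * h * b (p + s' *\<^sub>R w + t' *\<^sub>R v)"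
    using second_difference_mvt[OF assms(2) \<open>h > 0\<close> inS'] unfolding b_def by metis
  have "h * h * a (p + s *\<^sub>R v + t *\<^sub>R w) = h * h * b (p + s' *\<^sub>R w + t' *\<^sub>R v)"
    unfolding st(3)[symmetric] st'(3)[symmetric] by (simp add: add.assoc add.commute[of "h *\<^sub>R v"])
  then have eq: "a (p + s *\<^sub>R v + t *\<^sub>R w) = b (p + t' *\<^sub>R v + s' *\<^sub>R w)"
    using \<open>h > 0\<close> by (simp add: add.assoc add.commute[of "t' *\<^sub>R v"])
  have "\<bar>a (p + s *\<^sub>R v + t *\<^sub>R w) - a p\<bar> < e"
    using near[of s t] st by (intro d1) (auto simp: d_def)
  moreover have "\<bar>b (p + t' *\<^sub>R v + s' *\<^sub>R w) - b p\<bar> < e"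
    using near[of t' s'] st' by (intro d2) (auto simp: d_def)
  moreover have "\<bar>a p - b p\<bar> \<le> \<bar>a (p + s *\<^sub>R v + t *\<^sub>R w) - a p\<bar> + \<bar>b (p + t' *\<^sub>R v + s' *\<^sub>R w) - b p\<bar>"
    using eq by arith
  ultimately show False by (simp add: e_def)
qed

lemma pd_inner_const:
  assumes "f differentiable at p"
  shows "pd v (\<lambda>x. f x \<bullet> b) p = pd v f p \<bullet> b"
  using assms by (intro pd_eqI has_derivative_inner_left) (simp add: frechet_derivative_works)

lemma pd_commute:
  fixes f :: "'a::real_normed_vector \<Rightarrow> 'b::euclidean_space"
  assumes "open S" "C_k_on 2 f S" "p \<in> S"
  shows "pd w (pd v f) p = pd v (pd w f) p"
proof (rule euclidean_eqI)
  fix b :: 'b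
  have diff: "f differentiable at x" "pd v f differentiable at x" if "x \<in> S" for x v
    using assms(2) that by (auto simp: numeral_2_eq_2)
  have "pd w (pd v f) p \<bullet> b = pd w (pd v (\<lambda>x. f x \<bullet> b)) p" for v w
    by (subst pd_cong[OF assms(1,3), of "pd v (\<lambda>x. f x \<bullet> b)" "\<lambda>x. pd v f x \<bullet> b"])
       (simp_all add: pd_inner_const diff assms(3))
  moreover have "C_k_on 2 (\<lambda>x. f x \<bullet> b) S"
    by (intro C_k_on_inner assms C_k_on_const)
  ultimately show "pd w (pd v f) p \<bullet> b = pd v (pd w f) p \<bullet> b"
    using pd_commute_real[OF assms(1) _ assms(3)] by metis
qed

section \<open>Curvature in coordinates\<close>

unbundle cross3_syntax

section \<open>Extreme values of a quotient of two quadratic forms\<close>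

text \<open>\<mu> is the larger root of det (\<mu> I - II) = 0, where I and II are the forms with
  coefficients E, F, G and l, m, n. So \<mu> I - II, with entries a, b, c, has determinant 0 and
  nonnegative trace relative to I: it is semidefinite with a nontrivial kernel.\<close>

lemma quadratic_form_pencil:
  fixes E F G l m n \<mu> :: real
  assumes E: "E > 0" and A: "E * G - F\<^sup>2 > 0"
    and root: "(E * G - F\<^sup>2) * \<mu>\<^sup>2 - (E * n - 2 * F * m + G * l) * \<mu> + (l * n - m\<^sup>2) = 0"
    and big: "2 * (E * G - F\<^sup>2) * \<mu> \<ge> E * n - 2 * F * m + G * l"
  shows "l * x\<^sup>2 + 2 * m * x * y + n * y\<^sup>2 \<le> \<mu> * (E * x\<^sup>2 + 2 * F * x * y + G * y\<^sup>2)"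
    and "\<exists>x y. (x \<noteq> 0 \<or> y \<noteq> 0) \<and> l * x\<^sup>2 + 2 * m * x * y + n * y\<^sup>2 = \<mu> * (E * x\<^sup>2 + 2 * F * x * y + G * y\<^sup>2)"
proof -
  define a b c where "a = \<mu> * E - l" and "b = \<mu> * F - m" and "c = \<mu> * G - n"
  have det: "a * c = b\<^sup>2"
    using root by (simp add: a_def b_def c_def power2_eq_square algebra_simps)
  have tr: "E * c - 2 * F * b + G * a \<ge> 0"
    using big by (simp add: a_def b_def c_def power2_eq_square algebra_simps)
  have G: "G > 0"
  proof -
    have "E * G > 0" using A zero_le_power2[of F] by linarith
    then show ?thesis using E zero_less_mult_pos by blast
  qed
  \<comment> \<open>Multiplied by a, the trace becomes the form I at the vector (b, -a), because a c
    = b^2. As I is positive definite, a cannot be negative.\<close>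
  have a0: "a \<ge> 0"
  proof (rule ccontr)
    assume "\<not> a \<ge> 0"
    have "a * (E * c - 2 * F * b + G * a) = E * b\<^sup>2 - 2 * F * a * b + G * a\<^sup>2"
      using det by (simp add: algebra_simps power2_eq_square)
    moreover have "E * (E * b\<^sup>2 - 2 * F * a * b + G * a\<^sup>2) = (E * b - F * a)\<^sup>2 + (E * G - F\<^sup>2) * a\<^sup>2"
      by (simp add: algebra_simps power2_eq_square)
    moreover have "\<dots> > 0" using A \<open>\<not> a \<ge> 0\<close> by (intro add_nonneg_pos) auto
    ultimately have "a * (E * c - 2 * F * b + G * a) > 0"
      using E by (metis zero_less_mult_pos)
    moreover have "a * (E * c - 2 * F * b + G * a) \<le> 0"
      using tr \<open>\<not> a \<ge> 0\<close> by (simp add: mult_nonpos_nonneg)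
    ultimately show False by simp
  qed
  have eq: "\<mu> * (E * x\<^sup>2 + 2 * F * x * y + G * y\<^sup>2) - (l * x\<^sup>2 + 2 * m * x * y + n * y\<^sup>2)
      = a * x\<^sup>2 + 2 * b * x * y + c * y\<^sup>2" for x y
    by (simp add: a_def b_def c_def algebra_simps power2_eq_square)
  have "a * x\<^sup>2 + 2 * b * x * y + c * y\<^sup>2 \<ge> 0" for x y
  proof (cases "a = 0")
    case True
    then have "b = 0" using det by simp
    then have "c \<ge> 0" using True tr E by (simp add: zero_le_mult_iff)
    then show ?thesis using True \<open>b = 0\<close> by simp
  next
    case False
    have "a * (a * x\<^sup>2 + 2 * b * x * y + c * y\<^sup>2) = (a * x + b * y)\<^sup>2 + (a * c - b\<^sup>2) * y\<^sup>2"
      by (simp add: algebra_simps power2_eq_square)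
    then have "a * (a * x\<^sup>2 + 2 * b * x * y + c * y\<^sup>2) \<ge> 0" using det by simp
    then show ?thesis using a0 False by (simp add: zero_le_mult_iff)
  qed
  then show "l * x\<^sup>2 + 2 * m * x * y + n * y\<^sup>2 \<le> \<mu> * (E * x\<^sup>2 + 2 * F * x * y + G * y\<^sup>2)"
    using eq[of x y] by (metis diff_ge_0_iff_ge)
  show "\<exists>x y. (x \<noteq> 0 \<or> y \<noteq> 0) \<and> l * x\<^sup>2 + 2 * m * x * y + n * y\<^sup>2 = \<mu> * (E * x\<^sup>2 + 2 * F * x * y + G * y\<^sup>2)"
  proof (cases "a = 0")
    case True
    then have "b = 0" using det by simp
    then show ?thesis using eq[of 1 0] True by (intro exI[of _ 1] exI[of _ 0]) simp
  next
    case False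
    \<comment> \<open>For nonzero a the kernel is spanned by (b, -a).\<close>
    have "a * b\<^sup>2 + 2 * b * b * (- a) + c * (- a)\<^sup>2 = a * (a * c - b\<^sup>2)"
      by (simp add: algebra_simps power2_eq_square)
    then show ?thesis using eq[of b "- a"] det False
      by (intro exI[of _ b] exI[of _ "- a"]) simp
  qed
qed

lemma quadratic_form_SUP:
  fixes E F G l m n \<mu> :: real
  assumes "E > 0" "E * G - F\<^sup>2 > 0"
    "(E * G - F\<^sup>2) * \<mu>\<^sup>2 - (E * n - 2 * F * m + G * l) * \<mu> + (l * n - m\<^sup>2) = 0"
    "2 * (E * G - F\<^sup>2) * \<mu> \<ge> E * n - 2 * F * m + G * l"
  shows "(SUP v\<in>-{0::real^2}. (l * (v$1)\<^sup>2 + 2 * m * v$1 * v$2 + n * (v$2)\<^sup>2) /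
      (E * (v$1)\<^sup>2 + 2 * F * v$1 * v$2 + G * (v$2)\<^sup>2)) = \<mu>"
proof (rule cSup_eq_maximum)
  have pos: "E * (v$1)\<^sup>2 + 2 * F * v$1 * v$2 + G * (v$2)\<^sup>2 > 0" if "v \<noteq> 0" for v :: "real^2"
  proof -
    have "E * (E * (v$1)\<^sup>2 + 2 * F * v$1 * v$2 + G * (v$2)\<^sup>2) = (E * v$1 + F * v$2)\<^sup>2 + (E * G - F\<^sup>2) * (v$2)\<^sup>2"
      by (simp add: algebra_simps power2_eq_square)
    moreover have "\<dots> > 0"
    proof (cases "v$2 = 0")
      case True
      then have "v$1 \<noteq> 0" using that by (auto simp: vec_eq_iff forall_2)
      then show ?thesis using True assms(1) by simp
    next
      case False
      then show ?thesis using assms(2) by (intro add_nonneg_pos) auto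
    qed
    ultimately show ?thesis using assms(1) by (metis zero_less_mult_pos)
  qed
  obtain x y where xy: "x \<noteq> 0 \<or> y \<noteq> 0"
    "l * x\<^sup>2 + 2 * m * x * y + n * y\<^sup>2 = \<mu> * (E * x\<^sup>2 + 2 * F * x * y + G * y\<^sup>2)"
    using quadratic_form_pencil(2)[OF assms] by blast
  have nz: "(vector [x, y] :: real^2) \<noteq> 0" using xy(1) by (auto simp: vec_eq_iff forall_2)
  show "\<mu> \<in> (\<lambda>v::real^2. (l * (v$1)\<^sup>2 + 2 * m * v$1 * v$2 + n * (v$2)\<^sup>2) /
      (E * (v$1)\<^sup>2 + 2 * F * v$1 * v$2 + G * (v$2)\<^sup>2)) ` (-{0})"
    using xy pos[OF nz] by (intro image_eqI[of _ _ "vector [x, y]"]) (use nz in \<open>simp_all add: field_simps\<close>)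
  show "x \<le> \<mu>" if "x \<in> (\<lambda>v::real^2. (l * (v$1)\<^sup>2 + 2 * m * v$1 * v$2 + n * (v$2)\<^sup>2) /
      (E * (v$1)\<^sup>2 + 2 * F * v$1 * v$2 + G * (v$2)\<^sup>2)) ` (-{0})" for x
  proof -
    obtain v :: "real^2" where "v \<noteq> 0" and x: "x = (l * (v$1)\<^sup>2 + 2 * m * v$1 * v$2 + n * (v$2)\<^sup>2) /
      (E * (v$1)\<^sup>2 + 2 * F * v$1 * v$2 + G * (v$2)\<^sup>2)" using \<open>x \<in> _\<close> by blast
    show ?thesis unfolding x pos_divide_le_eq[OF pos[OF \<open>v \<noteq> 0\<close>]] by (rule quadratic_form_pencil(1)[OF assms])
  qed
qed

text \<open>Mean and Gauss curvature need only the sum and the product of the extreme values, and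
  Vieta's formulas give these without square roots.\<close>

lemma quadratic_form_SUP_INF:
  fixes E F G l m n :: real
  assumes E: "E > 0" and A: "E * G - F\<^sup>2 > 0"
  defines "q \<equiv> \<lambda>v::real^2. (l * (v$1)\<^sup>2 + 2 * m * v$1 * v$2 + n * (v$2)\<^sup>2) /
      (E * (v$1)\<^sup>2 + 2 * F * v$1 * v$2 + G * (v$2)\<^sup>2)"
  shows "(SUP v\<in>-{0}. q v) + (INF v\<in>-{0}. q v) = (E * n - 2 * F * m + G * l) / (E * G - F\<^sup>2)"
    and "(SUP v\<in>-{0}. q v) * (INF v\<in>-{0}. q v) = (l * n - m\<^sup>2) / (E * G - F\<^sup>2)"
proof -
  define K B C where "K = E * G - F\<^sup>2" and "B = E * n - 2 * F * m + G * l" and "C = l * n - m\<^sup>2"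
  have K: "K > 0" using A by (simp add: K_def)
  \<comment> \<open>After multiplication by E^2 the discriminant is a sum of nonnegative terms, so
    the roots are real; geometrically this is H^2 >= K.\<close>
  have "E\<^sup>2 * (B\<^sup>2 - 4 * K * C) = (E * (E * n - G * l) - 2 * F * (E * m - F * l))\<^sup>2 + 4 * K * (E * m - F * l)\<^sup>2"
    unfolding K_def B_def C_def by algebra
  also have "\<dots> \<ge> 0" using K by simp
  finally have disc: "B\<^sup>2 - 4 * K * C \<ge> 0" using E by (metis mult_pos_neg not_le zero_less_power)
  define r where "r = sqrt (B\<^sup>2 - 4 * K * C)"
  have r: "r \<ge> 0" "r\<^sup>2 = B\<^sup>2 - 4 * K * C" using disc by (auto simp: r_def)
  have root: "K * ((B + s) / (2 * K))\<^sup>2 - B * ((B + s) / (2 * K)) + C = 0" if "s\<^sup>2 = r\<^sup>2" for s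
  proof -
    have "K * ((B + s) / (2 * K))\<^sup>2 - B * ((B + s) / (2 * K)) + C = (s\<^sup>2 - (B\<^sup>2 - 4 * K * C)) / (4 * K)"
      using K by (simp add: field_simps power2_eq_square)
    then show ?thesis using that r by simp
  qed
  have sup: "(SUP v\<in>-{0}. q v) = (B + r) / (2 * K)"
    unfolding q_def using root[of r] r K
    by (intro quadratic_form_SUP[OF E A]) (simp_all add: K_def B_def C_def)
  \<comment> \<open>The least value is minus the greatest value of the quotient with l, m, n
    negated.\<close>
  have "(SUP v\<in>-{0}. - q v) = - ((B - r) / (2 * K))"
  proof -
    have "- q v = ((-l) * (v$1)\<^sup>2 + 2 * (-m) * v$1 * v$2 + (-n) * (v$2)\<^sup>2) /
      (E * (v$1)\<^sup>2 + 2 * F * v$1 * v$2 + G * (v$2)\<^sup>2)" for v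
      by (simp add: q_def minus_divide_left)
    moreover have "(SUP v\<in>-{0::real^2}. ((-l) * (v$1)\<^sup>2 + 2 * (-m) * v$1 * v$2 + (-n) * (v$2)\<^sup>2) /
      (E * (v$1)\<^sup>2 + 2 * F * v$1 * v$2 + G * (v$2)\<^sup>2)) = - ((B - r) / (2 * K))"
    proof (rule quadratic_form_SUP[OF E A])
      have eqs: "E * - n - 2 * F * - m + G * - l = - B" "- l * - n - (- m)\<^sup>2 = C" "E * G - F\<^sup>2 = K"
        by (simp_all add: K_def B_def C_def)
      have "- B * - ((B - r) / (2 * K)) = B * ((B - r) / (2 * K))" by simp
      then show "(E * G - F\<^sup>2) * (- ((B - r) / (2 * K)))\<^sup>2
          - (E * - n - 2 * F * - m + G * - l) * - ((B - r) / (2 * K)) + (- l * - n - (- m)\<^sup>2) = 0"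
        unfolding eqs unfolding power2_minus using root[of "-r"] by simp
      have "2 * K * - ((B - r) / (2 * K)) = - (B - r)" using K by (simp add: field_simps)
      then show "2 * (E * G - F\<^sup>2) * - ((B - r) / (2 * K)) \<ge> E * - n - 2 * F * - m + G * - l"
        unfolding eqs using r by simp
    qed
    ultimately show ?thesis by (simp only:)
  qed
  then have inf: "(INF v\<in>-{0}. q v) = (B - r) / (2 * K)"
    by (simp add: Inf_real_def image_image)
  show "(SUP v\<in>-{0}. q v) + (INF v\<in>-{0}. q v) = (E * n - 2 * F * m + G * l) / (E * G - F\<^sup>2)"
    unfolding sup inf K_def[symmetric] B_def[symmetric] using K by (simp add: field_simps)
  have "(B + r) * (B - r) = 4 * K * C" using r by (simp add: algebra_simps power2_eq_square)
  then show "(SUP v\<in>-{0}. q v) * (INF v\<in>-{0}. q v) = (l * n - m\<^sup>2) / (E * G - F\<^sup>2)"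
    unfolding sup inf K_def[symmetric] C_def[symmetric] using K by (simp add: field_simps power2_eq_square)
qed

section \<open>Mean and Gauss curvature as functions of the derivatives\<close>

text \<open>The classical expressions (E n - 2 F m + G l) / (2 (E G - F^2)) and, below, (l n - m^2)
  / (E G - F^2), with A, B the first and P, Q, R the second derivatives of the surface. As plain
  functions of five vectors they make continuity in the point and in a perturbation parameter
  visible.\<close>

definition mean_of :: "real^3 \<Rightarrow> real^3 \<Rightarrow> real^3 \<Rightarrow> real^3 \<Rightarrow> real^3 \<Rightarrow> real" where
  "mean_of A B P Q R = ((A \<bullet> A) * (R \<bullet> sgn (A \<times> B)) - 2 * (A \<bullet> B) * (Q \<bullet> sgn (A \<times> B)) +
     (B \<bullet> B) * (P \<bullet> sgn (A \<times> B))) / (2 * (norm (A \<times> B))\<^sup>2)"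

definition gauss_of :: "real^3 \<Rightarrow> real^3 \<Rightarrow> real^3 \<Rightarrow> real^3 \<Rightarrow> real^3 \<Rightarrow> real" where
  "gauss_of A B P Q R = ((P \<bullet> sgn (A \<times> B)) * (R \<bullet> sgn (A \<times> B)) - (Q \<bullet> sgn (A \<times> B))\<^sup>2) / (norm (A \<times> B))\<^sup>2"

lemma norm_cross_square: "(norm (A \<times> B))\<^sup>2 = (A \<bullet> A) * (B \<bullet> B) - (A \<bullet> B)\<^sup>2"
  using norm_cross_dot[of A B] by (simp add: power_mult_distrib power2_norm_eq_inner)

lemma normal_field_pd: "normal_field X p = pd e\<^sub>1 X p \<times> pd e\<^sub>2 X p"
  by (simp add: normal_field_def dir_deriv_def)

text \<open>If the cross product vanishes, equality in the Cauchy-Schwarz inequality yields the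
  relation (B \<bullet> B) A - (A \<bullet> B) B = 0 and with it a kernel vector.\<close>

lemma inj_frechet_iff_normal_field:
  assumes "X differentiable at p"
  shows "inj (frechet_derivative X (at p)) \<longleftrightarrow> normal_field X p \<noteq> 0"
proof -
  define A B where "A = pd e\<^sub>1 X p" and "B = pd e\<^sub>2 X p"
  have lin: "linear (frechet_derivative X (at p))" using assms by (rule linear_frechet_derivative)
  have ex: "frechet_derivative X (at p) v = v$1 *\<^sub>R A + v$2 *\<^sub>R B" for v
    unfolding A_def B_def by (rule pd_vec2[OF assms])
  show ?thesis unfolding linear_injective_0[OF lin] normal_field_pd A_def[symmetric] B_def[symmetric]
  proof
    assume inj: "\<forall>v. frechet_derivative X (at p) v = 0 \<longrightarrow> v = 0"
    show "A \<times> B \<noteq> 0"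
    proof
      assume "A \<times> B = 0"
      then have *: "(A \<bullet> A) * (B \<bullet> B) = (A \<bullet> B)\<^sup>2" using norm_cross_square[of A B] by simp
      define w where "w = (B \<bullet> B) *\<^sub>R A - (A \<bullet> B) *\<^sub>R B"
      have "w \<bullet> w = (B \<bullet> B) * ((A \<bullet> A) * (B \<bullet> B) - (A \<bullet> B)\<^sup>2)"
        by (simp add: w_def inner_diff_left inner_diff_right inner_commute algebra_simps power2_eq_square)
      then have "w = 0" using * by simp
      then have "frechet_derivative X (at p) (vector [B \<bullet> B, - (A \<bullet> B)]) = 0"
        by (simp add: ex w_def)
      then have "vector [B \<bullet> B, - (A \<bullet> B)] = (0::real^2)" using inj by blast
      then have "B = 0" by (simp add: vec_eq_iff forall_2)
      then have "frechet_derivative X (at p) e\<^sub>2 = 0" by (simp add: B_def)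
      then have "e\<^sub>2 = 0" using inj by blast
      then show False by (simp add: axis_eq_0_iff)
    qed
  next
    assume nz: "A \<times> B \<noteq> 0"
    show "\<forall>v. frechet_derivative X (at p) v = 0 \<longrightarrow> v = 0"
    proof (intro allI impI)
      fix v assume "frechet_derivative X (at p) v = 0"
      then have 0: "v$1 *\<^sub>R A + v$2 *\<^sub>R B = 0" using ex by simp
      have "v$1 *\<^sub>R (A \<times> B) = (v$1 *\<^sub>R A + v$2 *\<^sub>R B) \<times> B"
        by (simp add: cross_add_left cross_mult_left)
      moreover have "v$2 *\<^sub>R (A \<times> B) = A \<times> (v$1 *\<^sub>R A + v$2 *\<^sub>R B)"
        by (simp add: cross_add_right cross_mult_right)
      ultimately have "v$1 = 0" "v$2 = 0" unfolding 0 using nz by auto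
      then show "v = 0" by (simp add: vec_eq_iff forall_2)
    qed
  qed
qed

lemma normal_curvature_fundamental_forms:
  assumes "open U" "C_k_on 2 X U" "p \<in> U"
  defines "A \<equiv> pd e\<^sub>1 X p" and "B \<equiv> pd e\<^sub>2 X p"
    and "P \<equiv> pd e\<^sub>1 (pd e\<^sub>1 X) p" and "Q \<equiv> pd e\<^sub>1 (pd e\<^sub>2 X) p" and "R \<equiv> pd e\<^sub>2 (pd e\<^sub>2 X) p"
  shows "normal_curvature X p v =
    ((P \<bullet> unit_normal X p) * (v$1)\<^sup>2 + 2 * (Q \<bullet> unit_normal X p) * v$1 * v$2 + (R \<bullet> unit_normal X p) * (v$2)\<^sup>2) /
    ((A \<bullet> A) * (v$1)\<^sup>2 + 2 * (A \<bullet> B) * v$1 * v$2 + (B \<bullet> B) * (v$2)\<^sup>2)"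
proof -
  have diff: "X differentiable at x" "pd w X differentiable at x" if "x \<in> U" for x w
    using assms(2) that by (auto simp: numeral_2_eq_2)
  have comm: "pd e\<^sub>2 (pd e\<^sub>1 X) p = Q" unfolding Q_def by (rule pd_commute[OF assms(1-3)])
  have d1: "dir_deriv X v p = v$1 *\<^sub>R A + v$2 *\<^sub>R B"
    unfolding dir_deriv_def A_def B_def by (rule pd_vec2[OF diff(1)[OF assms(3)]])
  have "pd v (pd v X) p = pd v (\<lambda>x. v$1 *\<^sub>R pd e\<^sub>1 X x + v$2 *\<^sub>R pd e\<^sub>2 X x) p"
    by (rule pd_cong[OF assms(1,3)]) (rule pd_vec2[OF diff(1)])
  also have "\<dots> = v$1 *\<^sub>R pd v (pd e\<^sub>1 X) p + v$2 *\<^sub>R pd v (pd e\<^sub>2 X) p"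
    by (rule pd_eqI) (intro has_derivative_add has_derivative_scaleR_right diff[OF assms(3)]
        frechet_derivative_works[THEN iffD1])
  also have "\<dots> = v$1 *\<^sub>R (v$1 *\<^sub>R P + v$2 *\<^sub>R Q) + v$2 *\<^sub>R (v$1 *\<^sub>R Q + v$2 *\<^sub>R R)"
    using pd_vec2[OF diff(2)[OF assms(3)], of e\<^sub>1 v] pd_vec2[OF diff(2)[OF assms(3)], of e\<^sub>2 v] comm
    by (simp only: P_def Q_def R_def)
  finally have d2: "dir_deriv (dir_deriv X v) v p = \<dots>" by (simp add: dir_deriv_eq_pd)
  have n1: "(v $ 1 *\<^sub>R A + v $ 2 *\<^sub>R B) \<bullet> (v $ 1 *\<^sub>R A + v $ 2 *\<^sub>R B)
      = (A \<bullet> A) * (v$1)\<^sup>2 + 2 * (A \<bullet> B) * v$1 * v$2 + (B \<bullet> B) * (v$2)\<^sup>2"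
    by (simp add: inner_add_left inner_add_right inner_commute power2_eq_square algebra_simps)
  have n2: "(v$1 *\<^sub>R (v$1 *\<^sub>R P + v$2 *\<^sub>R Q) + v$2 *\<^sub>R (v$1 *\<^sub>R Q + v$2 *\<^sub>R R)) \<bullet> N
      = (P \<bullet> N) * (v$1)\<^sup>2 + 2 * (Q \<bullet> N) * v$1 * v$2 + (R \<bullet> N) * (v$2)\<^sup>2" for N
    by (simp only: inner_add_left inner_scaleR_left power2_eq_square) (simp add: algebra_simps)
  show ?thesis unfolding normal_curvature_def d1 d2 power2_norm_eq_inner n1 n2 ..
qed

text \<open>Trades the supremum and infimum over directions for algebra, which is what continuity
  arguments and explicit surfaces need.\<close>

lemma curvature_formulas:
  assumes "open U" "C_k_on 2 X U" "p \<in> U" "normal_field X p \<noteq> 0"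
  shows "mean_curvature X p = mean_of (pd e\<^sub>1 X p) (pd e\<^sub>2 X p) (pd e\<^sub>1 (pd e\<^sub>1 X) p) (pd e\<^sub>1 (pd e\<^sub>2 X) p) (pd e\<^sub>2 (pd e\<^sub>2 X) p)"
    and "gauss_curvature X p = gauss_of (pd e\<^sub>1 X p) (pd e\<^sub>2 X p) (pd e\<^sub>1 (pd e\<^sub>1 X) p) (pd e\<^sub>1 (pd e\<^sub>2 X) p) (pd e\<^sub>2 (pd e\<^sub>2 X) p)"
proof -
  define A B where "A = pd e\<^sub>1 X p" and "B = pd e\<^sub>2 X p"
  have N: "(norm (A \<times> B))\<^sup>2 = (A \<bullet> A) * (B \<bullet> B) - (A \<bullet> B)\<^sup>2" by (rule norm_cross_square)
  have nz: "A \<times> B \<noteq> 0" using assms(4) by (simp add: normal_field_pd A_def B_def)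
  then have "A \<noteq> 0" by auto
  then have 1: "A \<bullet> A > 0" by simp
  have 2: "(A \<bullet> A) * (B \<bullet> B) - (A \<bullet> B)\<^sup>2 > 0" unfolding N[symmetric] using nz by simp
  note q = quadratic_form_SUP_INF[OF 1 2]
  show "mean_curvature X p = mean_of (pd e\<^sub>1 X p) (pd e\<^sub>2 X p) (pd e\<^sub>1 (pd e\<^sub>1 X) p) (pd e\<^sub>1 (pd e\<^sub>2 X) p) (pd e\<^sub>2 (pd e\<^sub>2 X) p)"
    unfolding mean_curvature_def principal_curvature_max_def principal_curvature_min_def
      normal_curvature_fundamental_forms[OF assms(1-3)] A_def[symmetric] B_def[symmetric] q(1) mean_of_def N
    by (simp add: unit_normal_def normal_field_pd A_def B_def)
  show "gauss_curvature X p = gauss_of (pd e\<^sub>1 X p) (pd e\<^sub>2 X p) (pd e\<^sub>1 (pd e\<^sub>1 X) p) (pd e\<^sub>1 (pd e\<^sub>2 X) p) (pd e\<^sub>2 (pd e\<^sub>2 X) p)"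
    unfolding gauss_curvature_def principal_curvature_max_def principal_curvature_min_def
      normal_curvature_fundamental_forms[OF assms(1-3)] A_def[symmetric] B_def[symmetric] q(2) gauss_of_def N
    by (simp add: unit_normal_def normal_field_pd A_def B_def)
qed

section \<open>Change of parameters\<close>

lemma chain_rule_pd:
  fixes \<Psi> :: "real^2 \<Rightarrow> real^2" and f :: "real^2 \<Rightarrow> 'b::real_normed_vector"
  assumes "\<Psi> differentiable at p" "f differentiable at (\<Psi> p)"
  shows "((\<lambda>x. f (\<Psi> x)) has_derivative (\<lambda>v. pd (pd v \<Psi> p) f (\<Psi> p))) (at p)"
    and "pd v (\<lambda>x. f (\<Psi> x)) p = pd (pd v \<Psi> p) f (\<Psi> p)"
proof -
  show *: "((\<lambda>x. f (\<Psi> x)) has_derivative (\<lambda>v. pd (pd v \<Psi> p) f (\<Psi> p))) (at p)"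
    using diff_chain_at[of \<Psi> "frechet_derivative \<Psi> (at p)" p f] assms
    by (simp add: frechet_derivative_works o_def)
  show "pd v (\<lambda>x. f (\<Psi> x)) p = pd (pd v \<Psi> p) f (\<Psi> p)"
    by (rule pd_eqI[OF *])
qed

definition jac :: "(real^2 \<Rightarrow> real^2) \<Rightarrow> real^2 \<Rightarrow> real" where
  "jac \<Psi> p = pd e\<^sub>1 \<Psi> p $ 1 * pd e\<^sub>2 \<Psi> p $ 2 - pd e\<^sub>1 \<Psi> p $ 2 * pd e\<^sub>2 \<Psi> p $ 1"

lemma normal_field_reparam:
  assumes "\<Psi> differentiable at p" "X differentiable at (\<Psi> p)"
  shows "normal_field (\<lambda>x. X (\<Psi> x)) p = jac \<Psi> p *\<^sub>R normal_field X (\<Psi> p)"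
  unfolding normal_field_pd chain_rule_pd(2)[OF assms] jac_def
  using pd_vec2[OF assms(2), of "pd e\<^sub>1 \<Psi> p"] pd_vec2[OF assms(2), of "pd e\<^sub>2 \<Psi> p"]
    cross_skew[of "pd e\<^sub>2 X (\<Psi> p)" "pd e\<^sub>1 X (\<Psi> p)"]
  by (simp add: cross_add_left cross_add_right cross_mult_left cross_mult_right scaleR_diff_left mult.commute)

text \<open>The second derivative of the composition along v differs from that of X along T v only
  by the image under DX of the second derivative of \<Psi>. This vector is tangent, so the unit
  normal does not see it and normal curvatures correspond. T, the derivative of \<Psi>, maps the
  nonzero directions onto themselves, and a positive Jacobian keeps the orientation.\<close>

lemma principal_curvatures_reparam:
  assumes S: "open S" "C_k_on 2 \<Psi> S" "p \<in> S" and U: "open U" "C_k_on 2 X U"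
    and maps: "\<And>x. x \<in> S \<Longrightarrow> \<Psi> x \<in> U" and jac: "jac \<Psi> p > 0"
  shows "principal_curvature_max (\<lambda>x. X (\<Psi> x)) p = principal_curvature_max X (\<Psi> p)"
    and "principal_curvature_min (\<lambda>x. X (\<Psi> x)) p = principal_curvature_min X (\<Psi> p)"
proof -
  have dX: "X differentiable at x" "pd w X differentiable at x" if "x \<in> U" for x w
    using U(2) that by (auto simp: numeral_2_eq_2)
  have dPsi: "\<Psi> differentiable at x" "pd w \<Psi> differentiable at x" if "x \<in> S" for x w
    using S(2) that by (auto simp: numeral_2_eq_2)
  note d = dPsi[OF S(3)] dX[OF maps[OF S(3)]]
  have \<nu>: "unit_normal (\<lambda>x. X (\<Psi> x)) p = unit_normal X (\<Psi> p)"
    using jac by (simp add: unit_normal_def normal_field_reparam[OF d(1,3)] sgn_scaleR)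
  define T where "T v = pd v \<Psi> p" for v
  have linT: "linear T" unfolding T_def using linear_frechet_derivative[OF d(1)] by simp
  have tang: "pd w X (\<Psi> p) \<bullet> unit_normal X (\<Psi> p) = 0" for w
    using pd_vec2[OF d(3), of w]
    by (simp add: unit_normal_def normal_field_pd sgn_div_norm inner_add_left dot_cross_self)
  have nc: "normal_curvature (\<lambda>x. X (\<Psi> x)) p v = normal_curvature X (\<Psi> p) (T v)" for v
  proof -
    define w where "w = T v"
    have 1: "dir_deriv (\<lambda>x. X (\<Psi> x)) v x = pd (pd v \<Psi> x) X (\<Psi> x)" if "x \<in> S" for x
      unfolding dir_deriv_def by (rule chain_rule_pd(2)[OF dPsi(1)[OF that] dX(1)[OF maps[OF that]]])
    have "pd v (dir_deriv (\<lambda>x. X (\<Psi> x)) v) p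
        = pd v (\<lambda>x. pd v \<Psi> x $ 1 *\<^sub>R pd e\<^sub>1 X (\<Psi> x) + pd v \<Psi> x $ 2 *\<^sub>R pd e\<^sub>2 X (\<Psi> x)) p"
    proof (rule pd_cong[OF S(1,3)])
      show "dir_deriv (\<lambda>x. X (\<Psi> x)) v x = pd v \<Psi> x $ 1 *\<^sub>R pd e\<^sub>1 X (\<Psi> x) + pd v \<Psi> x $ 2 *\<^sub>R pd e\<^sub>2 X (\<Psi> x)"
        if "x \<in> S" for x
        unfolding 1[OF that] by (rule pd_vec2[OF dX(1)[OF maps[OF that]]])
    qed
    also have "\<dots> = (pd v \<Psi> p $ 1 *\<^sub>R pd w (pd e\<^sub>1 X) (\<Psi> p) + pd v (pd v \<Psi>) p $ 1 *\<^sub>R pd e\<^sub>1 X (\<Psi> p))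
        + (pd v \<Psi> p $ 2 *\<^sub>R pd w (pd e\<^sub>2 X) (\<Psi> p) + pd v (pd v \<Psi>) p $ 2 *\<^sub>R pd e\<^sub>2 X (\<Psi> p))"
      unfolding w_def T_def
      by (rule pd_eqI) (intro has_derivative_add has_derivative_scaleR
          bounded_linear.has_derivative[OF bounded_linear_vec_nth] chain_rule_pd(1)[OF d(1) d(4)]
          frechet_derivative_works[THEN iffD1] d)
    also have "\<dots> = (w $ 1 *\<^sub>R pd w (pd e\<^sub>1 X) (\<Psi> p) + w $ 2 *\<^sub>R pd w (pd e\<^sub>2 X) (\<Psi> p)) + pd (pd v (pd v \<Psi>) p) X (\<Psi> p)"
      unfolding pd_vec2[OF d(3), of "pd v (pd v \<Psi>) p"] by (simp add: w_def T_def)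
    also have "w $ 1 *\<^sub>R pd w (pd e\<^sub>1 X) (\<Psi> p) + w $ 2 *\<^sub>R pd w (pd e\<^sub>2 X) (\<Psi> p) = pd w (pd w X) (\<Psi> p)"
    proof -
      have "pd w (pd w X) (\<Psi> p) = pd w (\<lambda>x. w$1 *\<^sub>R pd e\<^sub>1 X x + w$2 *\<^sub>R pd e\<^sub>2 X x) (\<Psi> p)"
        by (rule pd_cong[OF U(1) maps[OF S(3)]]) (rule pd_vec2[OF dX(1)])
      also have "\<dots> = w $ 1 *\<^sub>R pd w (pd e\<^sub>1 X) (\<Psi> p) + w $ 2 *\<^sub>R pd w (pd e\<^sub>2 X) (\<Psi> p)"
        by (rule pd_eqI) (intro has_derivative_add has_derivative_scaleR_right d frechet_derivative_works[THEN iffD1])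
      finally show ?thesis by simp
    qed
    finally have "dir_deriv (dir_deriv (\<lambda>x. X (\<Psi> x)) v) v p \<bullet> unit_normal X (\<Psi> p)
        = dir_deriv (dir_deriv X w) w (\<Psi> p) \<bullet> unit_normal X (\<Psi> p)"
      by (simp add: dir_deriv_eq_pd inner_add_left tang)
    moreover have "dir_deriv (\<lambda>x. X (\<Psi> x)) v p = dir_deriv X w (\<Psi> p)"
      unfolding 1[OF S(3)] by (simp add: dir_deriv_def w_def T_def)
    ultimately show ?thesis unfolding normal_curvature_def \<nu> w_def[symmetric] by simp
  qed
  have im: "T ` (-{0}) = -{0}"
  proof -
    have T: "T v = v$1 *\<^sub>R T e\<^sub>1 + v$2 *\<^sub>R T e\<^sub>2" for v by (rule linear_vec2[OF linT])
    have j: "jac \<Psi> p = T e\<^sub>1 $ 1 * T e\<^sub>2 $ 2 - T e\<^sub>1 $ 2 * T e\<^sub>2 $ 1" by (simp add: jac_def T_def)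
    have inj: "v = 0" if "T v = 0" for v
    proof -
      have "v$1 * T e\<^sub>1 $ 1 + v$2 * T e\<^sub>2 $ 1 = 0" "v$1 * T e\<^sub>1 $ 2 + v$2 * T e\<^sub>2 $ 2 = 0"
        using T[of v] that by (auto simp: vec_eq_iff forall_2)
      then have "v$1 * jac \<Psi> p = 0" "v$2 * jac \<Psi> p = 0" unfolding j by algebra+
      then show "v = 0" using jac by (simp add: vec_eq_iff forall_2)
    qed
    then have "inj T" using linear_injective_0[OF linT] by blast
    then have "surj T" using linear_injective_imp_surjective[OF linT] by blast
    show ?thesis
    proof (intro equalityI subsetI)
      fix y assume "y \<in> -{0::real^2}"
      moreover obtain x where "y = T x" using \<open>surj T\<close> by (metis surjD)
      ultimately show "y \<in> T ` (-{0})" using linear_0[OF linT] by (intro image_eqI[of _ _ x]) auto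
    qed (use inj in auto)
  qed
  have im2: "normal_curvature (\<lambda>x. X (\<Psi> x)) p ` (-{0}) = normal_curvature X (\<Psi> p) ` (-{0})"
    using nc by (subst im[symmetric]) (simp add: image_image)
  show "principal_curvature_max (\<lambda>x. X (\<Psi> x)) p = principal_curvature_max X (\<Psi> p)"
    "principal_curvature_min (\<lambda>x. X (\<Psi> x)) p = principal_curvature_min X (\<Psi> p)"
    unfolding principal_curvature_max_def principal_curvature_min_def im2 by simp_all
qed

section \<open>Fenchel's theorem\<close>

text \<open>The norm comes from Lagrange's identity and yields the curvature |\<gamma>' \<times>
  \<gamma>''| / |\<gamma>'|^3. The explicit vector U serves where its continuity or its cross
  product with f is wanted.\<close>

lemma has_vector_derivative_sgn:
  fixes f :: "real \<Rightarrow> real^3"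
  assumes f: "(f has_vector_derivative f') (at t)" and nz: "f t \<noteq> 0"
  shows "\<exists>U. ((\<lambda>s. sgn (f s)) has_vector_derivative U) (at t) \<and> norm U = norm (f t \<times> f') / (norm (f t))\<^sup>2
    \<and> U = (1 / norm (f t)) *\<^sub>R f' - ((f t \<bullet> f') / norm (f t) ^ 3) *\<^sub>R f t"
proof -
  define n where "n = norm (f t)"
  define U where "U = (1 / n) *\<^sub>R f' - ((f t \<bullet> f') / n ^ 3) *\<^sub>R f t"
  have n: "n > 0" using nz by (simp add: n_def)
  have fd: "(f has_derivative (\<lambda>h. h *\<^sub>R f')) (at t)" using f by (simp add: has_vector_derivative_def)
  have nd: "((\<lambda>s. norm (f s)) has_real_derivative (f t \<bullet> f') / n) (at t)"
    unfolding has_field_derivative_def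
    by (rule has_derivative_eq_rhs[OF diff_chain_at[OF fd has_derivative_norm[OF nz], unfolded o_def]])
       (simp add: fun_eq_iff sgn_div_norm n_def divide_inverse inner_commute mult_ac)
  have "((\<lambda>s. inverse (norm (f s))) has_real_derivative - ((f t \<bullet> f') / n ^ 3)) (at t)"
    using DERIV_inverse_fun[OF nd] nz n by (simp add: n_def field_simps power2_eq_square power3_eq_cube)
  then have "((\<lambda>s. inverse (norm (f s)) *\<^sub>R f s) has_vector_derivative U) (at t)"
    by (rule has_vector_derivative_scaleR[OF _ f, THEN has_vector_derivative_eq_rhs])
       (simp add: U_def n_def inverse_eq_divide)
  then have "((\<lambda>s. sgn (f s)) has_vector_derivative U) (at t)" by (simp add: sgn_div_norm)
  moreover have "norm U = norm (f t \<times> f') / n\<^sup>2"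
  proof (rule power2_eq_imp_eq)
    have ff: "f t \<bullet> f t = n\<^sup>2" by (simp add: n_def power2_norm_eq_inner)
    have "(norm U)\<^sup>2 = (1 / n)\<^sup>2 * (f' \<bullet> f') - 2 * (1 / n) * ((f t \<bullet> f') / n ^ 3) * (f t \<bullet> f')
        + ((f t \<bullet> f') / n ^ 3)\<^sup>2 * n\<^sup>2"
    proof -
      have "(c *\<^sub>R f' - d *\<^sub>R f t) \<bullet> (c *\<^sub>R f' - d *\<^sub>R f t) = c\<^sup>2 * (f' \<bullet> f') - 2 * c * d * (f t \<bullet> f') + d\<^sup>2 * n\<^sup>2" for c d
        by (simp add: inner_diff_left inner_diff_right inner_commute[of f' "f t"] ff power2_eq_square algebra_simps)
      then show ?thesis unfolding power2_norm_eq_inner U_def .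
    qed
    also have "\<dots> = (n\<^sup>2 * (f' \<bullet> f') - (f t \<bullet> f')\<^sup>2) / n ^ 4"
      using n by (simp add: field_simps power2_eq_square eval_nat_numeral)
    also have "n\<^sup>2 * (f' \<bullet> f') - (f t \<bullet> f')\<^sup>2 = (norm (f t \<times> f'))\<^sup>2"
      unfolding norm_cross_square ff ..
    finally show "(norm U)\<^sup>2 = (norm (f t \<times> f') / n\<^sup>2)\<^sup>2"
      by (simp add: power_divide)
  qed (use n in auto)
  ultimately show ?thesis unfolding U_def n_def by blast
qed

text \<open>Formulated near a single parameter, because the boundary curves of the stretched
  surfaces are known explicitly only on arcs.\<close>

lemma curve_formulas:
  assumes T: "open T" "t \<in> T" "\<And>s. s \<in> T \<Longrightarrow> (\<gamma> has_vector_derivative \<gamma>1 s) (at s)"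
    and 2: "(\<gamma>1 has_vector_derivative \<gamma>2) (at t)" and nz: "\<gamma>1 t \<noteq> 0"
  shows "speed \<gamma> t = norm (\<gamma>1 t)" and "curve_curvature \<gamma> t = norm (\<gamma>1 t \<times> \<gamma>2) / norm (\<gamma>1 t) ^ 3"
    and "vector_derivative \<gamma> (at t) = \<gamma>1 t"
    and "vector_derivative (\<lambda>s. vector_derivative \<gamma> (at s)) (at t) = \<gamma>2"
proof -
  have vd: "vector_derivative \<gamma> (at s) = \<gamma>1 s" if "s \<in> T" for s
    using T(3)[OF that] by (rule vector_derivative_at)
  then show "vector_derivative \<gamma> (at t) = \<gamma>1 t" and sp: "speed \<gamma> t = norm (\<gamma>1 t)"
    using T by (auto simp: speed_def)
  have "((\<lambda>s. vector_derivative \<gamma> (at s)) has_vector_derivative \<gamma>2) (at t)"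
    by (rule has_vector_derivative_transform_within_open[OF 2 T(1,2)]) (simp add: vd)
  then show "vector_derivative (\<lambda>s. vector_derivative \<gamma> (at s)) (at t) = \<gamma>2"
    by (rule vector_derivative_at)
  obtain U where U: "((\<lambda>s. sgn (\<gamma>1 s)) has_vector_derivative U) (at t)"
    "norm U = norm (\<gamma>1 t \<times> \<gamma>2) / (norm (\<gamma>1 t))\<^sup>2"
    using has_vector_derivative_sgn[OF 2 nz] by blast
  have "(unit_tangent \<gamma> has_vector_derivative U) (at t)"
    by (rule has_vector_derivative_transform_within_open[OF U(1) T(1,2)]) (simp add: vd unit_tangent_def)
  then have "vector_derivative (unit_tangent \<gamma>) (at t) = U" by (rule vector_derivative_at)
  then show "curve_curvature \<gamma> t = norm (\<gamma>1 t \<times> \<gamma>2) / norm (\<gamma>1 t) ^ 3"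
    by (simp add: curve_curvature_def sp U(2) power2_eq_square power3_eq_cube)
qed

text \<open>arccos (A \<bullet> T) is the spherical distance from A, which changes at most as fast
  as T moves. Since arccos is not differentiable at 1 and -1, the estimate is made for arccos (c (A
  \<bullet> T)) with 0 < c < 1, and then c tends to 1.\<close>

lemma spherical_distance_le_length:
  fixes T :: "real \<Rightarrow> 'a::real_inner"
  assumes "s \<le> t" and T: "\<And>x. x \<in> {s..t} \<Longrightarrow> (T has_vector_derivative T' x) (at x)"
    and unit: "\<And>x. x \<in> {s..t} \<Longrightarrow> T x \<bullet> T x = 1" and orth: "\<And>x. x \<in> {s..t} \<Longrightarrow> T x \<bullet> T' x = 0"
    and cont: "continuous_on {s..t} T'" and A: "A \<bullet> A = 1"
  shows "\<bar>arccos (A \<bullet> T t) - arccos (A \<bullet> T s)\<bar> \<le> integral {s..t} (\<lambda>x. norm (T' x))"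
proof -
  define f where "f x = A \<bullet> T x" for x
  have f1: "\<bar>f x\<bar> \<le> 1" if "x \<in> {s..t}" for x
    using Cauchy_Schwarz_ineq2[of A "T x"] A unit[OF that] by (simp add: f_def norm_eq_sqrt_inner)
  have bound: "\<bar>arccos (c * f t) - arccos (c * f s)\<bar> \<le> integral {s..t} (\<lambda>x. norm (T' x))" if c: "0 < c" "c < 1" for c
  proof -
    define D where "D x = c * (A \<bullet> T' x) * inverse (- sqrt (1 - (c * f x)\<^sup>2))" for x
    have lt: "\<bar>c * f x\<bar> < 1" if "x \<in> {s..t}" for x
    proof -
      have "\<bar>c * f x\<bar> \<le> c" using f1[OF that] c by (simp add: abs_mult mult_left_le)
      then show ?thesis using c by linarith
    qed
    have der: "((\<lambda>x. arccos (c * f x)) has_real_derivative D x) (at x)" if "x \<in> {s..t}" for x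
    proof -
      have "((\<lambda>x. A \<bullet> T x) has_derivative (\<lambda>h. A \<bullet> (h *\<^sub>R T' x))) (at x)"
        using T[OF that] unfolding has_vector_derivative_def by (rule has_derivative_inner_right)
      then have "(f has_real_derivative (A \<bullet> T' x)) (at x)"
        unfolding f_def has_field_derivative_def by (simp add: mult_commute_abs)
      then have "((\<lambda>x. c * f x) has_real_derivative c * (A \<bullet> T' x)) (at x)" by (rule DERIV_cmult)
      from DERIV_chain2[OF DERIV_arccos this] lt[OF that]
      show ?thesis by (simp add: D_def mult.commute)
    qed
    have le: "\<bar>D x\<bar> \<le> norm (T' x)" if "x \<in> {s..t}" for x
    proof -
      have "(norm (A - f x *\<^sub>R T x))\<^sup>2 = 1 - (f x)\<^sup>2"
        unfolding power2_norm_eq_inner using A unit[OF that]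
        by (simp add: inner_diff_left inner_diff_right f_def inner_commute power2_eq_square)
      moreover have "c * c * (f x * f x) \<le> 1 * (f x * f x)"
        using c by (intro mult_right_mono) (auto simp: mult_le_one)
      ultimately have "(norm (A - f x *\<^sub>R T x))\<^sup>2 \<le> 1 - (c * f x)\<^sup>2" by (simp add: power2_eq_square algebra_simps)
      then have nle: "norm (A - f x *\<^sub>R T x) \<le> sqrt (1 - (c * f x)\<^sup>2)" by (rule real_le_rsqrt)
      have pos: "sqrt (1 - (c * f x)\<^sup>2) > 0" using lt[OF that] by (simp add: abs_square_less_1)
      \<comment> \<open>T' is orthogonal to T, so only the part of A orthogonal to T counts; its
        length sqrt (1 - f^2) is at most sqrt (1 - c^2 f^2).\<close>
      have "A \<bullet> T' x = (A - f x *\<^sub>R T x) \<bullet> T' x" using orth[OF that] by (simp add: inner_diff_left)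
      then have "\<bar>A \<bullet> T' x\<bar> \<le> norm (A - f x *\<^sub>R T x) * norm (T' x)"
        using Cauchy_Schwarz_ineq2 by metis
      also have "\<dots> \<le> sqrt (1 - (c * f x)\<^sup>2) * norm (T' x)" using nle by (rule mult_right_mono) simp
      finally have "\<bar>A \<bullet> T' x\<bar> / sqrt (1 - (c * f x)\<^sup>2) \<le> norm (T' x)"
        using pos by (simp add: divide_le_eq mult.commute)
      moreover have "\<bar>D x\<bar> = c * (\<bar>A \<bullet> T' x\<bar> / sqrt (1 - (c * f x)\<^sup>2))"
        using c pos by (simp add: D_def abs_mult divide_inverse)
      moreover have "\<dots> \<le> 1 * (\<bar>A \<bullet> T' x\<bar> / sqrt (1 - (c * f x)\<^sup>2))"
        using c pos by (intro mult_right_mono) auto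
      ultimately show ?thesis by linarith
    qed
    have "(D has_integral (arccos (c * f t) - arccos (c * f s))) {s..t}"
      using der by (intro fundamental_theorem_of_calculus assms(1))
         (auto simp: has_real_derivative_iff_has_vector_derivative intro: has_vector_derivative_at_within)
    then have "integral {s..t} D = arccos (c * f t) - arccos (c * f s)" "D integrable_on {s..t}"
      by (auto simp: has_integral_integrable)
    then show ?thesis
      using integral_norm_bound_integral[of D "{s..t}" "\<lambda>x. norm (T' x)"] le cont
      by (auto simp: integrable_continuous_interval continuous_on_norm)
  qed
  define c where "c n = 1 - inverse (real (Suc (Suc n)))" for n
  have c: "0 < c n" "c n < 1" for n by (auto simp: c_def field_simps)
  have c1: "c \<longlonglongrightarrow> 1"
    unfolding c_def using LIMSEQ_Suc[OF LIMSEQ_inverse_real_of_nat] by (auto intro: tendsto_eq_intros)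
  have lim: "(\<lambda>n. arccos (c n * f x)) \<longlonglongrightarrow> arccos (f x)" if "x \<in> {s..t}" for x
  proof (rule continuous_on_tendsto_compose[OF continuous_on_arccos'])
    show "(\<lambda>n. c n * f x) \<longlonglongrightarrow> f x" using tendsto_mult_right[OF c1, of "f x"] by simp
    show "f x \<in> {- 1..1}" using f1[OF that] by auto
    have "\<bar>c n * f x\<bar> \<le> 1" for n using f1[OF that] c[of n] by (simp add: abs_mult mult_le_one)
    then show "\<forall>\<^sub>F n in sequentially. c n * f x \<in> {- 1..1}" by (auto simp: abs_le_iff minus_le_iff)
  qed
  have "(\<lambda>n. \<bar>arccos (c n * f t) - arccos (c n * f s)\<bar>) \<longlonglongrightarrow> \<bar>arccos (f t) - arccos (f s)\<bar>"
    using assms(1) by (intro tendsto_intros lim) auto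
  then show ?thesis
    unfolding f_def[symmetric] by (rule LIMSEQ_le_const2) (use bound c in blast)
qed

text \<open>The unit tangents form a closed curve on the sphere whose length is the total curvature.
  If it is shorter than 2 pi, halve it at A = T 0 and B = T m: the distances of T t to A and B add
  up to less than pi, so T t lies in the open hemisphere around A + B for every t. Then (A + B)
  \<bullet> \<gamma> increases strictly, which a closed curve forbids.\<close>

theorem fenchel:
  fixes \<gamma> :: "real \<Rightarrow> real^3"
  assumes "0 < l"
    and 1: "\<And>t. t \<in> {0..l} \<Longrightarrow> (\<gamma> has_vector_derivative \<gamma>1 t) (at t)"
    and 2: "\<And>t. t \<in> {0..l} \<Longrightarrow> (\<gamma>1 has_vector_derivative \<gamma>2 t) (at t)"
    and cont: "continuous_on {0..l} \<gamma>2" and nz: "\<And>t. t \<in> {0..l} \<Longrightarrow> \<gamma>1 t \<noteq> 0"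
    and closed: "\<gamma> l = \<gamma> 0" "\<gamma>1 l = \<gamma>1 0"
  shows "2 * pi \<le> integral {0..l} (\<lambda>t. norm (\<gamma>1 t \<times> \<gamma>2 t) / (norm (\<gamma>1 t))\<^sup>2)"
proof (rule ccontr)
  define T where "T t = sgn (\<gamma>1 t)" for t
  define T' where "T' t = (1 / norm (\<gamma>1 t)) *\<^sub>R \<gamma>2 t - ((\<gamma>1 t \<bullet> \<gamma>2 t) / norm (\<gamma>1 t) ^ 3) *\<^sub>R \<gamma>1 t" for t
  have T: "(T has_vector_derivative T' t) (at t)"
    and nT': "norm (T' t) = norm (\<gamma>1 t \<times> \<gamma>2 t) / (norm (\<gamma>1 t))\<^sup>2" if "t \<in> {0..l}" for t
    using has_vector_derivative_sgn[OF 2[OF that] nz[OF that]] unfolding T_def T'_def by auto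
  have contg1: "continuous_on {0..l} \<gamma>1"
    using 2 by (intro continuous_at_imp_continuous_on ballI has_vector_derivative_continuous)
  have contT': "continuous_on {0..l} T'"
    unfolding T'_def using contg1 cont nz by (intro continuous_intros) auto
  have unit: "T t \<bullet> T t = 1" if "t \<in> {0..l}" for t
    using nz[OF that] by (simp add: T_def power2_norm_eq_inner[symmetric] norm_sgn)
  have orth: "T t \<bullet> T' t = 0" if "t \<in> {0..l}" for t
  proof -
    have "\<gamma>1 t \<bullet> T' t = (\<gamma>1 t \<bullet> \<gamma>2 t) / norm (\<gamma>1 t) - (\<gamma>1 t \<bullet> \<gamma>2 t) / norm (\<gamma>1 t) ^ 3 * (norm (\<gamma>1 t))\<^sup>2"
      by (simp add: T'_def inner_diff_right power2_norm_eq_inner)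
    also have "\<dots> = 0" using nz[OF that] by (simp add: power2_eq_square power3_eq_cube)
    finally show ?thesis by (simp add: T_def sgn_div_norm)
  qed
  define \<Phi> where "\<Phi> t = integral {0..t} (\<lambda>x. norm (T' x))" for t
  define L where "L = \<Phi> l"
  have int: "(\<lambda>x. norm (T' x)) integrable_on {0..l}"
    using contT' by (intro integrable_continuous_interval continuous_on_norm)
  have sub: "integral {s..t} (\<lambda>x. norm (T' x)) = \<Phi> t - \<Phi> s" if "0 \<le> s" "s \<le> t" "t \<le> l" for s t
  proof -
    have "(\<lambda>x. norm (T' x)) integrable_on {0..t}"
      by (rule integrable_on_subinterval[OF int]) (use that in auto)
    then show ?thesis
      using Henstock_Kurzweil_Integration.integral_combine[of 0 s t "\<lambda>x. norm (T' x)"] that by (simp add: \<Phi>_def)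
  qed
  assume "\<not> ?thesis"
  moreover have "integral {0..l} (\<lambda>t. norm (\<gamma>1 t \<times> \<gamma>2 t) / (norm (\<gamma>1 t))\<^sup>2) = L"
    unfolding L_def \<Phi>_def by (rule integral_cong) (simp add: nT')
  ultimately have L: "L < 2 * pi" by simp
  have "continuous_on {0..l} \<Phi>"
    unfolding \<Phi>_def by (rule indefinite_integral_continuous_1[OF int])
  moreover have "L \<ge> 0" unfolding L_def \<Phi>_def by (rule integral_nonneg[OF int]) simp
  moreover have "\<Phi> 0 = 0" by (simp add: \<Phi>_def)
  ultimately obtain m where m: "0 \<le> m" "m \<le> l" "\<Phi> m = L / 2"
    using IVT'[of \<Phi> 0 "L / 2" l] \<open>0 < l\<close> L_def by auto
  have dist: "arccos (T s \<bullet> T t) \<le> \<Phi> t - \<Phi> s" if "0 \<le> s" "s \<le> t" "t \<le> l" for s t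
  proof -
    have "\<bar>arccos (T s \<bullet> T t) - arccos (T s \<bullet> T s)\<bar> \<le> integral {s..t} (\<lambda>x. norm (T' x))"
      using that by (intro spherical_distance_le_length T unit orth continuous_on_subset[OF contT']) auto
    then show ?thesis unfolding sub[OF that] using unit[of s] that by simp
  qed
  have Tl: "T l = T 0" by (simp add: T_def closed)
  define A B where "A = T 0" and "B = T m"
  have "(A + B) \<bullet> T t > 0" if t: "t \<in> {0..l}" for t
  proof -
    have 1: "\<bar>A \<bullet> T t\<bar> \<le> 1" "\<bar>B \<bullet> T t\<bar> \<le> 1"
      using Cauchy_Schwarz_ineq2[of A "T t"] Cauchy_Schwarz_ineq2[of B "T t"] unit[OF t] unit[of 0] unit[of m] m \<open>0 < l\<close>
      by (auto simp: A_def B_def norm_eq_sqrt_inner)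
    define a b where "a = arccos (A \<bullet> T t)" and "b = arccos (B \<bullet> T t)"
    have ab: "cos a = A \<bullet> T t" "cos b = B \<bullet> T t" "0 \<le> a" "0 \<le> b" "b \<le> pi"
      using 1 by (auto simp: a_def b_def cos_arccos_abs arccos_lbound arccos_ubound)
    \<comment> \<open>As T l = T 0, the points A and B are joined by two arcs of length L / 2, and T
      t lies on one of them.\<close>
    have "a + b \<le> L / 2"
    proof (cases "t \<le> m")
      case True
      have "\<Phi> 0 = 0" by (simp add: \<Phi>_def)
      then show ?thesis using dist[of 0 t] dist[of t m] True t m by (simp add: a_def b_def A_def B_def inner_commute)
    next
      case False
      then show ?thesis using dist[of t l] dist[of m t] t m Tl
        by (simp add: a_def b_def A_def B_def inner_commute L_def)
    qed
    then have "a < pi - b" using L by simp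
    then have "cos (pi - b) < cos a" using ab by (intro cos_monotone_0_pi) auto
    then show ?thesis using ab by (simp add: inner_add_left)
  qed
  then have pos: "(A + B) \<bullet> \<gamma>1 t > 0" if "t \<in> {0..l}" for t
    using that nz[OF that] by (simp add: T_def sgn_div_norm zero_less_mult_iff)
  have "((\<lambda>t. (A + B) \<bullet> \<gamma> t) has_real_derivative (A + B) \<bullet> \<gamma>1 t) (at t)" if "t \<in> {0..l}" for t
    using has_derivative_inner_right[OF 1[OF that, unfolded has_vector_derivative_def], of "A + B"]
    by (simp add: has_field_derivative_def mult_commute_abs)
  then obtain \<xi> where "0 < \<xi>" "\<xi> < l" "(A + B) \<bullet> \<gamma> l - (A + B) \<bullet> \<gamma> 0 = (l - 0) * ((A + B) \<bullet> \<gamma>1 \<xi>)"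
    using MVT2[OF \<open>0 < l\<close>, of "\<lambda>t. (A + B) \<bullet> \<gamma> t" "\<lambda>t. (A + B) \<bullet> \<gamma>1 t"] by auto
  then show False using pos[of \<xi>] closed \<open>0 < l\<close> by simp
qed

section \<open>The Gauss-Bonnet formula for annuli\<close>

text \<open>The right-hand side is the Gram determinant of x, y, z.\<close>

lemma triple_product_gram:
  fixes x y z :: "real^3"
  shows "(x \<bullet> (y \<times> z))\<^sup>2 = (x \<bullet> x) * (y \<bullet> y) * (z \<bullet> z) + 2 * (x \<bullet> y) * (y \<bullet> z) * (x \<bullet> z)
     - (x \<bullet> x) * (y \<bullet> z)\<^sup>2 - (y \<bullet> y) * (x \<bullet> z)\<^sup>2 - (z \<bullet> z) * (x \<bullet> y)\<^sup>2"
  unfolding cross3_def inner_vec_def sum_3 vector_3 inner_real_def by algebra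

lemma orthonormal_expansion:
  fixes e \<nu> x :: "real^3"
  assumes "e \<bullet> e = 1" "\<nu> \<bullet> \<nu> = 1" "e \<bullet> \<nu> = 0"
  shows "x = (x \<bullet> e) *\<^sub>R e + (x \<bullet> (\<nu> \<times> e)) *\<^sub>R (\<nu> \<times> e) + (x \<bullet> \<nu>) *\<^sub>R \<nu>"
proof -
  define f where "f = \<nu> \<times> e"
  have o: "f \<bullet> e = 0" "f \<bullet> \<nu> = 0" by (simp_all add: f_def dot_cross_self)
  have ff: "f \<bullet> f = 1"
    using norm_cross_square[of \<nu> e] assms by (simp add: f_def power2_norm_eq_inner inner_commute)
  define d where "d = x - ((x \<bullet> e) *\<^sub>R e + (x \<bullet> f) *\<^sub>R f + (x \<bullet> \<nu>) *\<^sub>R \<nu>)"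
  have "d \<bullet> d = x \<bullet> x - (x \<bullet> e)\<^sup>2 - (x \<bullet> f)\<^sup>2 - (x \<bullet> \<nu>)\<^sup>2"
    using assms o ff by (simp add: d_def inner_diff_left inner_diff_right inner_add_left inner_add_right
        inner_commute power2_eq_square algebra_simps)
  also have "(x \<bullet> f)\<^sup>2 = x \<bullet> x - (x \<bullet> e)\<^sup>2 - (x \<bullet> \<nu>)\<^sup>2"
    unfolding f_def triple_product_gram using assms by (simp add: inner_commute)
  finally have "d = 0" by simp
  then show ?thesis by (simp add: d_def f_def)
qed

text \<open>The pointwise algebra of d\<omega> = - K dA for the connection form \<omega>: the left
  side is d\<omega> once the mixed second derivatives have cancelled, the right side minus the area
  form of the sphere pulled back by the Gauss map. In the frame e, \<nu> \<times> e, \<nu> each of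
  the four derivative vectors has only two components, and \<open>mix\<close> identifies those along
  \<nu> with those along e up to sign.\<close>

lemma frame_identity:
  fixes e \<nu> e\<rho> e\<theta> \<nu>\<rho> \<nu>\<theta> :: "real^3"
  assumes on: "e \<bullet> e = 1" "\<nu> \<bullet> \<nu> = 1" "e \<bullet> \<nu> = 0"
    and e: "e \<bullet> e\<rho> = 0" "e \<bullet> e\<theta> = 0" and \<nu>: "\<nu> \<bullet> \<nu>\<rho> = 0" "\<nu> \<bullet> \<nu>\<theta> = 0"
    and mix: "e\<rho> \<bullet> \<nu> = - (e \<bullet> \<nu>\<rho>)" "e\<theta> \<bullet> \<nu> = - (e \<bullet> \<nu>\<theta>)"
  shows "\<nu>\<rho> \<bullet> (e \<times> e\<theta>) - \<nu>\<theta> \<bullet> (e \<times> e\<rho>) + 2 * (\<nu> \<bullet> (e\<rho> \<times> e\<theta>)) = - (\<nu> \<bullet> (\<nu>\<rho> \<times> \<nu>\<theta>))"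
proof -
  define f where "f = \<nu> \<times> e"
  have o: "f \<bullet> e = 0" "f \<bullet> \<nu> = 0" "e \<bullet> f = 0" "\<nu> \<bullet> f = 0" "\<nu> \<bullet> e = 0"
    using on by (simp_all add: f_def dot_cross_self inner_commute)
  have ff: "f \<bullet> f = 1"
    using norm_cross_square[of \<nu> e] on by (simp add: f_def power2_norm_eq_inner inner_commute)
  have ef: "e \<times> f = \<nu>" "f \<times> e = - \<nu>"
    using on o cross_skew[of f e] by (simp_all add: f_def Lagrange)
  have f\<nu>: "\<nu> \<times> f = - e" "f \<times> \<nu> = e"
    using on o cross_skew[of f \<nu>] by (simp_all add: f_def Lagrange)
  have e\<nu>: "\<nu> \<times> e = f" "e \<times> \<nu> = - f" using cross_skew[of e \<nu>] by (simp_all add: f_def)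
  note ex = orthonormal_expansion[OF on, folded f_def]
  define g1 a1 where "g1 = e\<rho> \<bullet> f" and "a1 = e\<rho> \<bullet> \<nu>"
  define g2 a2 where "g2 = e\<theta> \<bullet> f" and "a2 = e\<theta> \<bullet> \<nu>"
  define c1 c2 where "c1 = \<nu>\<rho> \<bullet> f" and "c2 = \<nu>\<theta> \<bullet> f"
  have 1: "e\<rho> = g1 *\<^sub>R f + a1 *\<^sub>R \<nu>" using ex[of e\<rho>] e by (simp add: g1_def a1_def inner_commute)
  have 2: "e\<theta> = g2 *\<^sub>R f + a2 *\<^sub>R \<nu>" using ex[of e\<theta>] e by (simp add: g2_def a2_def inner_commute)
  have 3: "\<nu>\<rho> = c1 *\<^sub>R f - a1 *\<^sub>R e" using ex[of \<nu>\<rho>] \<nu> mix by (simp add: c1_def a1_def inner_commute add.commute)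
  have 4: "\<nu>\<theta> = c2 *\<^sub>R f - a2 *\<^sub>R e" using ex[of \<nu>\<theta>] \<nu> mix by (simp add: c2_def a2_def inner_commute add.commute)
  show ?thesis unfolding 1 2 3 4
    by (simp add: Cross3.left_diff_distrib Cross3.right_diff_distrib cross_add_left cross_add_right cross_mult_left cross_mult_right
        ef f\<nu> e\<nu> inner_add_left inner_add_right inner_diff_left inner_diff_right on o ff algebra_simps)
qed

lemma pd_shift:
  assumes "\<And>x. f (x + c) = f x"
  shows "pd v f (p + c) = pd v f p"
proof -
  have 1: "((\<lambda>x. x + c) has_derivative (\<lambda>x. x)) (at y)" "((\<lambda>x. x - c) has_derivative (\<lambda>x. x)) (at y)" for y
    by (auto intro!: derivative_eq_intros)
  have inv: "f (x - c) = f x" for x using assms[of "x - c"] by simp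
  have "(f has_derivative D) (at (p + c)) \<longleftrightarrow> (f has_derivative D) (at p)" for D
    using diff_chain_at[OF 1(1)[of p], of f D] diff_chain_at[OF 1(2)[of "p + c"], of f D]
    by (auto simp: o_def assms inv)
  then show ?thesis by (simp add: frechet_derivative_def)
qed

section \<open>Green's formula on boxes and integration in polar coordinates\<close>

lemma partial_has_vector_derivative:
  fixes f :: "real^2 \<Rightarrow> 'b::real_normed_vector"
  assumes "f differentiable at (vector [x, y])"
  shows "((\<lambda>s. f (vector [x, s])) has_vector_derivative pd e\<^sub>2 f (vector [x, y])) (at y)"
    and "((\<lambda>s. f (vector [s, y])) has_vector_derivative pd e\<^sub>1 f (vector [x, y])) (at x)"
proof -
  note f = assms[unfolded frechet_derivative_works]
  note sc = linear_scale[OF has_derivative_linear[OF f]]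
  have "((\<lambda>s. vector [x, s] :: real^2) has_derivative (\<lambda>h. h *\<^sub>R e\<^sub>2)) (at y)"
    unfolding vector_2_axis by (auto intro!: derivative_eq_intros)
  from diff_chain_at[OF this f] show "((\<lambda>s. f (vector [x, s])) has_vector_derivative pd e\<^sub>2 f (vector [x, y])) (at y)"
    by (simp add: has_vector_derivative_def o_def sc)
  have "((\<lambda>s. vector [s, y] :: real^2) has_derivative (\<lambda>h. h *\<^sub>R e\<^sub>1)) (at x)"
    unfolding vector_2_axis by (auto intro!: derivative_eq_intros)
  from diff_chain_at[OF this f] show "((\<lambda>s. f (vector [s, y])) has_vector_derivative pd e\<^sub>1 f (vector [x, y])) (at x)"
    by (simp add: has_vector_derivative_def o_def sc)
qed

text \<open>Under (x, y) \<mapsto> vector [x, y] boxes correspond to boxes of the same content,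
  which carries iterated integration from pairs over to \<open>real^2\<close>.\<close>

lemma integral_cbox_vec2:
  fixes f :: "real^2 \<Rightarrow> real"
  assumes f: "continuous_on (cbox (vector [a, c]) (vector [b, d])) f"
  shows "integral (cbox (vector [a, c]) (vector [b, d])) f = integral {a..b} (\<lambda>x. integral {c..d} (\<lambda>y. f (vector [x, y])))"
    and "integral (cbox (vector [a, c]) (vector [b, d])) f = integral {c..d} (\<lambda>y. integral {a..b} (\<lambda>x. f (vector [x, y])))"
proof -
  define g :: "real \<times> real \<Rightarrow> real^2" where "g = (\<lambda>(x, y). vector [x, y])"
  define h :: "real^2 \<Rightarrow> real \<times> real" where "h v = (v$1, v$2)" for v
  have gcont: "continuous_on S g" for S
    unfolding g_def vector_2_axis by (auto simp: split_beta intro!: continuous_intros)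
  have gbox: "g ` cbox u v = cbox (g u) (g v)" for u v
  proof (intro equalityI subsetI)
    fix x assume "x \<in> cbox (g u) (g v)"
    then show "x \<in> g ` cbox u v"
      by (intro image_eqI[of _ _ "h x"])
         (cases u; cases v; auto simp: g_def h_def mem_box_cart forall_2 vec_eq_iff cbox_Pair_eq)+
  qed (cases u; cases v; auto simp: g_def mem_box_cart forall_2)
  have hg: "h (g x) = x" and gh: "g (h y) = y" for x y
    by (auto simp: g_def h_def split_beta vec_eq_iff forall_2)
  have hbox: "h ` cbox u v = cbox (h u) (h v)" for u v
    using gbox[of "h u" "h v"] hg by (metis (no_types, lifting) gh image_ident image_image image_cong)
  have content: "Henstock_Kurzweil_Integration.content (g ` cbox u v) = Henstock_Kurzweil_Integration.content (cbox u v)" for u v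
  proof (cases "cbox u v = {}")
    case False
    then have "cbox (g u) (g v) \<noteq> {}" using gbox by blast
    then have "Henstock_Kurzweil_Integration.content (g ` cbox u v) = (g v $ 1 - g u $ 1) * (g v $ 2 - g u $ 2)"
      by (simp add: gbox content_cbox_cart UNIV_2)
    moreover have "fst u \<le> fst v" "snd u \<le> snd v"
      using False by (cases u; cases v; auto simp: cbox_Pair_eq)+
    then have "Henstock_Kurzweil_Integration.content (cbox u v) = (fst v - fst u) * (snd v - snd u)"
      using content_Pair[of "fst u" "snd u" "fst v" "snd v"] by simp
    ultimately show ?thesis by (simp add: g_def split_beta)
  qed simp
  have eq: "cbox (a, c) (b, d) = h ` cbox (vector [a, c]) (vector [b, d])"
    by (simp add: hbox) (simp add: h_def)
  have f': "continuous_on (cbox (a, c) (b, d)) (\<lambda>z. f (g z))"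
    by (rule continuous_on_compose2[OF f gcont])
       (use gbox[of "(a, c)" "(b, d)"] in \<open>simp add: g_def\<close>)
  have "((\<lambda>x. f (g x)) has_integral (1 / 1) *\<^sub>R integral (cbox (vector [a, c]) (vector [b, d])) f)
      (h ` cbox (vector [a, c]) (vector [b, d]))"
  proof (rule has_integral_twiddle)
    show "isCont g x" for x using gcont[of UNIV] continuous_on_eq_continuous_at by blast
    show "(f has_integral integral (cbox (vector [a, c]) (vector [b, d])) f) (cbox (vector [a, c]) (vector [b, d]))"
      using integrable_continuous[OF f] by (rule integrable_integral)
    show "\<exists>w z. h ` cbox u v = cbox w z" for u v using hbox by blast
  qed (use hg gh gbox content in auto)
  then have *: "integral (cbox (vector [a, c]) (vector [b, d])) f = integral (cbox (a, c) (b, d)) (\<lambda>z. f (g z))"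
    unfolding eq by (simp add: integral_unique)
  show "integral (cbox (vector [a, c]) (vector [b, d])) f = integral {a..b} (\<lambda>x. integral {c..d} (\<lambda>y. f (vector [x, y])))"
    unfolding * integral_prod_continuous[OF f'] by (simp add: g_def)
  moreover have "integral {a..b} (\<lambda>x. integral {c..d} (\<lambda>y. f (vector [x, y]))) = integral {c..d} (\<lambda>y. integral {a..b} (\<lambda>x. f (vector [x, y])))"
    using integral_swap_continuous[of a c b d "\<lambda>x y. f (g (x, y))"] f' by (simp add: g_def split_beta)
  ultimately show "integral (cbox (vector [a, c]) (vector [b, d])) f = integral {c..d} (\<lambda>y. integral {a..b} (\<lambda>x. f (vector [x, y])))"
    by simp
qed

lemma green_box:
  fixes G H :: "real^2 \<Rightarrow> real"
  assumes "open V" "C_k_on 1 G V" "C_k_on 1 H V" "cbox (vector [a, c]) (vector [b, d]) \<subseteq> V" "a \<le> b" "c \<le> d"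
  shows "integral (cbox (vector [a, c]) (vector [b, d])) (\<lambda>p. pd e\<^sub>1 G p - pd e\<^sub>2 H p) =
     integral {c..d} (\<lambda>y. G (vector [b, y]) - G (vector [a, y])) - integral {a..b} (\<lambda>x. H (vector [x, d]) - H (vector [x, c]))"
proof -
  have cont: "continuous_on (cbox (vector [a, c]) (vector [b, d])) (pd e\<^sub>1 G)" "continuous_on (cbox (vector [a, c]) (vector [b, d])) (pd e\<^sub>2 H)"
    using assms(2-4) by (auto intro: continuous_on_subset)
  have inV: "vector [x, y] \<in> V" if "x \<in> {a..b}" "y \<in> {c..d}" for x y
    using that assms(4) by (auto simp: mem_box_cart forall_2 subset_iff)
  have diff: "G differentiable at p" "H differentiable at p" if "p \<in> V" for p
    using that assms(2,3) by auto
  have ftc: "y \<in> {c..d} \<Longrightarrow> integral {a..b} (\<lambda>x. pd e\<^sub>1 G (vector [x, y])) = G (vector [b, y]) - G (vector [a, y])"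
    "x \<in> {a..b} \<Longrightarrow> integral {c..d} (\<lambda>y. pd e\<^sub>2 H (vector [x, y])) = H (vector [x, d]) - H (vector [x, c])" for x y
    using inV assms(5,6)
    by (auto intro!: integral_unique fundamental_theorem_of_calculus has_vector_derivative_at_within
        partial_has_vector_derivative(2)[of G] partial_has_vector_derivative(1)[of H] diff)
  have "integral (cbox (vector [a, c]) (vector [b, d])) (pd e\<^sub>1 G) = integral {c..d} (\<lambda>y. integral {a..b} (\<lambda>x. pd e\<^sub>1 G (vector [x, y])))"
    by (rule integral_cbox_vec2(2)[OF cont(1)])
  also have "\<dots> = integral {c..d} (\<lambda>y. G (vector [b, y]) - G (vector [a, y]))"
    by (rule integral_cong) (rule ftc(1))
  finally have 1: "integral (cbox (vector [a, c]) (vector [b, d])) (pd e\<^sub>1 G) = \<dots>" .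
  have "integral (cbox (vector [a, c]) (vector [b, d])) (pd e\<^sub>2 H) = integral {a..b} (\<lambda>x. integral {c..d} (\<lambda>y. pd e\<^sub>2 H (vector [x, y])))"
    by (rule integral_cbox_vec2(1)[OF cont(2)])
  also have "\<dots> = integral {a..b} (\<lambda>x. H (vector [x, d]) - H (vector [x, c]))"
    by (rule integral_cong) (rule ftc(2))
  finally show ?thesis using 1 cont
    by (simp add: Henstock_Kurzweil_Integration.integral_diff integrable_continuous)
qed

lemma integral_change_of_variables_2:
  fixes g :: "real^2 \<Rightarrow> real^2" and f :: "real^2 \<Rightarrow> real"
  assumes S: "S \<in> sets lebesgue" and der: "\<And>x. x \<in> S \<Longrightarrow> (g has_derivative g' x) (at x)" and inj: "inj_on g S"
    and ai: "(\<lambda>x. \<bar>det (matrix (g' x))\<bar> * f (g x)) absolutely_integrable_on S"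
  shows "integral (g ` S) f = integral S (\<lambda>x. \<bar>det (matrix (g' x))\<bar> * f (g x))"
proof -
  \<comment> \<open>The change of variables theorem applied below is for vector-valued functions, so
    f is embedded in \<open>real^1\<close>.\<close>
  define F :: "real^2 \<Rightarrow> real^1" where "F x = f x *\<^sub>R 1" for x
  have eq: "\<bar>det (matrix (g' x))\<bar> *\<^sub>R F (g x) = (\<bar>det (matrix (g' x))\<bar> * f (g x)) *\<^sub>R 1" for x
    by (simp add: F_def)
  have ai': "(\<lambda>x. \<bar>det (matrix (g' x))\<bar> *\<^sub>R F (g x)) absolutely_integrable_on S"
    unfolding eq by (rule absolutely_integrable_scaleR_right[OF ai])
  have cv: "F absolutely_integrable_on (g ` S) \<and> integral (g ` S) F = integral S (\<lambda>x. \<bar>det (matrix (g' x))\<bar> *\<^sub>R F (g x))"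
    using has_absolute_integral_change_of_variables[OF S has_derivative_at_withinI[OF der] inj, where f = F] ai' by blast
  then have "F integrable_on (g ` S)" using set_lebesgue_integral_eq_integral(1) by blast
  then have "integral (g ` S) (\<lambda>x. F x \<bullet> 1) = integral (g ` S) F \<bullet> 1"
    by (rule integral_component_eq)
  moreover have "integral S (\<lambda>x. \<bar>det (matrix (g' x))\<bar> *\<^sub>R F (g x) \<bullet> 1) = integral S (\<lambda>x. \<bar>det (matrix (g' x))\<bar> *\<^sub>R F (g x)) \<bullet> 1"
    using ai' set_lebesgue_integral_eq_integral(1) by (intro integral_component_eq) blast
  moreover have "(1::real^1) \<bullet> 1 = 1" by (simp add: inner_vec_def)
  ultimately show ?thesis using cv unfolding eq by (simp add: F_def)
qed

abbreviation annulus :: "real \<Rightarrow> real \<Rightarrow> (real^2) set" where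
  "annulus r R \<equiv> {p. r \<le> norm p \<and> norm p \<le> R}"

definition polar :: "real^2 \<Rightarrow> real^2" where
  "polar q = vector [q $ 1 * cos (q $ 2), q $ 1 * sin (q $ 2)]"

lemma norm_vec2: "norm (v::real^2) = sqrt ((v $ 1)\<^sup>2 + (v $ 2)\<^sup>2)"
  by (simp add: norm_vec_def L2_set_def sum_2)

lemma norm_polar: "norm (polar q) = \<bar>q $ 1\<bar>"
proof -
  have "(q $ 1 * cos (q $ 2))\<^sup>2 + (q $ 1 * sin (q $ 2))\<^sup>2 = (q $ 1)\<^sup>2"
    using sin_cos_squared_add[of "q $ 2"] by algebra
  then show ?thesis by (simp add: norm_vec2 polar_def)
qed

lemma polar_has_derivative:
  "(polar has_derivative (\<lambda>v. vector [v $ 1 * cos (q $ 2) - q $ 1 * sin (q $ 2) * v $ 2,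
      v $ 1 * sin (q $ 2) + q $ 1 * cos (q $ 2) * v $ 2])) (at q)"
  unfolding polar_def
  by (intro has_derivative_vector2; rule has_derivative_eq_rhs)
     (auto intro!: derivative_eq_intros bounded_linear.has_derivative[OF bounded_linear_vec_nth] simp: fun_eq_iff algebra_simps)

lemma pd_polar:
  "pd e\<^sub>1 polar q = vector [cos (q $ 2), sin (q $ 2)]"
  "pd e\<^sub>2 polar q = vector [- q $ 1 * sin (q $ 2), q $ 1 * cos (q $ 2)]"
  using pd_eqI[OF polar_has_derivative, of q] by (simp_all add: axis_def)

lemma jac_polar: "jac polar q = q $ 1"
  unfolding jac_def pd_polar vector_2 using sin_cos_squared_add[of "q $ 2"] by algebra

lemma C_k_on_polar: "C_k_on k polar UNIV"
proof -
  have "C_k_on k (\<lambda>q::real^2. f (q $ 2)) UNIV" if "C_k_on k f UNIV" for f :: "real \<Rightarrow> real"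
    by (rule C_k_on_compose[OF open_UNIV open_UNIV that C_k_on_nth]) auto
  then show ?thesis
    unfolding polar_def[abs_def] using C_k_on_sin_cos[of "UNIV::real set" k]
    by (intro C_k_on_vector2 C_k_on_mult C_k_on_nth) auto
qed

lemma integral_polar:
  fixes f :: "real^2 \<Rightarrow> real"
  assumes r: "0 < r" and f: "continuous_on (annulus r R) f"
  shows "integral (annulus r R) f = integral (cbox (vector [r, 0]) (vector [R, 2 * pi])) (\<lambda>q. q $ 1 * f (polar q))"
proof -
  let ?C = "cbox (vector [r, 0]) (vector [R, 2 * pi]) :: (real^2) set"
  \<comment> \<open>The angle 2 pi is excluded to make \<open>polar\<close> injective; the segment
    lost is negligible.\<close>
  define S where "S = ?C \<inter> {q. q $ 2 < 2 * pi}"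
  have memC: "q \<in> ?C \<longleftrightarrow> r \<le> q $ 1 \<and> q $ 1 \<le> R \<and> 0 \<le> q $ 2 \<and> q $ 2 \<le> 2 * pi" for q
    by (auto simp: mem_box_cart forall_2)
  have S: "S \<in> sets lebesgue"
    unfolding S_def by (auto intro!: sets.Int lebesgue_openin simp: open_halfspace_component_lt_cart)
  have inj: "inj_on polar S"
  proof (rule inj_onI)
    fix p q assume p: "p \<in> S" and q: "q \<in> S" and eq: "polar p = polar q"
    then have 1: "p $ 1 = q $ 1" using norm_polar[of p] norm_polar[of q] r by (auto simp: S_def memC)
    have "q $ 1 > 0" using q r by (auto simp: S_def memC)
    then have "sin (p $ 2) = sin (q $ 2) \<and> cos (p $ 2) = cos (q $ 2)"
      using eq 1 by (simp add: polar_def vec_eq_iff forall_2)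
    then obtain n :: int where n: "p $ 2 = q $ 2 + 2 * pi * n"
      using sin_cos_eq_iff by blast
    have "\<bar>p $ 2 - q $ 2\<bar> < 2 * pi" using p q by (auto simp: S_def memC)
    then have "2 * pi * \<bar>n\<bar> < 2 * pi * 1" using n by (simp add: abs_mult)
    then have "n = 0" by simp
    then show "p = q" using 1 n by (simp add: vec_eq_iff forall_2)
  qed
  have im: "polar ` S = annulus r R"
  proof (intro equalityI subsetI)
    fix p :: "real^2" assume "p \<in> annulus r R"
    then have p: "r \<le> norm p" "norm p \<le> R" by auto
    then have pos: "norm p > 0" using r by linarith
    have "(p $ 1 / norm p)\<^sup>2 + (p $ 2 / norm p)\<^sup>2 = ((p $ 1)\<^sup>2 + (p $ 2)\<^sup>2) / (norm p)\<^sup>2"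
      by (simp add: power_divide add_divide_distrib)
    also have "(p $ 1)\<^sup>2 + (p $ 2)\<^sup>2 = (norm p)\<^sup>2" by (simp add: norm_vec2)
    also have "(norm p)\<^sup>2 / (norm p)\<^sup>2 = 1" using pos by simp
    finally obtain t where t: "0 \<le> t" "t < 2 * pi" "p $ 1 / norm p = cos t" "p $ 2 / norm p = sin t"
      using sincos_total_2pi by metis
    have c: "norm p * cos t = p $ 1" "norm p * sin t = p $ 2"
      unfolding t(3,4)[symmetric] using pos by simp_all
    show "p \<in> polar ` S"
    proof (rule image_eqI)
      show "p = polar (vector [norm p, t])"
        by (simp add: polar_def vec_eq_iff forall_2 c)
      show "vector [norm p, t] \<in> S" using p t by (simp add: S_def memC)
    qed
  qed (use r norm_polar in \<open>auto simp: S_def memC\<close>)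
  define P' where "P' q = (\<lambda>v::real^2. vector [v $ 1 * cos (q $ 2) - q $ 1 * sin (q $ 2) * v $ 2,
      v $ 1 * sin (q $ 2) + q $ 1 * cos (q $ 2) * v $ 2] :: real^2)" for q :: "real^2"
  have det: "det (matrix (P' q)) = q $ 1" for q
  proof -
    have "det (matrix (P' q)) = cos (q $ 2) * (q $ 1 * cos (q $ 2)) - (- (q $ 1 * sin (q $ 2))) * sin (q $ 2)"
      by (simp add: det_2 matrix_def P'_def axis_def)
    also have "\<dots> = q $ 1" using sin_cos_squared_add[of "q $ 2"] by algebra
    finally show ?thesis .
  qed
  have contP: "continuous_on UNIV polar" using C_k_on_polar[of 0] by simp
  have cont: "continuous_on ?C (\<lambda>q. \<bar>det (matrix (P' q))\<bar> * f (polar q))"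
    unfolding det
  proof (intro continuous_intros continuous_on_compose2[OF f])
    show "continuous_on ?C polar" using contP continuous_on_subset by blast
    show "polar ` ?C \<subseteq> annulus r R" using r by (auto simp: norm_polar memC)
  qed
  have "integral (polar ` S) f = integral S (\<lambda>q. \<bar>det (matrix (P' q))\<bar> * f (polar q))"
  proof (rule integral_change_of_variables_2[OF S _ inj])
    show "(polar has_derivative P' q) (at q)" for q unfolding P'_def by (rule polar_has_derivative)
    show "(\<lambda>q. \<bar>det (matrix (P' q))\<bar> * f (polar q)) absolutely_integrable_on S"
      by (rule set_integrable_subset[OF absolutely_integrable_continuous[OF cont] S]) (simp add: S_def)
  qed
  also have "\<dots> = integral ?C (\<lambda>q. \<bar>det (matrix (P' q))\<bar> * f (polar q))"
  proof (rule integral_subset_negligible)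
    show "negligible (?C - S)"
      by (rule negligible_subset[OF negligible_hyperplane[of e\<^sub>2 "2 * pi"]]) (auto simp: S_def memC inner_axis')
  qed (simp add: S_def)
  also have "\<dots> = integral ?C (\<lambda>q. q $ 1 * f (polar q))"
    unfolding det using r by (intro integral_cong) (auto simp: memC)
  finally show ?thesis unfolding im .
qed

text \<open>With \<open>e\<close> the unit vector along the second coordinate lines, \<open>e\<close> and \<open>\<nu> \<times> e\<close> form a moving frame;
  \<open>frame_form v\<close> is its connection form.\<close>

definition frame_form :: "(real^2 \<Rightarrow> real^3) \<Rightarrow> real^2 \<Rightarrow> real^2 \<Rightarrow> real" where
  "frame_form Y v p = unit_normal Y p \<bullet> (sgn (pd e\<^sub>2 Y p) \<times> pd v (\<lambda>q. sgn (pd e\<^sub>2 Y q)) p)"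

lemma unit_normal_pd: "unit_normal Y = (\<lambda>p. sgn (pd e\<^sub>1 Y p \<times> pd e\<^sub>2 Y p))"
  by (simp add: fun_eq_iff unit_normal_def normal_field_pd)

lemma unit_orthogonal_derivative:
  fixes f g :: "'a::real_normed_vector \<Rightarrow> 'b::real_inner"
  assumes "open V" "p \<in> V" "\<And>q. q \<in> V \<Longrightarrow> f q \<bullet> g q = c" "f differentiable at p" "g differentiable at p"
  shows "f p \<bullet> pd v g p + pd v f p \<bullet> g p = 0"
proof -
  have "((\<lambda>q. f q \<bullet> g q) has_derivative (\<lambda>h. f p \<bullet> pd h g p + pd h f p \<bullet> g p)) (at p)"
    using assms(4,5) unfolding frechet_derivative_works by (rule has_derivative_inner)
  from pd_eqI[OF this, of v] have "pd v (\<lambda>q. f q \<bullet> g q) p = f p \<bullet> pd v g p + pd v f p \<bullet> g p" .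
  moreover have "pd v (\<lambda>q. f q \<bullet> g q) p = pd v (\<lambda>q. c) p"
    using assms(1-3) by (rule pd_cong)
  ultimately show ?thesis by simp
qed

text \<open>The product rule leaves mixed second derivatives of e, which cancel by symmetry, and
  terms settled by \<open>frame_identity\<close>. The orthogonality relations it asks for come from
  differentiating constant inner products.\<close>

lemma structure_equation:
  assumes V: "open V" and Y: "C_k_on 4 Y V" and nz: "\<And>p. p \<in> V \<Longrightarrow> normal_field Y p \<noteq> 0"
  shows "C_k_on 1 (frame_form Y v) V"
    and "p \<in> V \<Longrightarrow> pd e\<^sub>1 (frame_form Y e\<^sub>2) p - pd e\<^sub>2 (frame_form Y e\<^sub>1) p = - (gauss_curvature Y p * area_element Y p)"
proof -
  define A B where "A = pd e\<^sub>1 Y" and "B = pd e\<^sub>2 Y"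
  define \<nu> where "\<nu> = (\<lambda>p. sgn (A p \<times> B p))"
  define e where "e = (\<lambda>p. sgn (B p))"
  have AB: "C_k_on 3 A V" "C_k_on 3 B V"
    using Y by (auto simp: A_def B_def eval_nat_numeral)
  have nz': "A p \<times> B p \<noteq> 0" if "p \<in> V" for p using nz[OF that] by (simp add: normal_field_pd A_def B_def)
  then have B0: "B p \<noteq> 0" if "p \<in> V" for p using that by fastforce
  have C\<nu>: "C_k_on 3 \<nu> V" unfolding \<nu>_def using AB V nz' by (intro C_k_on_sgn C_k_on_cross3) auto
  have Ce: "C_k_on 3 e V" unfolding e_def using AB V B0 by (intro C_k_on_sgn) auto
  have C2: "C_k_on 2 (pd w e) V" for w using Ce by (auto simp: eval_nat_numeral)
  have ff: "frame_form Y w = (\<lambda>p. \<nu> p \<bullet> (e p \<times> pd w e p))" for w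
    by (simp add: fun_eq_iff frame_form_def unit_normal_pd \<nu>_def e_def A_def B_def)
  have "C_k_on 2 (frame_form Y v) V"
    unfolding ff by (intro C_k_on_inner C_k_on_cross3 C_k_on_le[OF C\<nu>] C_k_on_le[OF Ce] C2 V) auto
  then show "C_k_on 1 (frame_form Y v) V" by (rule C_k_on_le) simp
  assume p: "p \<in> V"
  have d: "\<nu> differentiable at q" "e differentiable at q" "pd w e differentiable at q"
      "A differentiable at q" "B differentiable at q" if "q \<in> V" for q w
    using C\<nu> Ce C2[of w] AB that by (auto simp: eval_nat_numeral)
  note fd = d[THEN frechet_derivative_works[THEN iffD1]]
  have der: "pd w (frame_form Y u) p = \<nu> p \<bullet> (e p \<times> pd w (pd u e) p + pd w e p \<times> pd u e p) + pd w \<nu> p \<bullet> (e p \<times> pd u e p)" for u w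
    unfolding ff
    by (rule pd_eqI) (intro has_derivative_inner bounded_bilinear.FDERIV[OF bounded_bilinear_cross3] fd p)
  have comm: "pd e\<^sub>1 (pd e\<^sub>2 e) p = pd e\<^sub>2 (pd e\<^sub>1 e) p"
    by (rule pd_commute[OF V C_k_on_le[OF Ce] p]) simp
  have ee: "e q \<bullet> e q = 1" "\<nu> q \<bullet> \<nu> q = 1" "e q \<bullet> \<nu> q = 0" "\<nu> q \<bullet> A q = 0" "\<nu> q \<bullet> B q = 0" if "q \<in> V" for q
    using B0[OF that] nz'[OF that]
    by (auto simp: e_def \<nu>_def power2_norm_eq_inner[symmetric] norm_sgn sgn_div_norm dot_cross_self)
  note ud = unit_orthogonal_derivative[OF V p]
  have e0: "e p \<bullet> pd w e p = 0" for w
    using ud[of e e 1 w] ee d[OF p] by (simp add: inner_commute)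
  have \<nu>0: "\<nu> p \<bullet> pd w \<nu> p = 0" for w
    using ud[of \<nu> \<nu> 1 w] ee d[OF p] by (simp add: inner_commute)
  have e\<nu>: "pd w e p \<bullet> \<nu> p = - (e p \<bullet> pd w \<nu> p)" for w
    using ud[of e \<nu> 0 w] ee d[OF p] by simp
  have \<nu>A: "pd w \<nu> p \<bullet> A p = - (\<nu> p \<bullet> pd w A p)" "pd w \<nu> p \<bullet> B p = - (\<nu> p \<bullet> pd w B p)" for w
    using ud[of \<nu> A 0 w] ud[of \<nu> B 0 w] ee d[OF p] by simp_all
  have "pd e\<^sub>1 (frame_form Y e\<^sub>2) p - pd e\<^sub>2 (frame_form Y e\<^sub>1) p
      = pd e\<^sub>1 \<nu> p \<bullet> (e p \<times> pd e\<^sub>2 e p) - pd e\<^sub>2 \<nu> p \<bullet> (e p \<times> pd e\<^sub>1 e p) + 2 * (\<nu> p \<bullet> (pd e\<^sub>1 e p \<times> pd e\<^sub>2 e p))"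
    unfolding der comm using cross_skew[of "pd e\<^sub>2 e p" "pd e\<^sub>1 e p"] by (simp add: inner_add_right inner_diff_right)
  also have "\<dots> = - (\<nu> p \<bullet> (pd e\<^sub>1 \<nu> p \<times> pd e\<^sub>2 \<nu> p))"
    using ee[OF p] e0 \<nu>0 e\<nu> by (intro frame_identity) auto
  also have "\<nu> p \<bullet> (pd e\<^sub>1 \<nu> p \<times> pd e\<^sub>2 \<nu> p) = gauss_curvature Y p * area_element Y p"
  proof -
    \<comment> \<open>Since \<nu> is a positive multiple of A \<times> B, the triple product becomes
      a 2 by 2 determinant of inner products, and differentiating \<nu> \<bullet> A = \<nu>
      \<bullet> B = 0 turns these into the second fundamental form.\<close>
    define N where "N = norm (A p \<times> B p)"
    have N: "N > 0" using nz'[OF p] by (simp add: N_def)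
    have \<nu>N: "\<nu> p = (1 / N) *\<^sub>R (A p \<times> B p)" by (simp add: \<nu>_def N_def sgn_div_norm inverse_eq_divide)
    have area: "area_element Y p = N" by (simp add: area_element_def normal_field_pd N_def A_def B_def)
    have YU: "C_k_on 2 Y V" by (rule C_k_on_le[OF Y]) simp
    have BA: "pd e\<^sub>2 A p = pd e\<^sub>1 B p" unfolding A_def B_def by (rule pd_commute[OF V YU p])
    have "(A p \<times> B p) \<bullet> (pd e\<^sub>1 \<nu> p \<times> pd e\<^sub>2 \<nu> p)
        = (A p \<bullet> pd e\<^sub>1 \<nu> p) * (B p \<bullet> pd e\<^sub>2 \<nu> p) - (A p \<bullet> pd e\<^sub>2 \<nu> p) * (B p \<bullet> pd e\<^sub>1 \<nu> p)"
      by (simp add: dot_cross)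
    also have "\<dots> = (\<nu> p \<bullet> pd e\<^sub>1 A p) * (\<nu> p \<bullet> pd e\<^sub>2 B p) - (\<nu> p \<bullet> pd e\<^sub>1 B p)\<^sup>2"
      using \<nu>A by (simp add: inner_commute BA power2_eq_square)
    finally have *: "(A p \<times> B p) \<bullet> (pd e\<^sub>1 \<nu> p \<times> pd e\<^sub>2 \<nu> p) = \<dots>" .
    have "gauss_curvature Y p = ((pd e\<^sub>1 A p \<bullet> \<nu> p) * (pd e\<^sub>2 B p \<bullet> \<nu> p) - (pd e\<^sub>1 B p \<bullet> \<nu> p)\<^sup>2) / N\<^sup>2"
      unfolding curvature_formulas(2)[OF V YU p nz[OF p]] gauss_of_def by (simp add: A_def B_def \<nu>_def N_def)
    then have "gauss_curvature Y p * area_element Y p = ((\<nu> p \<bullet> pd e\<^sub>1 A p) * (\<nu> p \<bullet> pd e\<^sub>2 B p) - (\<nu> p \<bullet> pd e\<^sub>1 B p)\<^sup>2) / N"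
      using N area by (simp add: inner_commute power2_eq_square)
    moreover have "\<nu> p \<bullet> (pd e\<^sub>1 \<nu> p \<times> pd e\<^sub>2 \<nu> p) = ((\<nu> p \<bullet> pd e\<^sub>1 A p) * (\<nu> p \<bullet> pd e\<^sub>2 B p) - (\<nu> p \<bullet> pd e\<^sub>1 B p)\<^sup>2) / N"
      unfolding *[symmetric] by (simp add: \<nu>N)
    ultimately show ?thesis by simp
  qed
  finally show "pd e\<^sub>1 (frame_form Y e\<^sub>2) p - pd e\<^sub>2 (frame_form Y e\<^sub>1) p = - (gauss_curvature Y p * area_element Y p)" .
qed

section \<open>Geodesic curvature of the boundary circles and Gauss-Bonnet\<close>

text \<open>Geodesic curvature times speed, so that the integral over [0, 2 pi] is the total
  geodesic curvature of the image of the circle of radius r, run counterclockwise.\<close>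

definition geodesic_form :: "(real^2 \<Rightarrow> real^3) \<Rightarrow> real \<Rightarrow> real \<Rightarrow> real" where
  "geodesic_form X r t = (let \<gamma>' = \<lambda>s. vector_derivative (circle_image X r) (at s) in
     unit_normal X (vector [r * cos t, r * sin t]) \<bullet> (\<gamma>' t \<times> vector_derivative \<gamma>' (at t)) / (norm (\<gamma>' t))\<^sup>2)"

lemma polar_vector: "polar (vector [r, t]) = vector [r * cos t, r * sin t]"
  by (simp add: polar_def)

lemma circle_image_polar: "circle_image X r t = X (polar (vector [r, t]))"
  by (simp add: circle_image_def polar_vector)

lemma open_vimage_polar: "open U \<Longrightarrow> open (polar -` U)"
  using C_k_on_polar[of 0] by (auto intro: open_vimage)

lemma polar_differentiable: "polar differentiable at q"
  using polar_has_derivative differentiable_def by blast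

lemma C_k_on_compose_polar:
  "open U \<Longrightarrow> C_k_on k X U \<Longrightarrow> C_k_on k (\<lambda>q. X (polar q)) (polar -` U)"
  by (rule C_k_on_compose[OF open_vimage_polar _ _ C_k_on_subset[OF C_k_on_polar]]) auto

lemma normal_field_polar:
  assumes "C_k_on (Suc k) X U" "polar q \<in> U"
  shows "normal_field (\<lambda>q. X (polar q)) q = q $ 1 *\<^sub>R normal_field X (polar q)"
  using normal_field_reparam[OF polar_differentiable] assms by (auto simp: jac_polar)

lemma C2_continuous:
  assumes "C_k_on 2 X U"
  shows "continuous_on U (pd v X)" "continuous_on U (pd v (pd w X))"
proof -
  have X: "C_k_on (Suc (Suc 0)) X U" using assms by (simp add: numeral_2_eq_2)
  show "continuous_on U (pd v X)" by (rule C_k_on_continuous[OF C_k_on_pd[OF X]])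
  show "continuous_on U (pd v (pd w X))" by (rule C_k_on_continuous[OF C_k_on_pd[OF C_k_on_pd[OF X]]])
qed

lemma open_regular_set:
  assumes "open U" "C_k_on (Suc k) X U"
  shows "open {p \<in> U. normal_field X p \<noteq> 0}"
proof -
  have "continuous_on U (normal_field X)"
    unfolding normal_field_pd[abs_def] by (intro continuous_on_cross C_k_on_continuous[OF C_k_on_pd[OF assms(2)]])
  from continuous_open_preimage[OF this assms(1), of "-{0}"] show ?thesis
    by (simp add: vimage_def Int_def open_Compl)
qed

text \<open>In polar coordinates the circle is a coordinate line, so its derivatives are partial
  derivatives of Y. The first one cannot vanish because it is a factor of the normal field of Y,
  which is r times that of X.\<close>

lemma circle_image_derivatives:
  fixes X :: "real^2 \<Rightarrow> real^3"
  assumes U: "open U" "C_k_on (Suc (Suc k)) X U" and circ: "\<And>t. vector [r * cos t, r * sin t] \<in> U"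
    and nz: "\<And>p. p \<in> U \<Longrightarrow> normal_field X p \<noteq> 0" and r: "r > 0"
  defines "Y \<equiv> \<lambda>q. X (polar q)"
  defines "c\<^sub>1 \<equiv> \<lambda>t. pd e\<^sub>2 Y (vector [r, t])" and "c\<^sub>2 \<equiv> \<lambda>t. pd e\<^sub>2 (pd e\<^sub>2 Y) (vector [r, t])"
  shows "(circle_image X r has_vector_derivative c\<^sub>1 t) (at t)" and "(c\<^sub>1 has_vector_derivative c\<^sub>2 t) (at t)"
    and "c\<^sub>1 t \<noteq> 0" and "continuous_on S c\<^sub>1" and "continuous_on S c\<^sub>2"
    and "speed (circle_image X r) t = norm (c\<^sub>1 t)"
    and "curve_curvature (circle_image X r) t = norm (c\<^sub>1 t \<times> c\<^sub>2 t) / norm (c\<^sub>1 t) ^ 3"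
    and "geodesic_form X r t = unit_normal X (vector [r * cos t, r * sin t]) \<bullet> (c\<^sub>1 t \<times> c\<^sub>2 t) / (norm (c\<^sub>1 t))\<^sup>2"
proof -
  define V where "V = polar -` U"
  have V: "open V" "C_k_on (Suc (Suc k)) Y V"
    unfolding V_def Y_def by (rule open_vimage_polar[OF U(1)], rule C_k_on_compose_polar[OF U])
  have inV: "vector [r, t] \<in> V" for t using circ by (simp add: V_def polar_vector)
  have d: "Y differentiable at (vector [r, t])" "pd e\<^sub>2 Y differentiable at (vector [r, t])" for t
    using V(2) inV by auto
  have "circle_image X r = (\<lambda>t. Y (vector [r, t]))"
    by (simp add: fun_eq_iff circle_image_polar Y_def)
  then show 1: "(circle_image X r has_vector_derivative c\<^sub>1 t) (at t)" for t
    using partial_has_vector_derivative(1)[OF d(1)] by (simp add: c\<^sub>1_def)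
  show 2: "(c\<^sub>1 has_vector_derivative c\<^sub>2 t) (at t)" for t
    using partial_has_vector_derivative(1)[OF d(2)] by (simp add: c\<^sub>1_def c\<^sub>2_def)
  have "normal_field Y (vector [r, t]) \<noteq> 0" for t
    using normal_field_polar[OF U(2), of "vector [r, t]"] nz[OF circ] circ r
    by (simp add: Y_def polar_vector)
  then show 3: "c\<^sub>1 t \<noteq> 0" for t unfolding c\<^sub>1_def normal_field_pd by (metis cross_zero_right)
  have vcont: "continuous_on S (\<lambda>t. vector [r, t] :: real^2)"
    unfolding vector_2_axis by (intro continuous_intros)
  have "continuous_on V (pd e\<^sub>2 Y)" "continuous_on V (pd e\<^sub>2 (pd e\<^sub>2 Y))"
    using V(2) C_k_on_continuous by (metis C_k_on_pd)+
  then show "continuous_on S c\<^sub>1" "continuous_on S c\<^sub>2"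
    unfolding c\<^sub>1_def c\<^sub>2_def using inV by (auto intro!: continuous_on_compose2[OF _ vcont])
  note cf = curve_formulas[OF open_UNIV UNIV_I 1 2 3]
  show "speed (circle_image X r) t = norm (c\<^sub>1 t)" by (rule cf)
  show "curve_curvature (circle_image X r) t = norm (c\<^sub>1 t \<times> c\<^sub>2 t) / norm (c\<^sub>1 t) ^ 3" by (rule cf)
  show "geodesic_form X r t = unit_normal X (vector [r * cos t, r * sin t]) \<bullet> (c\<^sub>1 t \<times> c\<^sub>2 t) / (norm (c\<^sub>1 t))\<^sup>2"
    unfolding geodesic_form_def Let_def unfolding cf(4) unfolding cf(3) ..
qed

lemma circle_densities_continuous:
  fixes X :: "real^2 \<Rightarrow> real^3"
  assumes U: "open U" "C_k_on (Suc (Suc k)) X U" and circ: "\<And>t. vector [r * cos t, r * sin t] \<in> U"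
    and nz: "\<And>p. p \<in> U \<Longrightarrow> normal_field X p \<noteq> 0" and r: "r > 0"
  shows "continuous_on S (\<lambda>t. (\<alpha> * (curve_curvature (circle_image X r) t)\<^sup>2 + \<beta>) * speed (circle_image X r) t)"
    and "continuous_on S (geodesic_form X r)"
proof -
  define c\<^sub>1 where "c\<^sub>1 t = pd e\<^sub>2 (\<lambda>q. X (polar q)) (vector [r, t])" for t
  define c\<^sub>2 where "c\<^sub>2 t = pd e\<^sub>2 (pd e\<^sub>2 (\<lambda>q. X (polar q))) (vector [r, t])" for t
  have cd: "c\<^sub>1 t \<noteq> 0" "continuous_on S c\<^sub>1" "continuous_on S c\<^sub>2" "speed (circle_image X r) t = norm (c\<^sub>1 t)"
    "curve_curvature (circle_image X r) t = norm (c\<^sub>1 t \<times> c\<^sub>2 t) / norm (c\<^sub>1 t) ^ 3"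
    "geodesic_form X r t = unit_normal X (vector [r * cos t, r * sin t]) \<bullet> (c\<^sub>1 t \<times> c\<^sub>2 t) / (norm (c\<^sub>1 t))\<^sup>2" for t S
    using circle_image_derivatives[OF U circ nz r, folded c\<^sub>1_def c\<^sub>2_def] by simp_all
  show "continuous_on S (\<lambda>t. (\<alpha> * (curve_curvature (circle_image X r) t)\<^sup>2 + \<beta>) * speed (circle_image X r) t)"
    unfolding cd(4,5) using cd(1) by (intro continuous_intros continuous_on_cross cd) auto
  have N: "continuous_on UNIV (\<lambda>t. unit_normal X (vector [r * cos t, r * sin t]))"
  proof (rule continuous_on_compose2[where g = "unit_normal X" and t = U])
    have "continuous_on U (pd v X)" for v by (rule C_k_on_continuous[OF C_k_on_pd[OF U(2)]])
    then show "continuous_on U (unit_normal X)"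
      unfolding unit_normal_pd sgn_div_norm using nz
      by (intro continuous_intros continuous_on_cross) (auto simp: normal_field_pd)
    show "continuous_on UNIV (\<lambda>t. vector [r * cos t, r * sin t] :: real^2)"
      unfolding vector_2_axis by (intro continuous_intros)
  qed (use circ in auto)
  show "continuous_on S (geodesic_form X r)"
    unfolding cd(6)[abs_def] using cd(1)
    by (intro continuous_intros continuous_on_cross cd continuous_on_subset[OF N]) auto
qed

text \<open>Along the circle e is the unit tangent. Its derivative is a combination of
  \<open>c\<^sub>2\<close> and \<open>c\<^sub>1\<close>, and the part along \<open>c\<^sub>1\<close>
  drops out of the cross product with e.\<close>

lemma frame_form_polar:
  fixes X :: "real^2 \<Rightarrow> real^3"
  assumes U: "open U" "C_k_on (Suc (Suc k)) X U" and circ: "\<And>t. vector [r * cos t, r * sin t] \<in> U"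
    and nz: "\<And>p. p \<in> U \<Longrightarrow> normal_field X p \<noteq> 0" and r: "r > 0"
  shows "frame_form (\<lambda>q. X (polar q)) e\<^sub>2 (vector [r, t]) = geodesic_form X r t"
proof -
  define Y where "Y = (\<lambda>q. X (polar q))"
  define c\<^sub>1 where "c\<^sub>1 t = pd e\<^sub>2 Y (vector [r, t])" for t
  define c\<^sub>2 where "c\<^sub>2 t = pd e\<^sub>2 (pd e\<^sub>2 Y) (vector [r, t])" for t
  note cd = circle_image_derivatives[OF U circ nz r, folded Y_def, folded c\<^sub>1_def c\<^sub>2_def]
  define W where "W = {q \<in> polar -` U. pd e\<^sub>2 Y q \<noteq> 0}"
  have oU: "open (polar -` U)" and CY: "C_k_on (Suc (Suc k)) Y (polar -` U)"
    unfolding Y_def by (rule open_vimage_polar[OF U(1)], rule C_k_on_compose_polar[OF U])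
  have CB: "C_k_on (Suc k) (pd e\<^sub>2 Y) (polar -` U)" by (rule C_k_on_pd[OF CY])
  have oW: "open W"
    using continuous_open_preimage[OF C_k_on_continuous[OF CB] oU, of "-{0}"]
    by (simp add: W_def vimage_def Int_def open_Compl)
  have inW: "vector [r, t] \<in> W" using cd(3)[of t] circ by (simp add: W_def polar_vector c\<^sub>1_def)
  have "C_k_on (Suc k) (\<lambda>q. sgn (pd e\<^sub>2 Y q)) W"
    by (rule C_k_on_sgn[OF oW C_k_on_subset[OF CB]]) (auto simp: W_def)
  then have "(\<lambda>q. sgn (pd e\<^sub>2 Y q)) differentiable at (vector [r, t])"
    using inW by simp
  from partial_has_vector_derivative(1)[OF this]
  have "((\<lambda>s. sgn (c\<^sub>1 s)) has_vector_derivative pd e\<^sub>2 (\<lambda>q. sgn (pd e\<^sub>2 Y q)) (vector [r, t])) (at t)"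
    by (simp add: c\<^sub>1_def)
  moreover obtain D where D: "((\<lambda>s. sgn (c\<^sub>1 s)) has_vector_derivative D) (at t)"
    "D = (1 / norm (c\<^sub>1 t)) *\<^sub>R c\<^sub>2 t - ((c\<^sub>1 t \<bullet> c\<^sub>2 t) / norm (c\<^sub>1 t) ^ 3) *\<^sub>R c\<^sub>1 t"
    using has_vector_derivative_sgn[OF cd(2) cd(3)] by blast
  ultimately have "pd e\<^sub>2 (\<lambda>q. sgn (pd e\<^sub>2 Y q)) (vector [r, t]) = D"
    using vector_derivative_unique_at by blast
  then have "sgn (pd e\<^sub>2 Y (vector [r, t])) \<times> pd e\<^sub>2 (\<lambda>q. sgn (pd e\<^sub>2 Y q)) (vector [r, t])
      = (1 / (norm (c\<^sub>1 t))\<^sup>2) *\<^sub>R (c\<^sub>1 t \<times> c\<^sub>2 t)"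
    by (simp add: D(2) c\<^sub>1_def[symmetric] sgn_div_norm cross_mult_left cross_mult_right Cross3.right_diff_distrib
        power2_eq_square inverse_eq_divide)
  moreover have "unit_normal Y (vector [r, t]) = unit_normal X (vector [r * cos t, r * sin t])"
    using normal_field_polar[OF U(2), of "vector [r, t]"] circ r
    by (simp add: unit_normal_def Y_def polar_vector sgn_scaleR)
  ultimately show ?thesis
    unfolding frame_form_def Y_def[symmetric] using cd(8)[of t] circ by simp
qed

lemma curvature_area_continuous:
  assumes U: "open U" "C_k_on 2 X U" and nz: "\<And>p. p \<in> U \<Longrightarrow> normal_field X p \<noteq> 0"
  shows "continuous_on U (mean_curvature X)" "continuous_on U (gauss_curvature X)" "continuous_on U (area_element X)"
proof -
  note c = C2_continuous[OF U(2)]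
  have nz': "pd e\<^sub>1 X p \<times> pd e\<^sub>2 X p \<noteq> 0" if "p \<in> U" for p
    using nz[OF that] by (simp add: normal_field_pd)
  show "continuous_on U (area_element X)"
    unfolding area_element_def[abs_def] normal_field_pd
    by (intro continuous_on_norm continuous_on_cross c)
  have "continuous_on U (\<lambda>p. mean_of (pd e\<^sub>1 X p) (pd e\<^sub>2 X p) (pd e\<^sub>1 (pd e\<^sub>1 X) p) (pd e\<^sub>1 (pd e\<^sub>2 X) p) (pd e\<^sub>2 (pd e\<^sub>2 X) p))"
    unfolding mean_of_def sgn_div_norm using nz' by (intro continuous_intros continuous_on_cross c) auto
  then show "continuous_on U (mean_curvature X)"
    using curvature_formulas(1)[OF U _ nz] by (simp cong: continuous_on_cong)
  have "continuous_on U (\<lambda>p. gauss_of (pd e\<^sub>1 X p) (pd e\<^sub>2 X p) (pd e\<^sub>1 (pd e\<^sub>1 X) p) (pd e\<^sub>1 (pd e\<^sub>2 X) p) (pd e\<^sub>2 (pd e\<^sub>2 X) p))"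
    unfolding gauss_of_def sgn_div_norm using nz' by (intro continuous_intros continuous_on_cross c) auto
  then show "continuous_on U (gauss_curvature X)"
    using curvature_formulas(2)[OF U _ nz] by (simp cong: continuous_on_cong)
qed

lemma annulus_circle: "0 < r \<Longrightarrow> r \<le> s \<Longrightarrow> s \<le> R \<Longrightarrow> vector [s * cos t, s * sin t] \<in> annulus r R"
  unfolding polar_vector[symmetric] by (simp add: norm_polar)

text \<open>Green's formula is applied on the rectangle of polar coordinates. By periodicity the two
  sides of constant angle cancel, so no corner or Euler characteristic term appears; the other two
  sides are the boundary circles, the outer one with a minus sign.\<close>

theorem gauss_bonnet_annulus:
  assumes r: "0 < r" "r \<le> R" and U: "open U" "C_k_on 4 X U" "annulus r R \<subseteq> U"
    and nz: "\<And>p. p \<in> U \<Longrightarrow> normal_field X p \<noteq> 0"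
  shows "integral (annulus r R) (\<lambda>p. gauss_curvature X p * area_element X p) =
     integral {0..2*pi} (geodesic_form X r) - integral {0..2*pi} (geodesic_form X R)"
proof -
  let ?C = "cbox (vector [r, 0]) (vector [R, 2 * pi]) :: (real^2) set"
  have memC: "q \<in> ?C \<longleftrightarrow> r \<le> q $ 1 \<and> q $ 1 \<le> R \<and> 0 \<le> q $ 2 \<and> q $ 2 \<le> 2 * pi" for q
    by (auto simp: mem_box_cart forall_2)
  define Y where "Y = (\<lambda>q. X (polar q))"
  \<comment> \<open>Positive radius keeps the Jacobian of \<open>polar\<close> positive, so Y
    inherits regularity and orientation from X.\<close>
  define V where "V = polar -` U \<inter> {q. q $ 1 > 0}"
  have oV: "open V" unfolding V_def by (intro open_Int open_vimage_polar U open_halfspace_component_gt_cart)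
  have CY: "C_k_on 4 Y V"
    using C_k_on_subset[OF C_k_on_compose_polar[OF U(1,2)]] by (auto simp: V_def Y_def)
  have U2: "C_k_on 2 X U" "C_k_on (Suc (Suc 0)) X U" by (rule C_k_on_le[OF U(2)]; simp)+
  have nY: "normal_field Y q = q $ 1 *\<^sub>R normal_field X (polar q)" if "q \<in> V" for q
    unfolding Y_def by (rule normal_field_polar[OF U2(2)]) (use that in \<open>simp add: V_def\<close>)
  have nzY: "normal_field Y q \<noteq> 0" if "q \<in> V" for q
    using nY[OF that] nz that by (auto simp: V_def)
  have CV: "?C \<subseteq> V"
  proof
    fix q assume q: "q \<in> ?C"
    then have "polar q \<in> annulus r R" using r by (simp add: norm_polar memC)
    then show "q \<in> V" using q U(3) r by (auto simp: V_def memC)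
  qed
  have KY: "gauss_curvature Y q * area_element Y q = q $ 1 * (gauss_curvature X (polar q) * area_element X (polar q))"
    if "q \<in> V" for q
  proof -
    have "gauss_curvature Y q = gauss_curvature X (polar q)"
      unfolding gauss_curvature_def Y_def
      using principal_curvatures_reparam[OF oV C_k_on_subset[OF C_k_on_polar] that U(1) U2(1)] that
      by (simp add: V_def jac_polar)
    then show ?thesis using nY[OF that] that by (simp add: area_element_def V_def)
  qed
  have se1: "C_k_on 1 (frame_form Y v) V" for v
    by (rule structure_equation(1)[OF oV CY nzY])
  have se2: "pd e\<^sub>1 (frame_form Y e\<^sub>2) q - pd e\<^sub>2 (frame_form Y e\<^sub>1) q = - (gauss_curvature Y q * area_element Y q)"
    if "q \<in> V" for q
    by (rule structure_equation(2)[OF oV CY nzY that])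
  have circ: "vector [s * cos t, s * sin t] \<in> U" if "r \<le> s" "s \<le> R" for s t
    using annulus_circle[of r s R t] r that U(3) by blast
  have "continuous_on (annulus r R) (\<lambda>p. gauss_curvature X p * area_element X p)"
    by (intro continuous_on_mult continuous_on_subset[OF _ U(3)] curvature_area_continuous[OF U(1) U2(1) nz])
  then have "integral (annulus r R) (\<lambda>p. gauss_curvature X p * area_element X p)
      = integral ?C (\<lambda>q. q $ 1 * (gauss_curvature X (polar q) * area_element X (polar q)))"
    by (rule integral_polar[OF r(1)])
  also have "\<dots> = integral ?C (\<lambda>q. - (pd e\<^sub>1 (frame_form Y e\<^sub>2) q - pd e\<^sub>2 (frame_form Y e\<^sub>1) q))"
  proof (rule integral_cong)
    fix q assume "q \<in> ?C"
    then have "q \<in> V" using CV by blast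
    from se2[OF this] KY[OF this]
    show "q $ 1 * (gauss_curvature X (polar q) * area_element X (polar q))
        = - (pd e\<^sub>1 (frame_form Y e\<^sub>2) q - pd e\<^sub>2 (frame_form Y e\<^sub>1) q)" by linarith
  qed
  also have "\<dots> = - (integral {0..2*pi} (\<lambda>y. frame_form Y e\<^sub>2 (vector [R, y]) - frame_form Y e\<^sub>2 (vector [r, y]))
      - integral {r..R} (\<lambda>x. frame_form Y e\<^sub>1 (vector [x, 2*pi]) - frame_form Y e\<^sub>1 (vector [x, 0])))"
    unfolding integral_neg using green_box[OF oV se1 se1 CV] r by simp
  also have "integral {r..R} (\<lambda>x. frame_form Y e\<^sub>1 (vector [x, 2*pi]) - frame_form Y e\<^sub>1 (vector [x, 0])) = 0"
  proof -
    have per: "Y (q + vector [0, 2*pi]) = Y q" for q by (simp add: Y_def polar_def)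
    have "frame_form Y e\<^sub>1 (q + vector [0, 2*pi]) = frame_form Y e\<^sub>1 q" for q
      unfolding frame_form_def unit_normal_pd pd_shift[of Y, OF per]
      by (simp add: pd_shift[of "\<lambda>q. sgn (pd e\<^sub>2 Y q)"] pd_shift[of Y, OF per])
    from this[of "vector [x, 0]" for x]
    have "frame_form Y e\<^sub>1 (vector [x, 2*pi]) = frame_form Y e\<^sub>1 (vector [x, 0])" for x
      by (simp add: vector_2_axis)
    then show ?thesis by simp
  qed
  also have "integral {0..2*pi} (\<lambda>y. frame_form Y e\<^sub>2 (vector [R, y]) - frame_form Y e\<^sub>2 (vector [r, y]))
      = integral {0..2*pi} (\<lambda>y. frame_form Y e\<^sub>2 (vector [R, y])) - integral {0..2*pi} (\<lambda>y. frame_form Y e\<^sub>2 (vector [r, y]))"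
  proof (rule Henstock_Kurzweil_Integration.integral_diff)
    have "continuous_on {0..2*pi} (\<lambda>y. frame_form Y e\<^sub>2 (vector [s, y]))" if "s \<in> {r, R}" for s
    proof (rule continuous_on_compose2[OF C_k_on_continuous[OF se1]])
      show "continuous_on {0..2*pi} (\<lambda>y. vector [s, y] :: real^2)"
        unfolding vector_2_axis by (intro continuous_intros)
      have "vector [s, y] \<in> ?C" if "y \<in> {0..2*pi}" for y
        using that \<open>s \<in> {r, R}\<close> r unfolding memC by auto
      then show "(\<lambda>y. vector [s, y]) ` {0..2*pi} \<subseteq> V" using CV by auto
    qed
    then show "(\<lambda>y. frame_form Y e\<^sub>2 (vector [R, y])) integrable_on {0..2*pi}"
      "(\<lambda>y. frame_form Y e\<^sub>2 (vector [r, y])) integrable_on {0..2*pi}"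
      by (auto intro: integrable_continuous_interval)
  qed
  finally show ?thesis
    unfolding Y_def using frame_form_polar[OF U(1) U2(2) circ nz] r by simp
qed

section \<open>The lower bound for annuli\<close>

lemma integrable_on_compact:
  fixes f :: "'a::euclidean_space \<Rightarrow> real"
  assumes "compact D" "continuous_on D f"
  shows "f integrable_on D"
  using borel_integrable_compact[OF assms] set_borel_integral_eq_integral(1)[of D f]
  by (simp add: set_integrable_def indicator_scaleR_eq_if if_distrib cong: if_cong)

lemma compact_annulus: "compact (annulus r R)"
proof -
  have "annulus r R = cball 0 R \<inter> {p. r \<le> norm p}" by auto
  moreover have "closed {p::real^2. r \<le> norm p}" by (intro closed_Collect_le continuous_intros)
  ultimately show ?thesis by (simp add: compact_Int_closed)
qed

text \<open>Regularity is an open condition, so the extension of X is still an immersion close to D,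
  and boundary points can be treated like interior ones.\<close>

lemma immersion_neighbourhood:
  assumes "embedded_C4_surface D X"
  obtains U where "open U" "D \<subseteq> U" "C_k_on 4 X U" "\<And>p. p \<in> U \<Longrightarrow> normal_field X p \<noteq> 0"
proof -
  obtain U where U: "open U" "D \<subseteq> U" "C_k_on 4 X U" and inj: "\<And>p. p \<in> D \<Longrightarrow> inj (frechet_derivative X (at p))"
    using assms unfolding embedded_C4_surface_def by blast
  define U' where "U' = {p \<in> U. normal_field X p \<noteq> 0}"
  have "C_k_on (Suc 3) X U" using U(3) by (simp add: eval_nat_numeral)
  then have "open U'" unfolding U'_def by (rule open_regular_set[OF U(1)])
  moreover have "D \<subseteq> U'"
  proof
    fix p assume "p \<in> D"
    moreover have "X differentiable at p" using C_k_on_has_derivative[OF \<open>C_k_on (Suc 3) X U\<close>] \<open>p \<in> D\<close> U(2)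
      unfolding differentiable_def by blast
    ultimately show "p \<in> U'" using inj[of p] inj_frechet_iff_normal_field U(2) by (auto simp: U'_def)
  qed
  moreover have "C_k_on 4 X U'" by (rule C_k_on_subset[OF U(3)]) (auto simp: U'_def)
  ultimately show ?thesis by (intro that[of U']) (auto simp: U'_def)
qed

text \<open>The witness \<tau> is the total curvature of the boundary circle. Fenchel bounds it
  below, and it controls both the energy, through
  \<open>(sqrt \<alpha> * \<kappa> - sqrt \<beta>)\<^sup>2 \<ge> 0\<close>, and the total geodesic
  curvature.\<close>

lemma curve_energy_total_curvature:
  fixes X :: "real^2 \<Rightarrow> real^3"
  assumes U: "open U" "C_k_on (Suc (Suc k)) X U" and circ: "\<And>t. vector [r * cos t, r * sin t] \<in> U"
    and nz: "\<And>p. p \<in> U \<Longrightarrow> normal_field X p \<noteq> 0" and r: "r > 0" and "\<alpha> > 0" "\<beta> > 0"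
  obtains \<tau> where "2 * pi \<le> \<tau>" "2 * sqrt (\<alpha> * \<beta>) * \<tau> \<le> curve_energy \<alpha> \<beta> (circle_image X r)"
    "\<bar>integral {0..2*pi} (geodesic_form X r)\<bar> \<le> \<tau>"
proof -
  define Y where "Y = (\<lambda>q. X (polar q))"
  define c\<^sub>1 where "c\<^sub>1 t = pd e\<^sub>2 Y (vector [r, t])" for t
  define c\<^sub>2 where "c\<^sub>2 t = pd e\<^sub>2 (pd e\<^sub>2 Y) (vector [r, t])" for t
  have cd: "(circle_image X r has_vector_derivative c\<^sub>1 t) (at t)" "(c\<^sub>1 has_vector_derivative c\<^sub>2 t) (at t)"
    "c\<^sub>1 t \<noteq> 0" "continuous_on S c\<^sub>1" "continuous_on S c\<^sub>2" "speed (circle_image X r) t = norm (c\<^sub>1 t)"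
    "curve_curvature (circle_image X r) t = norm (c\<^sub>1 t \<times> c\<^sub>2 t) / norm (c\<^sub>1 t) ^ 3"
    "geodesic_form X r t = unit_normal X (vector [r * cos t, r * sin t]) \<bullet> (c\<^sub>1 t \<times> c\<^sub>2 t) / (norm (c\<^sub>1 t))\<^sup>2" for t S
    using circle_image_derivatives[OF U circ nz r, folded Y_def, folded c\<^sub>1_def c\<^sub>2_def] by simp_all
  define k\<^sub>c where "k\<^sub>c t = norm (c\<^sub>1 t \<times> c\<^sub>2 t) / (norm (c\<^sub>1 t))\<^sup>2" for t
  have kc: "continuous_on {0..2*pi} k\<^sub>c"
    unfolding k\<^sub>c_def using cd(3) by (intro continuous_intros continuous_on_cross cd) auto
  have gc: "continuous_on {0..2*pi} (geodesic_form X r)"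
    by (rule circle_densities_continuous(2)[OF U circ nz r])
  have periodic: "circle_image X r (2*pi) = circle_image X r 0" "c\<^sub>1 (2*pi) = c\<^sub>1 0"
  proof -
    show "circle_image X r (2*pi) = circle_image X r 0" by (simp add: circle_image_def)
    have per: "Y (q + vector [0, 2*pi]) = Y q" for q by (simp add: Y_def polar_def)
    have "vector [r, 0] + vector [0, 2*pi] = (vector [r, 2*pi] :: real^2)" by (simp add: vec_eq_iff forall_2)
    then show "c\<^sub>1 (2*pi) = c\<^sub>1 0" unfolding c\<^sub>1_def using pd_shift[of Y, OF per] by metis
  qed
  have fen: "2 * pi \<le> integral {0..2*pi} k\<^sub>c"
    unfolding k\<^sub>c_def by (rule fenchel[OF _ cd(1) cd(2) cd(5) cd(3) periodic]) simp
  moreover have "2 * sqrt (\<alpha> * \<beta>) * integral {0..2*pi} k\<^sub>c \<le> curve_energy \<alpha> \<beta> (circle_image X r)"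
  proof -
    have "2 * sqrt (\<alpha> * \<beta>) * integral {0..2*pi} k\<^sub>c = integral {0..2*pi} (\<lambda>t. 2 * sqrt (\<alpha> * \<beta>) * k\<^sub>c t)" by simp
    also have "\<dots> \<le> curve_energy \<alpha> \<beta> (circle_image X r)"
      unfolding curve_energy_def
    proof (rule integral_le)
      show "(\<lambda>t. 2 * sqrt (\<alpha> * \<beta>) * k\<^sub>c t) integrable_on {0..2*pi}"
        by (intro integrable_continuous_interval continuous_intros kc)
      show "(\<lambda>t. (\<alpha> * (curve_curvature (circle_image X r) t)\<^sup>2 + \<beta>) * speed (circle_image X r) t) integrable_on {0..2*pi}"
        by (rule integrable_continuous_interval[OF circle_densities_continuous(1)[OF U circ nz r]])
      show "2 * sqrt (\<alpha> * \<beta>) * k\<^sub>c t \<le> (\<alpha> * (curve_curvature (circle_image X r) t)\<^sup>2 + \<beta>) * speed (circle_image X r) t" for t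
      proof -
        define \<kappa> where "\<kappa> = curve_curvature (circle_image X r) t"
        have "0 \<le> (sqrt \<alpha> * \<kappa> - sqrt \<beta>)\<^sup>2" by simp
        also have "\<dots> = \<alpha> * \<kappa>\<^sup>2 + \<beta> - 2 * sqrt (\<alpha> * \<beta>) * \<kappa>"
          using \<open>\<alpha> > 0\<close> \<open>\<beta> > 0\<close> by (simp add: power2_diff power_mult_distrib real_sqrt_mult)
        finally have "2 * sqrt (\<alpha> * \<beta>) * \<kappa> * speed (circle_image X r) t \<le> (\<alpha> * \<kappa>\<^sup>2 + \<beta>) * speed (circle_image X r) t"
          by (intro mult_right_mono) (auto simp: cd(6))
        moreover have "\<kappa> * speed (circle_image X r) t = k\<^sub>c t"
          using cd(3)[of t] by (simp add: \<kappa>_def cd(6,7) k\<^sub>c_def power2_eq_square power3_eq_cube)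
        ultimately show ?thesis by (simp add: \<kappa>_def mult.assoc)
      qed
    qed
    finally show ?thesis .
  qed
  moreover have "\<bar>integral {0..2*pi} (geodesic_form X r)\<bar> \<le> integral {0..2*pi} k\<^sub>c"
  proof -
    have "\<bar>geodesic_form X r t\<bar> \<le> k\<^sub>c t" for t
    proof -
      have "\<bar>unit_normal X (vector [r * cos t, r * sin t]) \<bullet> (c\<^sub>1 t \<times> c\<^sub>2 t)\<bar> \<le> 1 * norm (c\<^sub>1 t \<times> c\<^sub>2 t)"
        using Cauchy_Schwarz_ineq2 nz[OF circ] by (metis norm_sgn unit_normal_def)
      then show ?thesis unfolding cd(8) k\<^sub>c_def abs_divide by (simp add: divide_right_mono)
    qed
    then show ?thesis
      using integral_norm_bound_integral[OF integrable_continuous_interval[OF gc] integrable_continuous_interval[OF kc]] by simp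
  qed
  ultimately show ?thesis by (rule that)
qed

text \<open>The energy is at least \<open>E_under\<close> times \<tau>1 + \<tau>2, the sum of the
  total curvatures of both circles; \<open>E_under\<close> >= 0 permits replacing each of them by 2
  pi.\<close>

lemma annulus_energy_lower_bound:
  assumes "a > 0" "\<alpha> > 0" "\<beta> > 0" and E: "E_under b \<alpha> \<beta> \<ge> 0" and X: "X \<in> top_annuli"
  shows "E_A b \<alpha> \<beta> \<le> annulus_energy a c\<^sub>o b \<alpha> \<beta> X"
proof -
  have ann: "std_annulus = annulus 1 2" by (simp add: std_annulus_def)
  obtain U where U: "open U" "annulus 1 2 \<subseteq> U" "C_k_on 4 X U" and nz: "\<And>p. p \<in> U \<Longrightarrow> normal_field X p \<noteq> 0"
    using immersion_neighbourhood X unfolding top_annuli_def ann by blast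
  have U2: "C_k_on 2 X U" "C_k_on (Suc (Suc 0)) X U" by (rule C_k_on_le[OF U(3)]; simp)+
  have circ: "vector [s * cos t, s * sin t] \<in> U" if "1 \<le> s" "s \<le> 2" for s t
    using annulus_circle[of 1 s 2 t] that U(2) by auto
  have c1: "vector [1 * cos t, 1 * sin t] \<in> U" for t by (rule circ) auto
  have c2: "vector [2 * cos t, 2 * sin t] \<in> U" for t by (rule circ) auto
  obtain \<tau>1 where \<tau>1: "2 * pi \<le> \<tau>1" "2 * sqrt (\<alpha> * \<beta>) * \<tau>1 \<le> curve_energy \<alpha> \<beta> (circle_image X 1)"
    "\<bar>integral {0..2*pi} (geodesic_form X 1)\<bar> \<le> \<tau>1"
    using curve_energy_total_curvature[OF U(1) U2(2) c1 nz _ assms(2,3)] by auto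
  obtain \<tau>2 where \<tau>2: "2 * pi \<le> \<tau>2" "2 * sqrt (\<alpha> * \<beta>) * \<tau>2 \<le> curve_energy \<alpha> \<beta> (circle_image X 2)"
    "\<bar>integral {0..2*pi} (geodesic_form X 2)\<bar> \<le> \<tau>2"
    using curve_energy_total_curvature[OF U(1) U2(2) c2 nz _ assms(2,3)] by auto
  define J where "J = integral (annulus 1 2) (\<lambda>p. gauss_curvature X p * area_element X p)"
  have J: "\<bar>J\<bar> \<le> \<tau>1 + \<tau>2"
    using gauss_bonnet_annulus[OF _ _ U(1,3,2) nz] \<tau>1(3) \<tau>2(3) by (simp add: J_def)
  note cont = continuous_on_subset[OF curvature_area_continuous(1)[OF U(1) U2(1) nz] U(2)]
    continuous_on_subset[OF curvature_area_continuous(2)[OF U(1) U2(1) nz] U(2)]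
    continuous_on_subset[OF curvature_area_continuous(3)[OF U(1) U2(1) nz] U(2)]
  have "b * J = integral (annulus 1 2) (\<lambda>p. b * (gauss_curvature X p * area_element X p))"
    by (simp add: J_def)
  also have "\<dots> \<le> integral (annulus 1 2) (\<lambda>p. (a * (mean_curvature X p + c\<^sub>o)\<^sup>2 + b * gauss_curvature X p) * area_element X p)"
  proof (rule integral_le)
    show "b * (gauss_curvature X p * area_element X p)
        \<le> (a * (mean_curvature X p + c\<^sub>o)\<^sup>2 + b * gauss_curvature X p) * area_element X p" for p
    proof -
      have "0 \<le> a * (mean_curvature X p + c\<^sub>o)\<^sup>2 * area_element X p"
        using assms(1) by (simp add: area_element_def)
      then show ?thesis by (simp add: algebra_simps)
    qed
    show "(\<lambda>p. b * (gauss_curvature X p * area_element X p)) integrable_on annulus 1 2"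
      by (rule integrable_on_compact[OF compact_annulus], intro continuous_intros cont)
    have "continuous_on (annulus 1 2) (\<lambda>p. (a * (mean_curvature X p + c\<^sub>o)\<^sup>2 + b * gauss_curvature X p) * area_element X p)"
      by (intro continuous_on_mult continuous_on_add continuous_on_power continuous_on_const cont)
    then show "(\<lambda>p. (a * (mean_curvature X p + c\<^sub>o)\<^sup>2 + b * gauss_curvature X p) * area_element X p) integrable_on annulus 1 2"
      by (rule integrable_on_compact[OF compact_annulus])
  qed
  finally have "b * J \<le> surface_energy a c\<^sub>o b std_annulus X" by (simp add: surface_energy_def ann)
  moreover have "- (\<bar>b\<bar> * (\<tau>1 + \<tau>2)) \<le> b * J"
  proof -
    have "\<bar>b * J\<bar> \<le> \<bar>b\<bar> * (\<tau>1 + \<tau>2)" unfolding abs_mult by (rule mult_left_mono[OF J]) simp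
    then show ?thesis by linarith
  qed
  ultimately have "2 * sqrt (\<alpha> * \<beta>) * \<tau>1 + 2 * sqrt (\<alpha> * \<beta>) * \<tau>2 - \<bar>b\<bar> * (\<tau>1 + \<tau>2) \<le> annulus_energy a c\<^sub>o b \<alpha> \<beta> X"
    using \<tau>1(2) \<tau>2(2) unfolding annulus_energy_def by linarith
  moreover have "2 * sqrt (\<alpha> * \<beta>) * \<tau>1 + 2 * sqrt (\<alpha> * \<beta>) * \<tau>2 - \<bar>b\<bar> * (\<tau>1 + \<tau>2) = E_under b \<alpha> \<beta> * (\<tau>1 + \<tau>2)"
    by (simp add: E_under_def algebra_simps)
  moreover have "E_under b \<alpha> \<beta> * (4 * pi) \<le> E_under b \<alpha> \<beta> * (\<tau>1 + \<tau>2)"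
    using \<tau>1(1) \<tau>2(1) by (intro mult_left_mono E) linarith
  ultimately show ?thesis by (simp add: E_A_def mult.commute)
qed

section \<open>Perturbation of the energy\<close>

text \<open>On the compact product of [0, e] and D joint continuity gives a constant bound, so
  dominated convergence applies. The parameters e / (n + 1) tend to 0 within (0, e].\<close>

lemma integral_limit_parameter:
  fixes F :: "real \<Rightarrow> 'a::euclidean_space \<Rightarrow> real"
  assumes "0 < e" "compact D" and F: "continuous_on (Product_Type.Times {0..e} D) (\<lambda>(\<epsilon>, p). F \<epsilon> p)"
  shows "(\<lambda>n. integral D (F (e * inverse (real (Suc n))))) \<longlonglongrightarrow> integral D (F 0)"
proof -
  define x where "x n = e * inverse (real (Suc n))" for n
  have x: "x n \<in> {0..e}" for n
    using \<open>0 < e\<close> by (auto simp: x_def field_simps)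
  have x0: "x \<longlonglongrightarrow> 0"
    unfolding x_def using tendsto_mult_right_zero[OF LIMSEQ_inverse_real_of_nat] by simp
  have "compact ((\<lambda>(\<epsilon>, p). F \<epsilon> p) ` (Product_Type.Times {0..e} D))"
    using F assms(2) by (intro compact_continuous_image compact_Times) auto
  then have "bounded ((\<lambda>(\<epsilon>, p). F \<epsilon> p) ` (Product_Type.Times {0..e} D))" by (rule compact_imp_bounded)
  then obtain B where B0: "\<forall>y\<in>(\<lambda>(\<epsilon>, p). F \<epsilon> p) ` (Product_Type.Times {0..e} D). norm y \<le> B"
    unfolding bounded_iff ..
  have B: "\<bar>F \<epsilon> p\<bar> \<le> B" if "\<epsilon> \<in> {0..e}" "p \<in> D" for \<epsilon> p
    using bspec[OF B0, OF image_eqI[of "F \<epsilon> p" _ "(\<epsilon>, p)"]] that by simp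
  have Fe: "continuous_on D (F \<epsilon>)" if "\<epsilon> \<in> {0..e}" for \<epsilon>
  proof -
    have "continuous_on D (\<lambda>p. (\<lambda>(\<epsilon>, p). F \<epsilon> p) (\<epsilon>, p))"
      by (rule continuous_on_compose2[OF F continuous_on_Pair[OF continuous_on_const continuous_on_id]]) (use that in auto)
    then show ?thesis by simp
  qed
  have "(\<lambda>n. integral D (F (x n))) \<longlonglongrightarrow> integral D (F 0)"
  proof (rule dominated_convergence(2)[where h = "\<lambda>_. B"])
    show "F (x n) integrable_on D" for n by (rule integrable_on_compact[OF assms(2) Fe[OF x]])
    show "(\<lambda>_. B) integrable_on D" by (rule integrable_on_compact[OF assms(2)]) simp
    show "norm (F (x n) p) \<le> B" if "p \<in> D" for n p using B[OF x that] by simp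
    show "(\<lambda>n. F (x n) p) \<longlonglongrightarrow> F 0 p" if "p \<in> D" for p
    proof -
      have "continuous_on {0..e} (\<lambda>\<epsilon>. F \<epsilon> p)"
      proof -
        have "continuous_on {0..e} (\<lambda>\<epsilon>. (\<lambda>(\<epsilon>, p). F \<epsilon> p) (\<epsilon>, p))"
          by (rule continuous_on_compose2[OF F continuous_on_Pair[OF continuous_on_id continuous_on_const]]) (use that in auto)
        then show ?thesis by simp
      qed
      then show ?thesis
        by (rule continuous_on_tendsto_compose[OF _ x0]) (use x \<open>0 < e\<close> in auto)
    qed
  qed
  then show ?thesis by (simp add: x_def)
qed

lemma pd_add_scaleR:
  assumes "X differentiable at p" "W differentiable at p"
  shows "pd v (\<lambda>q. X q + \<epsilon> *\<^sub>R W q) p = pd v X p + \<epsilon> *\<^sub>R pd v W p"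
  by (rule pd_eqI) (intro has_derivative_add has_derivative_scaleR_right assms frechet_derivative_works[THEN iffD1])

lemma pd_pd_add_scaleR:
  assumes "open U" "C_k_on 2 X U" "C_k_on 2 W U" "p \<in> U"
  shows "pd v (pd w (\<lambda>q. X q + \<epsilon> *\<^sub>R W q)) p = pd v (pd w X) p + \<epsilon> *\<^sub>R pd v (pd w W) p"
proof -
  have d: "X differentiable at q" "W differentiable at q" "pd w X differentiable at q" "pd w W differentiable at q"
    if "q \<in> U" for q using assms(2,3) that by (auto simp: numeral_2_eq_2)
  have "pd v (pd w (\<lambda>q. X q + \<epsilon> *\<^sub>R W q)) p = pd v (\<lambda>q. pd w X q + \<epsilon> *\<^sub>R pd w W q) p"
    by (rule pd_cong[OF assms(1,4)]) (rule pd_add_scaleR[OF d(1,2)])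
  then show ?thesis using pd_add_scaleR[OF d(3,4)[OF assms(4)]] by simp
qed

lemma C_k_on_add_scaleR:
  "open U \<Longrightarrow> C_k_on k X U \<Longrightarrow> C_k_on k W U \<Longrightarrow> C_k_on k (\<lambda>q. X q + \<epsilon> *\<^sub>R W q) U"
  by (intro C_k_on_add C_k_on_scaleR C_k_on_const)

text \<open>All derivatives of the perturbed map up to order two are affine in \<epsilon>. As long
  as it stays an immersion for all \<epsilon> in [0, e], the integrand is jointly continuous,
  \<epsilon> = 0 included.\<close>

lemma surface_energy_limit:
  assumes "0 < e" and D: "compact D" "D \<subseteq> U" and U: "open U" "C_k_on 2 X U" "C_k_on 2 W U"
    and nz: "\<And>\<epsilon> p. \<epsilon> \<in> {0..e} \<Longrightarrow> p \<in> D \<Longrightarrow> normal_field (\<lambda>q. X q + \<epsilon> *\<^sub>R W q) p \<noteq> 0"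
  shows "(\<lambda>n. surface_energy a c b D (\<lambda>q. X q + (e * inverse (real (Suc n))) *\<^sub>R W q)) \<longlonglongrightarrow> surface_energy a c b D X"
proof -
  define A where "A \<epsilon> p = pd e\<^sub>1 X p + \<epsilon> *\<^sub>R pd e\<^sub>1 W p" for \<epsilon> p
  define B where "B \<epsilon> p = pd e\<^sub>2 X p + \<epsilon> *\<^sub>R pd e\<^sub>2 W p" for \<epsilon> p
  define P where "P \<epsilon> p = pd e\<^sub>1 (pd e\<^sub>1 X) p + \<epsilon> *\<^sub>R pd e\<^sub>1 (pd e\<^sub>1 W) p" for \<epsilon> p
  define Q where "Q \<epsilon> p = pd e\<^sub>1 (pd e\<^sub>2 X) p + \<epsilon> *\<^sub>R pd e\<^sub>1 (pd e\<^sub>2 W) p" for \<epsilon> p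
  define R where "R \<epsilon> p = pd e\<^sub>2 (pd e\<^sub>2 X) p + \<epsilon> *\<^sub>R pd e\<^sub>2 (pd e\<^sub>2 W) p" for \<epsilon> p
  have diff: "X differentiable at p" "W differentiable at p" if "p \<in> U" for p
    using U(2,3) that by (auto simp: numeral_2_eq_2)
  define F where "F \<epsilon> p = (a * (mean_of (A \<epsilon> p) (B \<epsilon> p) (P \<epsilon> p) (Q \<epsilon> p) (R \<epsilon> p) + c)\<^sup>2
     + b * gauss_of (A \<epsilon> p) (B \<epsilon> p) (P \<epsilon> p) (Q \<epsilon> p) (R \<epsilon> p)) * norm (A \<epsilon> p \<times> B \<epsilon> p)" for \<epsilon> p
  have N: "normal_field (\<lambda>q. X q + \<epsilon> *\<^sub>R W q) p = A \<epsilon> p \<times> B \<epsilon> p" if "p \<in> D" for \<epsilon> p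
    using that D diff by (simp add: normal_field_pd pd_add_scaleR A_def B_def subset_iff)
  have nz': "A \<epsilon> p \<times> B \<epsilon> p \<noteq> 0" if "\<epsilon> \<in> {0..e}" "p \<in> D" for \<epsilon> p
    using nz[OF that] N[OF that(2)] by simp
  have se: "surface_energy a c b D (\<lambda>q. X q + \<epsilon> *\<^sub>R W q) = integral D (F \<epsilon>)" if "\<epsilon> \<in> {0..e}" for \<epsilon>
    unfolding surface_energy_def
  proof (rule integral_cong)
    fix p assume p: "p \<in> D"
    then have pU: "p \<in> U" using D by blast
    note cf = curvature_formulas[OF U(1) C_k_on_add_scaleR[OF U] pU nz[OF that p]]
    show "(a * (mean_curvature (\<lambda>q. X q + \<epsilon> *\<^sub>R W q) p + c)\<^sup>2 + b * gauss_curvature (\<lambda>q. X q + \<epsilon> *\<^sub>R W q) p)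
        * area_element (\<lambda>q. X q + \<epsilon> *\<^sub>R W q) p = F \<epsilon> p"
      unfolding cf area_element_def N[OF p] pd_pd_add_scaleR[OF U pU] pd_add_scaleR[OF diff[OF pU]] F_def
      by (simp add: A_def B_def P_def Q_def R_def)
  qed
  have fst_snd: "continuous_on (Product_Type.Times {0..e} D) (\<lambda>x. f (snd x))" if "continuous_on U f" for f :: "real^2 \<Rightarrow> real^3"
    by (rule continuous_on_compose2[OF that continuous_on_snd[OF continuous_on_id]]) (use D in auto)
  have cont: "continuous_on (Product_Type.Times {0..e} D) (\<lambda>x. A (fst x) (snd x))" "continuous_on (Product_Type.Times {0..e} D) (\<lambda>x. B (fst x) (snd x))"
    "continuous_on (Product_Type.Times {0..e} D) (\<lambda>x. P (fst x) (snd x))" "continuous_on (Product_Type.Times {0..e} D) (\<lambda>x. Q (fst x) (snd x))"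
    "continuous_on (Product_Type.Times {0..e} D) (\<lambda>x. R (fst x) (snd x))"
    unfolding A_def B_def P_def Q_def R_def
    by (intro continuous_on_add continuous_on_scaleR continuous_on_fst[OF continuous_on_id] fst_snd C2_continuous U)+
  have nzF: "A (fst x) (snd x) \<times> B (fst x) (snd x) \<noteq> 0" if "x \<in> Product_Type.Times {0..e} D" for x using nz' that by auto
  have "continuous_on (Product_Type.Times {0..e} D) (\<lambda>x. F (fst x) (snd x))"
    unfolding F_def mean_of_def gauss_of_def sgn_div_norm
    using nzF by (intro continuous_intros continuous_on_cross cont) auto
  then have "continuous_on (Product_Type.Times {0..e} D) (\<lambda>(\<epsilon>, p). F \<epsilon> p)" by (simp add: split_beta)
  from integral_limit_parameter[OF assms(1) D(1) this]
  have "(\<lambda>n. integral D (F (e * inverse (real (Suc n))))) \<longlonglongrightarrow> integral D (F 0)" .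
  moreover have "e * inverse (real (Suc n)) \<in> {0..e}" for n using assms(1) by (auto simp: field_simps)
  moreover have "surface_energy a c b D X = integral D (F 0)" using se[of 0] assms(1) by simp
  ultimately show ?thesis using se by simp
qed

lemma curve_energy_limit:
  assumes "0 < e" "r > 0" and circ: "\<And>t. vector [r * cos t, r * sin t] \<in> D" and D: "D \<subseteq> U"
    and U: "open U" "C_k_on 2 X U" "C_k_on 2 W U"
    and nz: "\<And>\<epsilon> p. \<epsilon> \<in> {0..e} \<Longrightarrow> p \<in> D \<Longrightarrow> normal_field (\<lambda>q. X q + \<epsilon> *\<^sub>R W q) p \<noteq> 0"
  shows "(\<lambda>n. curve_energy \<alpha> \<beta> (circle_image (\<lambda>q. X q + (e * inverse (real (Suc n))) *\<^sub>R W q) r))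
    \<longlonglongrightarrow> curve_energy \<alpha> \<beta> (circle_image X r)"
proof -
  define Z where "Z \<epsilon> q = X q + \<epsilon> *\<^sub>R W q" for \<epsilon> q
  define c\<^sub>1 where "c\<^sub>1 Y t = pd e\<^sub>2 (\<lambda>q. Y (polar q)) (vector [r, t])" for Y :: "real^2 \<Rightarrow> real^3" and t
  define c\<^sub>2 where "c\<^sub>2 Y t = pd e\<^sub>2 (pd e\<^sub>2 (\<lambda>q. Y (polar q))) (vector [r, t])" for Y :: "real^2 \<Rightarrow> real^3" and t
  have circU: "vector [r * cos t, r * sin t] \<in> U" for t using circ D by blast
  have op: "open (polar -` U)" by (rule open_vimage_polar[OF U(1)])
  note Cp = C_k_on_compose_polar[OF U(1) U(2)] C_k_on_compose_polar[OF U(1) U(3)]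
  have inV: "vector [r, t] \<in> polar -` U" for t using circU by (simp add: polar_vector)
  have dp: "(\<lambda>q. X (polar q)) differentiable at (vector [r, t])" "(\<lambda>q. W (polar q)) differentiable at (vector [r, t])" for t
    using Cp[unfolded numeral_2_eq_2] inV by auto
  have c: "c\<^sub>1 (Z \<epsilon>) t = c\<^sub>1 X t + \<epsilon> *\<^sub>R c\<^sub>1 W t" "c\<^sub>2 (Z \<epsilon>) t = c\<^sub>2 X t + \<epsilon> *\<^sub>R c\<^sub>2 W t" for \<epsilon> t
    unfolding c\<^sub>1_def c\<^sub>2_def Z_def using pd_add_scaleR[OF dp] pd_pd_add_scaleR[OF op Cp inV] by auto
  define K where "K A B = (\<alpha> * (norm (A \<times> B) / norm A ^ 3)\<^sup>2 + \<beta>) * norm A" for A B :: "real^3"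
  have fm: "speed (circle_image (Z \<epsilon>) r) t = norm (c\<^sub>1 (Z \<epsilon>) t)"
    "curve_curvature (circle_image (Z \<epsilon>) r) t = norm (c\<^sub>1 (Z \<epsilon>) t \<times> c\<^sub>2 (Z \<epsilon>) t) / norm (c\<^sub>1 (Z \<epsilon>) t) ^ 3"
    "c\<^sub>1 (Z \<epsilon>) t \<noteq> 0" if \<epsilon>: "\<epsilon> \<in> {0..e}" for \<epsilon> t
  proof -
    have CZ: "C_k_on 2 (Z \<epsilon>) U" unfolding Z_def by (rule C_k_on_add_scaleR[OF U])
    \<comment> \<open>The formulas for the circle ask for an open set of regular points, which here
      depends on \<epsilon>.\<close>
    define U' where "U' = {p \<in> U. normal_field (Z \<epsilon>) p \<noteq> 0}"
    have oU': "open U'"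
      unfolding U'_def by (rule open_regular_set[OF U(1) CZ[unfolded numeral_2_eq_2]])
    have CU': "C_k_on (Suc (Suc 0)) (Z \<epsilon>) U'"
      using C_k_on_subset[OF CZ, of U'] by (auto simp: U'_def numeral_2_eq_2)
    have cU': "vector [r * cos t, r * sin t] \<in> U'" for t
      using circU nz[OF \<epsilon> circ] by (auto simp: U'_def Z_def[abs_def])
    have nU': "normal_field (Z \<epsilon>) p \<noteq> 0" if "p \<in> U'" for p using that by (simp add: U'_def)
    note cd = circle_image_derivatives[OF oU' CU' cU' nU' assms(2)]
    show "speed (circle_image (Z \<epsilon>) r) t = norm (c\<^sub>1 (Z \<epsilon>) t)" unfolding c\<^sub>1_def by (rule cd(6))
    show "curve_curvature (circle_image (Z \<epsilon>) r) t = norm (c\<^sub>1 (Z \<epsilon>) t \<times> c\<^sub>2 (Z \<epsilon>) t) / norm (c\<^sub>1 (Z \<epsilon>) t) ^ 3"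
      unfolding c\<^sub>1_def c\<^sub>2_def by (rule cd(7))
    show "c\<^sub>1 (Z \<epsilon>) t \<noteq> 0" unfolding c\<^sub>1_def by (rule cd(3))
  qed
  have ce: "curve_energy \<alpha> \<beta> (circle_image (Z \<epsilon>) r) = integral {0..2*pi} (\<lambda>t. K (c\<^sub>1 X t + \<epsilon> *\<^sub>R c\<^sub>1 W t) (c\<^sub>2 X t + \<epsilon> *\<^sub>R c\<^sub>2 W t))"
    if "\<epsilon> \<in> {0..e}" for \<epsilon>
    unfolding curve_energy_def fm(1,2)[OF that] K_def c ..
  have cc: "continuous_on UNIV (c\<^sub>1 Y)" "continuous_on UNIV (c\<^sub>2 Y)" if "C_k_on 2 (\<lambda>q. Y (polar q)) (polar -` U)" for Y
  proof -
    have v: "continuous_on UNIV (\<lambda>t. vector [r, t] :: real^2)" unfolding vector_2_axis by (intro continuous_intros)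
    show "continuous_on UNIV (c\<^sub>1 Y)" "continuous_on UNIV (c\<^sub>2 Y)"
      unfolding c\<^sub>1_def c\<^sub>2_def
      by (rule continuous_on_compose2[OF C2_continuous(1)[OF that] v] continuous_on_compose2[OF C2_continuous(2)[OF that] v];
          use inV in auto)+
  qed
  have fs: "continuous_on (Product_Type.Times {0..e} {0..2*pi}) (\<lambda>x. f (snd x))" if "continuous_on UNIV f" for f :: "real \<Rightarrow> real^3"
    by (rule continuous_on_compose2[OF that continuous_on_snd[OF continuous_on_id]]) auto
  have nz1: "c\<^sub>1 X t + \<epsilon> *\<^sub>R c\<^sub>1 W t \<noteq> 0" if "\<epsilon> \<in> {0..e}" for \<epsilon> t using fm(3)[OF that, of t] unfolding c .
  have "continuous_on (Product_Type.Times {0..e} {0..2*pi}) (\<lambda>x. K (c\<^sub>1 X (snd x) + fst x *\<^sub>R c\<^sub>1 W (snd x)) (c\<^sub>2 X (snd x) + fst x *\<^sub>R c\<^sub>2 W (snd x)))"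
    unfolding K_def using nz1
    by (intro continuous_intros continuous_on_cross fs cc Cp) auto
  then have "continuous_on (Product_Type.Times {0..e} {0..2*pi}) (\<lambda>(\<epsilon>, t). K (c\<^sub>1 X t + \<epsilon> *\<^sub>R c\<^sub>1 W t) (c\<^sub>2 X t + \<epsilon> *\<^sub>R c\<^sub>2 W t))"
    by (simp add: split_beta)
  from integral_limit_parameter[OF assms(1) compact_Icc this]
  have "(\<lambda>n. curve_energy \<alpha> \<beta> (circle_image (Z (e * inverse (real (Suc n)))) r)) \<longlonglongrightarrow> curve_energy \<alpha> \<beta> (circle_image (Z 0) r)"
  proof -
    assume *: "(\<lambda>n. integral {0..2*pi} (\<lambda>t. K (c\<^sub>1 X t + (e * inverse (real (Suc n))) *\<^sub>R c\<^sub>1 W t) (c\<^sub>2 X t + (e * inverse (real (Suc n))) *\<^sub>R c\<^sub>2 W t)))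
      \<longlonglongrightarrow> integral {0..2*pi} (\<lambda>t. K (c\<^sub>1 X t + 0 *\<^sub>R c\<^sub>1 W t) (c\<^sub>2 X t + 0 *\<^sub>R c\<^sub>2 W t))"
    have "e * inverse (real (Suc n)) \<in> {0..e}" for n using assms(1) by (auto simp: field_simps)
    moreover have "0 \<in> {0..e}" using assms(1) by simp
    ultimately show ?thesis using * by (simp only: ce)
  qed
  then show ?thesis by (simp add: Z_def[abs_def])
qed

section \<open>Surfaces of revolution and their spiral perturbations\<close>

lemma nth_derivs:
  fixes v :: "real^2"
  shows "((\<lambda>v::real^2. v $ i) has_derivative (\<lambda>h. h $ i)) (at v)"
  by (rule bounded_linear_imp_has_derivative) (rule bounded_linear_vec_nth)

lemma compose_nth_derivs:
  fixes f :: "real \<Rightarrow> real" and v :: "real^2"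
  assumes "(f has_real_derivative d) (at (v $ i))"
  shows "((\<lambda>v. f (v $ i)) has_derivative (\<lambda>h. d * h $ i)) (at v)"
  using diff_chain_at[OF nth_derivs assms[unfolded has_field_derivative_def]] by (simp add: o_def)

text \<open>The profile curve \<open>(r u, z u)\<close> of a surface of revolution, parametrised by its angle \<open>u\<close> with the
  horizontal; \<open>1 / w\<close> is its curvature.\<close>

locale profile =
  fixes r z w w' :: "real \<Rightarrow> real" and I :: "real set" and u0 u1 :: real
  assumes I: "open I" "{u0..u1} \<subseteq> I" "u0 < u1"
    and smooth: "C_k_on 4 r I" "C_k_on 4 z I"
    and der: "u \<in> I \<Longrightarrow> (r has_real_derivative w u * cos u) (at u)"
      "u \<in> I \<Longrightarrow> (z has_real_derivative w u * sin u) (at u)"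
      "u \<in> I \<Longrightarrow> (w has_real_derivative w' u) (at u)"
    and pos: "u \<in> I \<Longrightarrow> w u > 0" "u \<in> I \<Longrightarrow> r u > 0"
    and inj: "inj_on z {u0..u1}"
begin

text \<open>The coordinates are rotation angle and profile angle. The rotation angle is not
  restricted, so \<open>revolve\<close> covers the surface infinitely often and can follow a strip
  through any number of turns.\<close>

definition param_dom :: "(real^2) set" where "param_dom = {v. v $ 2 \<in> I}"

definition revolve :: "real^2 \<Rightarrow> real^3" where
  "revolve v = vector [r (v $ 2) * cos (v $ 1), r (v $ 2) * sin (v $ 1), z (v $ 2)]"

definition drift :: "real^2 \<Rightarrow> real^3" where
  "drift v = vector [v $ 1 * cos (v $ 1), v $ 1 * sin (v $ 1), 0]"

definition spiral :: "real \<Rightarrow> real^2 \<Rightarrow> real^3" where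
  "spiral \<epsilon> v = revolve v + \<epsilon> *\<^sub>R drift v"

lemma spiral_eq: "spiral \<epsilon> v = vector [(r (v $ 2) + \<epsilon> * v $ 1) * cos (v $ 1), (r (v $ 2) + \<epsilon> * v $ 1) * sin (v $ 1), z (v $ 2)]"
  by (simp add: spiral_def revolve_def drift_def vec_eq_iff forall_3 algebra_simps)

lemma open_dom: "open param_dom"
proof -
  have "open ((\<lambda>v::real^2. v $ 2) -` I)" by (intro open_vimage I(1) continuous_intros)
  then show ?thesis by (simp add: param_dom_def vimage_def)
qed

lemma smooth_rev: "C_k_on 4 revolve param_dom" and smooth_drift: "C_k_on 4 drift param_dom"
proof -
  have c: "C_k_on 4 (\<lambda>v::real^2. f (v $ 2)) param_dom" if "C_k_on 4 f I" for f :: "real \<Rightarrow> real"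
    by (rule C_k_on_compose[OF open_dom I(1) that C_k_on_nth[OF open_dom]]) (simp add: param_dom_def)
  have s: "C_k_on 4 (\<lambda>v::real^2. f (v $ 1)) param_dom" if "C_k_on 4 f UNIV" for f :: "real \<Rightarrow> real"
    by (rule C_k_on_compose[OF open_dom open_UNIV that C_k_on_nth[OF open_dom]]) simp
  have sc: "C_k_on 4 (sin :: real \<Rightarrow> real) UNIV" "C_k_on 4 (cos :: real \<Rightarrow> real) UNIV"
    using C_k_on_sin_cos[of "UNIV::real set" 4] by auto
  show "C_k_on 4 revolve param_dom" unfolding revolve_def[abs_def]
    by (intro C_k_on_vector3 C_k_on_mult open_dom c s sc smooth)
  show "C_k_on 4 drift param_dom" unfolding drift_def[abs_def]
    by (intro C_k_on_vector3 C_k_on_mult open_dom s sc C_k_on_const C_k_on_nth)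
qed

lemma pd_spiral:
  assumes "v \<in> param_dom"
  shows "pd e\<^sub>1 (spiral \<epsilon>) v = vector [\<epsilon> * cos (v $ 1) - (r (v $ 2) + \<epsilon> * v $ 1) * sin (v $ 1),
      \<epsilon> * sin (v $ 1) + (r (v $ 2) + \<epsilon> * v $ 1) * cos (v $ 1), 0]"
    and "pd e\<^sub>2 (spiral \<epsilon>) v = vector [w (v $ 2) * cos (v $ 2) * cos (v $ 1), w (v $ 2) * cos (v $ 2) * sin (v $ 1), w (v $ 2) * sin (v $ 2)]"
proof -
  have u: "v $ 2 \<in> I" using assms by (simp add: param_dom_def)
  have "(spiral \<epsilon> has_derivative (\<lambda>h. vector
      [(r (v $ 2) + \<epsilon> * v $ 1) * (- sin (v $ 1) * h $ 1) + (w (v $ 2) * cos (v $ 2) * h $ 2 + \<epsilon> * h $ 1) * cos (v $ 1),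
       (r (v $ 2) + \<epsilon> * v $ 1) * (cos (v $ 1) * h $ 1) + (w (v $ 2) * cos (v $ 2) * h $ 2 + \<epsilon> * h $ 1) * sin (v $ 1),
       w (v $ 2) * sin (v $ 2) * h $ 2])) (at v)"
    unfolding spiral_eq[abs_def]
    by (intro has_derivative_vector3 has_derivative_mult has_derivative_add has_derivative_mult_right
        compose_nth_derivs der u DERIV_cos DERIV_sin nth_derivs)
  from pd_eqI[OF this]
  show "pd e\<^sub>1 (spiral \<epsilon>) v = vector [\<epsilon> * cos (v $ 1) - (r (v $ 2) + \<epsilon> * v $ 1) * sin (v $ 1),
      \<epsilon> * sin (v $ 1) + (r (v $ 2) + \<epsilon> * v $ 1) * cos (v $ 1), 0]"
    "pd e\<^sub>2 (spiral \<epsilon>) v = vector [w (v $ 2) * cos (v $ 2) * cos (v $ 1), w (v $ 2) * cos (v $ 2) * sin (v $ 1), w (v $ 2) * sin (v $ 2)]"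
    by (simp_all add: axis_def vec_eq_iff forall_3)
qed

text \<open>With R the distance to the axis, the normal has vertical component - R w cos u and a
  horizontal part of length w |sin u| sqrt (R^2 + \<epsilon>^2); for R > 0 these do not vanish
  together.\<close>

lemma normal_field_spiral:
  assumes "v \<in> param_dom" "r (v $ 2) + \<epsilon> * v $ 1 > 0"
  shows "normal_field (spiral \<epsilon>) v \<noteq> 0"
proof
  define \<theta> u R where "\<theta> = v $ 1" and "u = v $ 2" and "R = r (v $ 2) + \<epsilon> * v $ 1"
  assume "normal_field (spiral \<epsilon>) v = 0"
  then have "(\<epsilon> * sin \<theta> + R * cos \<theta>) * (w u * sin u) = 0"
    and "(\<epsilon> * cos \<theta> - R * sin \<theta>) * (w u * sin u) = 0"
    and "(\<epsilon> * cos \<theta> - R * sin \<theta>) * (w u * cos u * sin \<theta>) - (\<epsilon> * sin \<theta> + R * cos \<theta>) * (w u * cos u * cos \<theta>) = 0"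
    unfolding normal_field_pd pd_spiral[OF assms(1)]
    by (simp_all add: cross3_def vec_eq_iff forall_3 \<theta>_def u_def R_def)
  moreover have "w u > 0" using pos(1) assms(1) by (simp add: u_def param_dom_def)
  moreover have "(\<epsilon> * cos \<theta> - R * sin \<theta>) * (w u * cos u * sin \<theta>) - (\<epsilon> * sin \<theta> + R * cos \<theta>) * (w u * cos u * cos \<theta>) = - R * w u * cos u"
    using sin_cos_squared_add[of \<theta>] by algebra
  moreover have "R > 0" using assms(2) by (simp add: R_def)
  ultimately have "cos u = 0" and *: "sin u = 0 \<or> \<epsilon> * sin \<theta> + R * cos \<theta> = 0 \<and> \<epsilon> * cos \<theta> - R * sin \<theta> = 0"
    by auto
  then have "sin u \<noteq> 0" using sin_cos_squared_add[of u] by auto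
  then have "\<epsilon> * sin \<theta> + R * cos \<theta> = 0" "\<epsilon> * cos \<theta> - R * sin \<theta> = 0" using * by auto
  then have "R = 0" using sin_cos_squared_add[of \<theta>] by algebra
  then show False using \<open>R > 0\<close> by simp
qed

lemma spiral_0: "spiral 0 = revolve"
  by (simp add: fun_eq_iff spiral_def)

lemma normal_rev:
  assumes "v \<in> param_dom"
  shows "normal_field revolve v = (r (v $ 2) * w (v $ 2)) *\<^sub>R vector [sin (v $ 2) * cos (v $ 1), sin (v $ 2) * sin (v $ 1), - cos (v $ 2)]"
    and "unit_normal revolve v = vector [sin (v $ 2) * cos (v $ 1), sin (v $ 2) * sin (v $ 1), - cos (v $ 2)]"
    and "normal_field revolve v \<noteq> 0"
proof -
  let ?\<nu> = "vector [sin (v $ 2) * cos (v $ 1), sin (v $ 2) * sin (v $ 1), - cos (v $ 2)] :: real^3"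
  note p = pd_spiral[OF assms, of 0, unfolded spiral_0, simplified]
  have "- (r (v $ 2) * sin (v $ 1)) * (w (v $ 2) * cos (v $ 2) * sin (v $ 1)) - r (v $ 2) * cos (v $ 1) * (w (v $ 2) * cos (v $ 2) * cos (v $ 1))
      = - (r (v $ 2) * w (v $ 2) * cos (v $ 2))"
    using sin_cos_squared_add[of "v $ 1"] by algebra
  then show 1: "normal_field revolve v = (r (v $ 2) * w (v $ 2)) *\<^sub>R ?\<nu>"
    unfolding normal_field_pd p by (simp add: cross3_def vec_eq_iff forall_3)
  have rw: "r (v $ 2) * w (v $ 2) > 0" using pos assms by (simp add: param_dom_def)
  have "?\<nu> \<bullet> ?\<nu> = 1"
  proof -
    have "sin (v $ 2) * cos (v $ 1) * (sin (v $ 2) * cos (v $ 1)) + sin (v $ 2) * sin (v $ 1) * (sin (v $ 2) * sin (v $ 1)) + cos (v $ 2) * cos (v $ 2) = 1"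
      using sin_cos_squared_add[of "v $ 1"] sin_cos_squared_add[of "v $ 2"] by algebra
    then show ?thesis by (simp add: inner_vec_def sum_3)
  qed
  then have n: "norm ?\<nu> = 1" by (simp add: norm_eq_sqrt_inner)
  then show "unit_normal revolve v = ?\<nu>"
    using rw by (simp add: unit_normal_def 1 sgn_scaleR) (simp add: sgn_div_norm)
  show "normal_field revolve v \<noteq> 0"
  proof
    assume "normal_field revolve v = 0"
    then have "norm ((r (v $ 2) * w (v $ 2)) *\<^sub>R ?\<nu>) = 0" by (simp add: 1)
    then show False using n rw by auto
  qed
qed

text \<open>Both fundamental forms are diagonal in these coordinates, so parallels and meridians are
  the lines of curvature, with normal curvatures - sin u / r and - 1 / w.\<close>

lemma curvatures_rev:
  assumes v: "v \<in> param_dom"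
  shows "mean_curvature revolve v = - (1 / w (v $ 2) + sin (v $ 2) / r (v $ 2)) / 2"
    and "gauss_curvature revolve v = 1 / w (v $ 2) * (sin (v $ 2) / r (v $ 2))"
proof -
  define \<theta> u where "\<theta> = v $ 1" and "u = v $ 2"
  define R W where "R = r u" and "W = w u"
  have uI: "u \<in> I" using v by (simp add: param_dom_def u_def)
  have RW: "R > 0" "W > 0" using pos uI by (auto simp: R_def W_def)
  define \<nu> where "\<nu> = (vector [sin u * cos \<theta>, sin u * sin \<theta>, - cos u] :: real^3)"
  note p = pd_spiral[of _ 0, unfolded spiral_0, simplified]
  have 1: "pd e\<^sub>1 revolve v = vector [- R * sin \<theta>, R * cos \<theta>, 0]" "pd e\<^sub>2 revolve v = vector [W * cos u * cos \<theta>, W * cos u * sin \<theta>, W * sin u]"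
    using p[OF v] by (simp_all add: \<theta>_def u_def R_def W_def)
  have 11: "pd e\<^sub>1 (pd e\<^sub>1 revolve) v = vector [- R * cos \<theta>, - R * sin \<theta>, 0]"
  proof -
    have "pd e\<^sub>1 (pd e\<^sub>1 revolve) v = pd e\<^sub>1 (\<lambda>v. vector [r (v $ 2) * (- sin (v $ 1)), r (v $ 2) * cos (v $ 1), 0] :: real^3) v"
      by (rule pd_cong[OF open_dom v]) (simp add: p)
    note * = this
    have "((\<lambda>v. vector [r (v $ 2) * (- sin (v $ 1)), r (v $ 2) * cos (v $ 1), 0] :: real^3) has_derivative
       (\<lambda>h. vector [r (v $ 2) * (- (cos (v $ 1) * h $ 1)) + w (v $ 2) * cos (v $ 2) * h $ 2 * (- sin (v $ 1)),
         r (v $ 2) * (- sin (v $ 1) * h $ 1) + w (v $ 2) * cos (v $ 2) * h $ 2 * cos (v $ 1), 0])) (at v)"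
      using uI by (intro has_derivative_vector3 has_derivative_mult has_derivative_minus compose_nth_derivs der
          DERIV_cos DERIV_sin has_derivative_const) (auto simp: u_def)
    from pd_eqI[OF this] show ?thesis
      unfolding * by (simp add: axis_def \<theta>_def u_def R_def)
  qed
  have 2: "pd e (pd e\<^sub>2 revolve) v = vector [W * cos u * (- sin \<theta> * e $ 1) + (W * (- sin u * e $ 2) + w' u * e $ 2 * cos u) * cos \<theta>,
        W * cos u * (cos \<theta> * e $ 1) + (W * (- sin u * e $ 2) + w' u * e $ 2 * cos u) * sin \<theta>,
        W * (cos u * e $ 2) + w' u * e $ 2 * sin u]" for e
  proof -
    have "pd e (pd e\<^sub>2 revolve) v = pd e (\<lambda>v. vector [w (v $ 2) * cos (v $ 2) * cos (v $ 1), w (v $ 2) * cos (v $ 2) * sin (v $ 1), w (v $ 2) * sin (v $ 2)] :: real^3) v"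
      by (rule pd_cong[OF open_dom v]) (simp add: p)
    note * = this
    have "((\<lambda>v. vector [w (v $ 2) * cos (v $ 2) * cos (v $ 1), w (v $ 2) * cos (v $ 2) * sin (v $ 1), w (v $ 2) * sin (v $ 2)] :: real^3) has_derivative
       (\<lambda>h. vector [w (v $ 2) * cos (v $ 2) * (- sin (v $ 1) * h $ 1) + (w (v $ 2) * (- sin (v $ 2) * h $ 2) + w' (v $ 2) * h $ 2 * cos (v $ 2)) * cos (v $ 1),
        w (v $ 2) * cos (v $ 2) * (cos (v $ 1) * h $ 1) + (w (v $ 2) * (- sin (v $ 2) * h $ 2) + w' (v $ 2) * h $ 2 * cos (v $ 2)) * sin (v $ 1),
        w (v $ 2) * (cos (v $ 2) * h $ 2) + w' (v $ 2) * h $ 2 * sin (v $ 2)])) (at v)"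
      using uI by (intro has_derivative_vector3 has_derivative_mult compose_nth_derivs der DERIV_cos DERIV_sin) (auto simp: u_def)
    from pd_eqI[OF this, of e] show ?thesis
      unfolding * by (simp add: \<theta>_def u_def W_def)
  qed
  have 12: "pd e\<^sub>1 (pd e\<^sub>2 revolve) v = vector [- W * cos u * sin \<theta>, W * cos u * cos \<theta>, 0]"
    unfolding 2 by (simp add: axis_def)
  have 22: "pd e\<^sub>2 (pd e\<^sub>2 revolve) v = vector [(w' u * cos u - W * sin u) * cos \<theta>, (w' u * cos u - W * sin u) * sin \<theta>, W * cos u + w' u * sin u]"
    unfolding 2 by (simp add: axis_def)
  have \<nu>: "sgn (pd e\<^sub>1 revolve v \<times> pd e\<^sub>2 revolve v) = \<nu>"
    using normal_rev(2)[OF v] by (simp add: unit_normal_pd \<nu>_def \<theta>_def u_def)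
  have sc: "sin \<theta> * sin \<theta> + cos \<theta> * cos \<theta> = 1" "sin u * sin u + cos u * cos u = 1"
    using sin_cos_squared_add[of \<theta>] sin_cos_squared_add[of u] by (simp_all add: power2_eq_square)
  note inner3 = inner_vec_def sum_3 vector_3 inner_real_def
  have E1: "pd e\<^sub>1 revolve v \<bullet> pd e\<^sub>1 revolve v = R * R"
    unfolding 1 inner3 using sc by algebra
  have E2: "pd e\<^sub>1 revolve v \<bullet> pd e\<^sub>2 revolve v = 0"
    unfolding 1 inner3 by algebra
  have E3: "pd e\<^sub>2 revolve v \<bullet> pd e\<^sub>2 revolve v = W * W"
    unfolding 1 inner3 using sc by algebra
  note E = E1 E2 E3
  have L1: "pd e\<^sub>1 (pd e\<^sub>1 revolve) v \<bullet> \<nu> = - R * sin u"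
    unfolding 11 \<nu>_def inner3 using sc by algebra
  have L2: "pd e\<^sub>1 (pd e\<^sub>2 revolve) v \<bullet> \<nu> = 0"
    unfolding 12 \<nu>_def inner3 by algebra
  have L3: "pd e\<^sub>2 (pd e\<^sub>2 revolve) v \<bullet> \<nu> = - W"
    unfolding 22 \<nu>_def inner3 using sc by algebra
  note L = L1 L2 L3
  have N: "(norm (pd e\<^sub>1 revolve v \<times> pd e\<^sub>2 revolve v))\<^sup>2 = R * R * (W * W)"
    unfolding norm_cross_square E by simp
  have "C_k_on 2 revolve param_dom" by (rule C_k_on_le[OF smooth_rev]) simp
  note cf = curvature_formulas[OF open_dom this v normal_rev(3)[OF v]]
  show "mean_curvature revolve v = - (1 / w (v $ 2) + sin (v $ 2) / r (v $ 2)) / 2"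
    unfolding cf(1) mean_of_def \<nu> E L N u_def[symmetric] R_def[symmetric] W_def[symmetric]
    using RW by (simp add: field_simps)
  show "gauss_curvature revolve v = 1 / w (v $ 2) * (sin (v $ 2) / r (v $ 2))"
    unfolding cf(2) gauss_of_def \<nu> E L N u_def[symmetric] R_def[symmetric] W_def[symmetric]
    using RW by (simp add: field_simps)
qed

text \<open>The height determines the profile angle, as z is injective there; the distance to the
  axis then determines the rotation angle, since it grows with slope \<epsilon> > 0. Positivity lets
  the distance be recovered from the point.\<close>

lemma inj_spiral:
  assumes "\<epsilon> > 0"
  shows "inj_on (spiral \<epsilon>) {v. v $ 2 \<in> {u0..u1} \<and> r (v $ 2) + \<epsilon> * v $ 1 > 0}"
proof (rule inj_onI)
  fix p q :: "real^2"
  assume p: "p \<in> {v. v $ 2 \<in> {u0..u1} \<and> r (v $ 2) + \<epsilon> * v $ 1 > 0}"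
    and q: "q \<in> {v. v $ 2 \<in> {u0..u1} \<and> r (v $ 2) + \<epsilon> * v $ 1 > 0}" and eq: "spiral \<epsilon> p = spiral \<epsilon> q"
  define S T where "S = r (p $ 2) + \<epsilon> * p $ 1" and "T = r (q $ 2) + \<epsilon> * q $ 1"
  have e: "S * cos (p $ 1) = T * cos (q $ 1)" "S * sin (p $ 1) = T * sin (q $ 1)" "z (p $ 2) = z (q $ 2)"
    using eq by (simp_all add: spiral_eq vec_eq_iff forall_3 S_def T_def)
  have 2: "p $ 2 = q $ 2" using e(3) inj p q by (auto dest: inj_onD)
  have "S\<^sup>2 = T\<^sup>2"
    using e(1,2) sin_cos_squared_add[of "p $ 1"] sin_cos_squared_add[of "q $ 1"] by algebra
  moreover have "S > 0" "T > 0" using p q by (auto simp: S_def T_def)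
  ultimately have "S = T" by (simp add: power2_eq_iff)
  then have "p $ 1 = q $ 1" using 2 assms by (simp add: S_def T_def)
  then show "p = q" using 2 by (simp add: vec_eq_iff forall_2)
qed

end

section \<open>Stretched parameter domains\<close>

lemma C_k_on_pos_part_power: "C_k_on k (\<lambda>t::real. max 0 t ^ Suc k) UNIV"
proof (induction k)
  case 0
  then show ?case by (simp add: continuous_on_max)
next
  case (Suc k)
  show ?case
  proof (rule C_k_on_real_SucI[OF open_UNIV])
    show "C_k_on k (\<lambda>t. real (Suc (Suc k)) * max 0 t ^ Suc k) UNIV"
      by (intro C_k_on_mult C_k_on_const open_UNIV Suc)
    show "((\<lambda>t. max 0 t ^ Suc (Suc k)) has_real_derivative real (Suc (Suc k)) * max 0 t ^ Suc k) (at t)" for t :: real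
    proof -
      consider "t > 0" | "t < 0" | "t = 0" by linarith
      then show ?thesis
      proof cases
        case 1
        have "((\<lambda>t. t ^ Suc (Suc k)) has_real_derivative real (Suc (Suc k)) * t ^ Suc k) (at t)"
          using DERIV_pow[of "Suc (Suc k)" t] by simp
        then have "((\<lambda>t. max 0 t ^ Suc (Suc k)) has_real_derivative real (Suc (Suc k)) * t ^ Suc k) (at t)"
          by (rule has_field_derivative_transform_within_open[OF _ open_greaterThan[of 0]]) (use 1 in auto)
        then show ?thesis using 1 by simp
      next
        case 2
        have "((\<lambda>t. 0) has_real_derivative 0) (at t)" by simp
        then have "((\<lambda>t. max 0 t ^ Suc (Suc k)) has_real_derivative 0) (at t)"
          by (rule has_field_derivative_transform_within_open[OF _ open_lessThan[of 0]]) (use 2 in auto)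
        then show ?thesis using 2 by simp
      next
        case 3
        \<comment> \<open>At 0 Caratheodory's criterion applies: the difference quotient is max 0 t
          ^ Suc k, which is continuous with value 0.\<close>
        have "isCont (\<lambda>t::real. max 0 t ^ Suc k) 0" by (intro continuous_intros)
        moreover have "max 0 z ^ Suc (Suc k) - max 0 0 ^ Suc (Suc k) = max 0 z ^ Suc k * (z - 0)" for z :: real
          by (cases "z > 0") auto
        ultimately have "((\<lambda>t::real. max 0 t ^ Suc (Suc k)) has_real_derivative 0) (at 0)"
          unfolding CARAT_DERIV by (intro exI[of _ "\<lambda>t. max 0 t ^ Suc k"]) auto
        then show ?thesis using 3 by simp
      qed
    qed
  qed
qed

text \<open>The exponent 5 is what class C^4 calls for. Shifted copies of this function build the
  cutoff and \<open>slack\<close>.\<close>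

definition bump :: "real \<Rightarrow> real" where "bump t = max 0 t ^ 5"

lemma bump_nonneg: "bump t \<ge> 0" and bump_zero: "t \<le> 0 \<Longrightarrow> bump t = 0" and bump_pos: "t > 0 \<Longrightarrow> bump t > 0"
  by (auto simp: bump_def)

lemma C_k_on_bump: "C_k_on 4 (\<lambda>x. bump (a * x + b)) UNIV"
proof -
  have "C_k_on 4 bump UNIV" using C_k_on_pos_part_power[of 4] by (simp add: bump_def[abs_def] eval_nat_numeral)
  moreover have "C_k_on 4 (\<lambda>x. a * x + b) UNIV"
    by (intro C_k_on_add C_k_on_const open_UNIV C_k_on_bounded_linear bounded_linear_mult_right)
  ultimately show ?thesis by (rule C_k_on_compose[OF open_UNIV open_UNIV]) simp
qed

text \<open>\<eta> is the normalised integral of a bump supported in [6/5, 7/5]; its total increase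
  is one full turn. The interval lies to the right of the unit circle and within |x| <= 3/2, where
  \<open>width\<close> straightens the circle of radius 2.\<close>

lemma cutoff_exists:
  obtains \<eta> \<eta>' :: "real \<Rightarrow> real" where "C_k_on 4 \<eta> UNIV" "\<And>x. (\<eta> has_real_derivative \<eta>' x) (at x)"
    "\<And>x. \<eta>' x \<ge> 0" "\<And>x. \<eta> x \<ge> 0" "\<And>x. x \<le> 6/5 \<Longrightarrow> \<eta> x = 0" "\<And>x. x \<ge> 7/5 \<Longrightarrow> \<eta> x = 2 * pi"
    "\<And>x. x \<notin> {6/5<..<7/5} \<Longrightarrow> \<eta>' x = 0" "continuous_on UNIV \<eta>'"
proof -
  define g where "g x = bump (1 * x + - (6/5)) * bump (- 1 * x + 7/5)" for x
  have g4: "C_k_on 4 g UNIV" unfolding g_def[abs_def] by (intro C_k_on_mult C_k_on_bump open_UNIV)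
  have gc: "continuous_on S g" for S using C_k_on_continuous[OF g4] continuous_on_subset by blast
  have g0: "g x = 0" if "x \<notin> {6/5<..<7/5}" for x
    using that by (auto simp: g_def bump_zero)
  have gpos: "g x > 0" if "x \<in> {6/5<..<7/5}" for x
    using that by (auto simp: g_def bump_pos)
  have gnn: "g x \<ge> 0" for x using gpos[of x] g0[of x] by (cases "x \<in> {6/5<..<7/5}") auto
  define h where "h x = integral {0..x} g" for x
  have h0: "h x = 0" if "x \<le> 6/5" for x
  proof -
    have "integral {0..x} g = integral {0..x} (\<lambda>_. 0)" by (rule integral_cong) (use that g0 in auto)
    then show ?thesis by (simp add: h_def)
  qed
  have hd: "(h has_real_derivative g x) (at x)" for x
  proof (cases "x < 6/5")
    case True
    have "((\<lambda>_. 0) has_real_derivative 0) (at x)" by simp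
    then have "(h has_real_derivative 0) (at x)"
      by (rule has_field_derivative_transform_within_open[OF _ open_lessThan[of "6/5"]]) (use True h0 in auto)
    then show ?thesis using g0[of x] True by simp
  next
    case False
    have "(h has_real_derivative g x) (at x within {0..x+1})"
      unfolding h_def by (rule integral_has_real_derivative[OF gc]) (use False in auto)
    moreover have "at x within {0..x+1} = at x" by (rule at_within_interior) (use False in auto)
    ultimately show ?thesis by simp
  qed
  have hnn: "h x \<ge> 0" for x
    unfolding h_def by (intro integral_nonneg integrable_continuous_interval gc) (use gnn in auto)
  define T where "T = h (7/5)"
  have T: "T > 0"
  proof -
    have "\<exists>z>6/5. z < 7/5 \<and> h (7/5) - h (6/5) = (7/5 - 6/5) * g z" by (rule MVT2) (use hd in auto)
    then obtain z where "6/5 < z" "z < 7/5" "T = 1/5 * g z" using h0[of "6/5"] by (auto simp: T_def)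
    then show ?thesis using gpos[of z] by simp
  qed
  have hT: "h x = T" if "x \<ge> 7/5" for x
  proof (cases "x = 7/5")
    case False
    have "\<exists>z>7/5. z < x \<and> h x - h (7/5) = (x - 7/5) * g z" by (rule MVT2) (use hd that False in auto)
    then show ?thesis using g0 by (auto simp: T_def)
  next
    case True
    then show ?thesis by (simp only: T_def)
  qed
  define k where "k = 2 * pi / T"
  show ?thesis
  proof (rule that[of "\<lambda>x. k * h x" "\<lambda>x. k * g x"])
    show d: "((\<lambda>x. k * h x) has_real_derivative k * g x) (at x)" for x by (rule DERIV_cmult[OF hd])
    have "C_k_on 3 (\<lambda>x. k * g x) UNIV" by (intro C_k_on_mult C_k_on_const open_UNIV C_k_on_le[OF g4]) simp
    from C_k_on_real_SucI[OF open_UNIV d this]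
    show "C_k_on 4 (\<lambda>x. k * h x) UNIV" by (simp add: eval_nat_numeral)
    show "continuous_on UNIV (\<lambda>x. k * g x)" by (intro continuous_intros gc)
  qed (use T gnn hnn h0 hT g0 in \<open>auto simp: k_def\<close>)
qed

text \<open>\<open>width x\<close> is \<open>1 / sqrt (4 - x\<^sup>2)\<close> for \<open>\<bar>x\<bar> \<le> 3/2\<close>, so that \<open>(x, y) \<mapsto> (x, y * width x)\<close> straightens
  these parts of the circle of radius 2 while remaining a diffeomorphism near the poles.\<close>

definition slack :: "real \<Rightarrow> real" where
  "slack x = 4 - x\<^sup>2 + 1000 * bump (1 * x + - (3/2)) + 1000 * bump (- 1 * x + - (3/2))"

definition width :: "real \<Rightarrow> real" where "width x = inverse (sqrt (slack x))"

lemma slack_inside: "\<bar>x\<bar> \<le> 3/2 \<Longrightarrow> slack x = 4 - x\<^sup>2"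
  by (simp add: slack_def bump_zero)

lemma slack_ge: "slack x \<ge> 4 - x\<^sup>2"
  using bump_nonneg[of "1 * x + - (3/2)"] bump_nonneg[of "- 1 * x + - (3/2)"] by (simp add: slack_def)

text \<open>Beyond |x| = 3/2 put t = |x| - 3/2. Up to t = 2/5 the term 4 - x^2 is still positive;
  from there on 1000 t^5 exceeds 12 t + t^2, which outweighs the negative part 3 t + t^2.\<close>

lemma slack_pos: "slack x > 0"
proof -
  have key: "4 - (3/2 + t)\<^sup>2 + 1000 * t ^ 5 > 0" if "t \<ge> 0" for t :: real
  proof -
    have sq: "(3/2 + t)\<^sup>2 = 9/4 + 3 * t + t * t" by (simp add: power2_eq_square algebra_simps)
    show ?thesis
    proof (cases "t \<le> 2/5")
    case True
    then have "t * t \<le> 2/5 * (2/5)" using that by (intro mult_mono) auto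
    moreover have "t ^ 5 \<ge> 0" using that by simp
    ultimately show ?thesis unfolding sq using True by linarith
  next
    case False
    have "(2/5) ^ 4 \<le> t ^ 4" "(2/5) ^ 3 \<le> t ^ 3" using False by (intro power_mono; simp)+
    then have "(2/5) ^ 4 * t \<le> t ^ 4 * t" "(2/5) ^ 3 * t\<^sup>2 \<le> t ^ 3 * t\<^sup>2" using that by (intro mult_right_mono; simp)+
    moreover have "t ^ 4 * t = t ^ 5" "t ^ 3 * t\<^sup>2 = t ^ 5" by (simp_all add: eval_nat_numeral)
    ultimately have "16/625 * t \<le> t ^ 5" "8/125 * t\<^sup>2 \<le> t ^ 5" by (simp_all add: power_divide)
    then have "12 * t + t\<^sup>2 \<le> 1000 * t ^ 5" using that zero_le_power2[of t] by linarith
    then have "12 * t + t * t \<le> 1000 * t ^ 5" by (simp add: power2_eq_square)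
    then show ?thesis unfolding sq using that by linarith
    qed
  qed
  show ?thesis
  proof (cases "\<bar>x\<bar> \<le> 3/2")
    case True
    then have "\<bar>x\<bar>\<^sup>2 \<le> (3/2)\<^sup>2" by (intro power_mono) auto
    then show ?thesis using slack_inside[OF True] by (simp add: power2_eq_square)
  next
    case False
    then have "4 - (3/2 + (\<bar>x\<bar> - 3/2))\<^sup>2 + 1000 * (\<bar>x\<bar> - 3/2) ^ 5 > 0" by (intro key) simp
    moreover have "slack x = 4 - x\<^sup>2 + 1000 * (\<bar>x\<bar> - 3/2) ^ 5"
      using False by (auto simp: slack_def bump_def abs_if)
    ultimately show ?thesis by simp
  qed
qed

lemma width_pos: "width x > 0"
  by (simp add: width_def slack_pos)

lemma C_k_on_width: "C_k_on 4 width UNIV"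
proof -
  have "C_k_on 4 (\<lambda>x::real. 4 - x * x) UNIV"
    by (intro C_k_on_diff C_k_on_const C_k_on_mult open_UNIV C_k_on_bounded_linear bounded_linear_ident)
  then have "C_k_on 4 slack UNIV"
    unfolding slack_def[abs_def] power2_eq_square
    by (intro C_k_on_add C_k_on_mult[OF _ C_k_on_const] C_k_on_bump open_UNIV)
  then show ?thesis unfolding width_def[abs_def]
    by (intro C_k_on_inverse_pos open_UNIV) (auto simp: slack_pos)
qed

lemma width_circle: "x\<^sup>2 + y\<^sup>2 \<le> 4 \<Longrightarrow> \<bar>y * width x\<bar> \<le> 1"
proof -
  assume "x\<^sup>2 + y\<^sup>2 \<le> 4"
  then have "y\<^sup>2 \<le> slack x" using slack_ge[of x] by simp
  then have "\<bar>y\<bar> \<le> sqrt (slack x)" using real_le_rsqrt[of "\<bar>y\<bar>"] by simp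
  then show ?thesis using slack_pos[of x] by (simp add: width_def abs_mult field_simps)
qed

lemma width_boundary: "x\<^sup>2 + y\<^sup>2 = 4 \<Longrightarrow> \<bar>x\<bar> \<le> 3/2 \<Longrightarrow> y * width x = sgn y"
proof -
  assume 1: "x\<^sup>2 + y\<^sup>2 = 4" and 2: "\<bar>x\<bar> \<le> 3/2"
  have "slack x = y\<^sup>2" using slack_inside[OF 2] 1 by simp
  then have "width x = inverse \<bar>y\<bar>" by (simp add: width_def)
  then show ?thesis by (simp add: sgn_real_def abs_if)
qed

lemma scaled_norm:
  assumes "l > 0" "norm (p::real^2) \<le> 2 / l"
  shows "(l * p $ 1)\<^sup>2 + (l * p $ 2)\<^sup>2 \<le> 4"
proof -
  have "l * norm p \<le> 2" using assms by (simp add: field_simps)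
  then have "(l * norm p)\<^sup>2 \<le> 2\<^sup>2" using assms(1) by (intro power_mono) auto
  moreover have "(norm p)\<^sup>2 = (p $ 1)\<^sup>2 + (p $ 2)\<^sup>2" by (simp add: norm_vec2)
  ultimately show ?thesis by (simp add: power_mult_distrib algebra_simps)
qed

lemma C_k_on_scaled_nth: "C_k_on 4 f UNIV \<Longrightarrow> C_k_on 4 (\<lambda>p::real^2. f (l * p $ i)) UNIV" for f :: "real \<Rightarrow> real"
  by (rule C_k_on_compose[OF open_UNIV open_UNIV])
     (auto intro!: C_k_on_mult C_k_on_const C_k_on_nth)

section \<open>The strip as a surface over the round annulus and disc\<close>

locale cover = profile +
  fixes \<eta> \<eta>' :: "real \<Rightarrow> real"
  assumes eta: "C_k_on 4 \<eta> UNIV" "\<And>x. (\<eta> has_real_derivative \<eta>' x) (at x)" "\<And>x. \<eta>' x \<ge> 0" "\<And>x. \<eta> x \<ge> 0"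
    "\<And>x. x \<le> 6/5 \<Longrightarrow> \<eta> x = 0" "\<And>x. x \<ge> 7/5 \<Longrightarrow> \<eta> x = 2 * pi"
    "\<And>x. x \<notin> {6/5<..<7/5} \<Longrightarrow> \<eta>' x = 0" "continuous_on UNIV \<eta>'"
begin

text \<open>Affine from [-1, 1] onto [u0, u1] in the straightened ordinate
  \<open>y * width x\<close>, so that near the band the upper arc of the outer circle goes to
  profile angle u1 and the lower arc to u0.\<close>

definition height :: "real \<Rightarrow> real \<Rightarrow> real" where
  "height x y = (u0 + u1) / 2 + (u1 - u0) / 2 * (y * width x)"

text \<open>The rotation angle gains n extra turns while l x crosses the band from 6/5 to 7/5. The
  factor l brings a domain of outer radius 2 / l to radius 2: l = 1 for the annulus, l = 2 for the
  disc.\<close>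

definition strip :: "real \<Rightarrow> real \<Rightarrow> real^2 \<Rightarrow> real^2" where
  "strip n l p = vector [l * p $ 1 + n * \<eta> (l * p $ 1), height (l * p $ 1) (l * p $ 2)]"

definition surf :: "real \<Rightarrow> real \<Rightarrow> real \<Rightarrow> real^2 \<Rightarrow> real^3" where
  "surf \<epsilon> n l p = spiral \<epsilon> (strip n l p)"

definition reg :: "real \<Rightarrow> (real^2) set" where
  "reg l = {p. height (l * p $ 1) (l * p $ 2) \<in> I}"

lemma strip_dom: "strip n l p \<in> param_dom \<longleftrightarrow> p \<in> reg l"
  by (simp add: param_dom_def strip_def reg_def)

lemma height_circle:
  assumes "x\<^sup>2 + y\<^sup>2 \<le> 4"
  shows "height x y \<in> {u0..u1}"
proof -
  have "\<bar>y * width x\<bar> \<le> 1" by (rule width_circle[OF assms])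
  then have "\<bar>(u1 - u0) / 2 * (y * width x)\<bar> \<le> (u1 - u0) / 2 * 1"
    unfolding abs_mult using I(3) by (intro mult_mono) auto
  then have "- ((u1 - u0) / 2) \<le> (u1 - u0) / 2 * (y * width x)" "(u1 - u0) / 2 * (y * width x) \<le> (u1 - u0) / 2"
    by linarith+
  then show ?thesis unfolding height_def atLeastAtMost_iff by (auto simp: field_simps)
qed

lemma strip_inside:
  assumes "l > 0" "norm p \<le> 2 / l"
  shows "strip n l p $ 2 \<in> {u0..u1}" "p \<in> reg l" "l * p $ 1 \<ge> - 2"
proof -
  note s = scaled_norm[OF assms]
  show "strip n l p $ 2 \<in> {u0..u1}" using height_circle[OF s] by (simp add: strip_def)
  then show "p \<in> reg l" using I(2) by (auto simp: reg_def strip_def)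
  have "(l * p $ 1)\<^sup>2 \<le> 4" using s zero_le_power2[of "l * p $ 2"] by linarith
  then have "\<bar>l * p $ 1\<bar> \<le> 2" using abs_le_square_iff[of "l * p $ 1" 2] by simp
  then show "l * p $ 1 \<ge> - 2" by linarith
qed

lemma C_k_on_strip: "C_k_on 4 (strip n l) UNIV"
  unfolding strip_def[abs_def] height_def
  by (intro C_k_on_vector2 C_k_on_add C_k_on_mult C_k_on_const open_UNIV C_k_on_nth C_k_on_scaled_nth eta C_k_on_width)

lemma open_reg: "open (reg l)"
proof -
  have "continuous_on UNIV (strip 0 l)" using C_k_on_continuous[OF C_k_on_strip] .
  then have "open (strip 0 l -` param_dom)" by (intro open_vimage open_dom) auto
  moreover have "strip 0 l -` param_dom = reg l" using strip_dom by auto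
  ultimately show ?thesis by simp
qed

lemma strip_differentiable: "strip n l differentiable at p"
  using C_k_on_has_derivative[of 3 "strip n l" UNIV p] C_k_on_strip[of n l]
  by (auto simp: differentiable_def eval_nat_numeral)

text \<open>The matrix is triangular, so these three entries determine the Jacobian.\<close>

lemma pd_strip:
  "pd e\<^sub>1 (strip n l) p $ 1 = l * (1 + n * \<eta>' (l * p $ 1))" "pd e\<^sub>2 (strip n l) p $ 1 = 0"
  "pd e\<^sub>2 (strip n l) p $ 2 = (u1 - u0) / 2 * (l * width (l * p $ 1))"
proof -
  note d = strip_differentiable[of n l p, unfolded frechet_derivative_works]
  have 1: "pd v (strip n l) p $ i = pd v (\<lambda>p. strip n l p $ i) p" for v i
    by (rule sym, rule pd_eqI) (rule bounded_linear.has_derivative[OF bounded_linear_vec_nth d])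
  have sc: "((\<lambda>p::real^2. l * p $ 1) has_derivative (\<lambda>h. l * h $ 1)) (at p)"
    by (intro has_derivative_mult_right nth_derivs)
  have "((\<lambda>p::real^2. \<eta> (l * p $ 1)) has_derivative (\<lambda>h. \<eta>' (l * p $ 1) * (l * h $ 1))) (at p)"
    using diff_chain_at[OF sc eta(2)[unfolded has_field_derivative_def]] by (simp add: o_def)
  then have "((\<lambda>p. strip n l p $ 1) has_derivative (\<lambda>h. l * h $ 1 + n * (\<eta>' (l * p $ 1) * (l * h $ 1)))) (at p)"
    unfolding strip_def vector_2 by (intro has_derivative_add sc has_derivative_mult_right)
  from pd_eqI[OF this] show "pd e\<^sub>1 (strip n l) p $ 1 = l * (1 + n * \<eta>' (l * p $ 1))" "pd e\<^sub>2 (strip n l) p $ 1 = 0"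
    unfolding 1 by (simp_all add: axis_def algebra_simps)
  have "C_k_on (Suc 3) width UNIV" using C_k_on_width by (simp add: eval_nat_numeral)
  then have "width differentiable at (l * p $ 1)" unfolding C_k_on.simps by blast
  then obtain d where "(width has_real_derivative d) (at (l * p $ 1))" by (rule real_differentiableE)
  then have D: "((\<lambda>p::real^2. width (l * p $ 1)) has_derivative (\<lambda>h. d * (l * h $ 1))) (at p)"
    using diff_chain_at[OF sc, of width] by (simp add: has_field_derivative_def o_def)
  have "((\<lambda>p. strip n l p $ 2) has_derivative (\<lambda>h. 0 + (u1 - u0) / 2 * (l * p $ 2 * (d * (l * h $ 1)) + l * h $ 2 * width (l * p $ 1)))) (at p)"
    unfolding strip_def vector_2 height_def
    by (intro has_derivative_add has_derivative_mult_right has_derivative_mult has_derivative_const D nth_derivs)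
  from pd_eqI[OF this, of e\<^sub>2] show "pd e\<^sub>2 (strip n l) p $ 2 = (u1 - u0) / 2 * (l * width (l * p $ 1))"
    unfolding 1 by (simp add: axis_def)
qed

lemma jac_strip: "l > 0 \<Longrightarrow> n \<ge> 0 \<Longrightarrow> jac (strip n l) p > 0"
  using I(3) width_pos[of "l * p $ 1"] eta(3)[of "l * p $ 1"]
  by (simp add: jac_def pd_strip add_pos_nonneg)

text \<open>x + n \<eta>(x) is strictly increasing, and for fixed x the height is an affine function
  of y with positive slope.\<close>

lemma inj_strip:
  assumes "l > 0" "n \<ge> 0"
  shows "inj (strip n l)"
proof (rule injI)
  fix p q assume eq: "strip n l p = strip n l q"
  have mono: "\<eta> x \<le> \<eta> y" if "x \<le> y" for x y
    by (rule DERIV_nonneg_imp_nondecreasing[OF that]) (use eta(2,3) in blast)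
  have strict: "x + n * \<eta> x < y + n * \<eta> y" if "x < y" for x y
    using mono[of x y] that assms(2) mult_left_mono[of "\<eta> x" "\<eta> y" n] by linarith
  have "l * p $ 1 + n * \<eta> (l * p $ 1) = l * q $ 1 + n * \<eta> (l * q $ 1)"
    using eq by (simp add: strip_def vec_eq_iff forall_2)
  then have "l * p $ 1 = l * q $ 1"
    using strict[of "l * p $ 1" "l * q $ 1"] strict[of "l * q $ 1" "l * p $ 1"] by (cases "l * p $ 1" "l * q $ 1" rule: linorder_cases) auto
  then have 1: "p $ 1 = q $ 1" using assms by simp
  then have "height (l * p $ 1) (l * p $ 2) = height (l * p $ 1) (l * q $ 2)"
    using eq by (simp add: strip_def vec_eq_iff forall_2)
  then have "p $ 2 = q $ 2" using I(3) width_pos[of "l * p $ 1"] assms by (simp add: height_def)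
  then show "p = q" using 1 by (simp add: vec_eq_iff forall_2)
qed

lemma surf_eq: "surf \<epsilon> n l = (\<lambda>p. surf 0 n l p + \<epsilon> *\<^sub>R drift (strip n l p))"
  by (simp add: fun_eq_iff surf_def spiral_def)

lemma smooth_surf: "C_k_on 4 (surf 0 n l) (reg l)" "C_k_on 4 (\<lambda>p. drift (strip n l p)) (reg l)" "C_k_on 4 (surf \<epsilon> n l) (reg l)"
proof -
  note C = C_k_on_compose[OF open_reg open_dom _ C_k_on_subset[OF C_k_on_strip subset_UNIV]]
  show 1: "C_k_on 4 (surf 0 n l) (reg l)"
    unfolding surf_def[abs_def] spiral_0 by (rule C[OF smooth_rev]) (simp add: strip_dom)
  show 2: "C_k_on 4 (\<lambda>p. drift (strip n l p)) (reg l)"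
    by (rule C[OF smooth_drift]) (simp add: strip_dom)
  show "C_k_on 4 (surf \<epsilon> n l) (reg l)"
    unfolding surf_eq[of \<epsilon>] by (rule C_k_on_add_scaleR[OF open_reg 1 2])
qed

lemma spiral_differentiable: "v \<in> param_dom \<Longrightarrow> spiral \<epsilon> differentiable at v"
  using C_k_on_add_scaleR[OF open_dom smooth_rev smooth_drift, of \<epsilon>]
  by (simp add: spiral_def[abs_def] eval_nat_numeral)

lemma normal_field_surf:
  assumes "p \<in> reg l"
  shows "normal_field (surf \<epsilon> n l) p = jac (strip n l) p *\<^sub>R normal_field (spiral \<epsilon>) (strip n l p)"
  unfolding surf_def[abs_def]
  by (rule normal_field_reparam[OF strip_differentiable spiral_differentiable]) (simp add: strip_dom assms)

lemma normal_field_surf_nonzero: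
  assumes "l > 0" "n \<ge> 0" "p \<in> reg l" "r (strip n l p $ 2) + \<epsilon> * strip n l p $ 1 > 0"
  shows "normal_field (surf \<epsilon> n l) p \<noteq> 0"
  using normal_field_surf[OF assms(3), of \<epsilon> n] normal_field_spiral[of "strip n l p" \<epsilon>] jac_strip[OF assms(1,2), of p] assms(3,4)
  by (simp add: strip_dom)

lemma normal_field_surf_0_nonzero:
  assumes "l > 0" "n \<ge> 0" "p \<in> reg l"
  shows "normal_field (surf 0 n l) p \<noteq> 0"
  using normal_field_surf_nonzero[OF assms, of 0] pos(2) assms(3) by (simp add: reg_def strip_def)

lemma unit_normal_surf:
  assumes "l > 0" "n \<ge> 0" "p \<in> reg l"
  shows "unit_normal (surf 0 n l) p = unit_normal revolve (strip n l p)"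
  using jac_strip[OF assms(1,2), of p]
  by (simp add: unit_normal_def normal_field_surf[OF assms(3)] sgn_scaleR spiral_0)

lemma curvatures_surf:
  assumes "l > 0" "n \<ge> 0" "p \<in> reg l"
  defines "u \<equiv> height (l * p $ 1) (l * p $ 2)"
  shows "mean_curvature (surf 0 n l) p = - (1 / w u + sin u / r u) / 2"
    and "gauss_curvature (surf 0 n l) p = 1 / w u * (sin u / r u)"
proof -
  have "C_k_on 2 revolve param_dom" "C_k_on 2 (strip n l) (reg l)"
    using C_k_on_le[OF smooth_rev] C_k_on_le[OF C_k_on_subset[OF C_k_on_strip subset_UNIV]] by auto
  note pc = principal_curvatures_reparam[OF open_reg this(2) assms(3) open_dom this(1) _ jac_strip[OF assms(1,2)]]
  have "strip n l p $ 2 = u" by (simp add: strip_def u_def)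
  moreover have "strip n l p \<in> param_dom" using assms(3) by (simp add: strip_dom)
  ultimately show "mean_curvature (surf 0 n l) p = - (1 / w u + sin u / r u) / 2"
    "gauss_curvature (surf 0 n l) p = 1 / w u * (sin u / r u)"
    using curvatures_rev[of "strip n l p"] pc strip_dom[of n l]
    by (simp_all add: surf_def[abs_def] spiral_0 mean_curvature_def gauss_curvature_def)
qed

text \<open>On the domain l x >= -2 and \<eta> >= 0, so the drift can shrink the radius by at most 2
  \<epsilon>, however large n is: extra turns only push outwards. A quarter of the least radius is
  therefore a threshold independent of n.\<close>

lemma spiral_threshold:
  obtains e where "e > 0"
    "\<And>\<epsilon> n l p. \<epsilon> \<in> {0..e} \<Longrightarrow> n \<ge> 0 \<Longrightarrow> l > 0 \<Longrightarrow> norm p \<le> 2 / l \<Longrightarrow> r (strip n l p $ 2) + \<epsilon> * strip n l p $ 1 > 0"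
proof -
  have "continuous_on {u0..u1} r"
    using C_k_on_continuous[OF smooth(1)] I(2) continuous_on_subset by blast
  then obtain u where u: "u \<in> {u0..u1}" "\<And>v. v \<in> {u0..u1} \<Longrightarrow> r u \<le> r v"
    using continuous_attains_inf[of "{u0..u1}" r] I(3) by auto
  have ru: "r u > 0" using pos(2) u(1) I(2) by blast
  show ?thesis
  proof (rule that[of "r u / 4"])
    fix \<epsilon> n l :: real and p :: "real^2"
    assume e: "\<epsilon> \<in> {0..r u / 4}" and n: "n \<ge> 0" and p: "l > 0" "norm p \<le> 2 / l"
    have "strip n l p $ 1 \<ge> - 2"
      using strip_inside(3)[OF p] n eta(4)[of "l * p $ 1"] by (simp add: strip_def add_increasing2)
    then have "\<epsilon> * strip n l p $ 1 \<ge> \<epsilon> * (- 2)" using e by (intro mult_left_mono) auto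
    moreover have "r (strip n l p $ 2) \<ge> r u" using u(2) strip_inside(1)[OF p] by blast
    ultimately show "r (strip n l p $ 2) + \<epsilon> * strip n l p $ 1 > 0" using e ru by simp
  qed (use ru in simp)
qed

lemma embedded_surf:
  assumes "\<epsilon> > 0" "n \<ge> 0" "l > 0" "\<And>p. p \<in> D \<Longrightarrow> norm p \<le> 2 / l"
    and pos: "\<And>p. p \<in> D \<Longrightarrow> r (strip n l p $ 2) + \<epsilon> * strip n l p $ 1 > 0"
  shows "embedded_C4_surface D (surf \<epsilon> n l)"
  unfolding embedded_C4_surface_def
proof (intro conjI ballI exI)
  show "open (reg l)" by (rule open_reg)
  show D: "D \<subseteq> reg l" using strip_inside(2) assms by blast
  show "C_k_on 4 (surf \<epsilon> n l) (reg l)" by (rule smooth_surf)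
  show "inj (frechet_derivative (surf \<epsilon> n l) (at p))" if "p \<in> D" for p
  proof (subst inj_frechet_iff_normal_field)
    have "C_k_on (Suc 3) (surf \<epsilon> n l) (reg l)" using smooth_surf(3) by (simp add: eval_nat_numeral)
    then show "surf \<epsilon> n l differentiable at p" using C_k_on_has_derivative D that unfolding differentiable_def by blast
    show "normal_field (surf \<epsilon> n l) p \<noteq> 0"
      using normal_field_surf_nonzero assms that D by blast
  qed
  show "inj_on (surf \<epsilon> n l) D"
  proof (rule inj_onI)
    fix p q assume pq: "p \<in> D" "q \<in> D" "surf \<epsilon> n l p = surf \<epsilon> n l q"
    have "strip n l p = strip n l q"
    proof (rule inj_onD[OF inj_spiral[OF assms(1)]])
      show "spiral \<epsilon> (strip n l p) = spiral \<epsilon> (strip n l q)" using pq by (simp add: surf_def)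
      show "strip n l p \<in> {v. v $ 2 \<in> {u0..u1} \<and> r (v $ 2) + \<epsilon> * v $ 1 > 0}"
        "strip n l q \<in> {v. v $ 2 \<in> {u0..u1} \<and> r (v $ 2) + \<epsilon> * v $ 1 > 0}"
        using pq assms strip_inside(1) by blast+
    qed
    then show "p = q" using inj_strip[OF assms(3,2)] by (rule injD[rotated])
  qed
qed

end

section \<open>Growth of the energy under stretching\<close>

lemma vector_derivative_local_cong:
  assumes "open T" "t \<in> T" "\<And>s. s \<in> T \<Longrightarrow> f s = g s"
  shows "vector_derivative f (at t) = vector_derivative g (at t)"
proof -
  have "(f has_vector_derivative d) (at t) \<longleftrightarrow> (g has_vector_derivative d) (at t)" for d
    using has_vector_derivative_transform_within_open[of f d t T g]
      has_vector_derivative_transform_within_open[of g d t T f] assms by metis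
  then show ?thesis by (simp add: vector_derivative_def)
qed

lemma curve_local_cong:
  assumes T: "open T" "t \<in> T" "\<forall>s\<in>T. \<gamma> s = \<delta> s"
  shows "speed \<gamma> t = speed \<delta> t" "curve_curvature \<gamma> t = curve_curvature \<delta> t"
    "vector_derivative (\<lambda>s. vector_derivative \<gamma> (at s)) (at t) = vector_derivative (\<lambda>s. vector_derivative \<delta> (at s)) (at t)"
    "vector_derivative \<gamma> (at t) = vector_derivative \<delta> (at t)"
proof -
  have 1: "vector_derivative \<gamma> (at s) = vector_derivative \<delta> (at s)" if "s \<in> T" for s
    using T(3) by (intro vector_derivative_local_cong[OF T(1) that]) auto
  show sp: "speed \<gamma> t = speed \<delta> t" "vector_derivative \<gamma> (at t) = vector_derivative \<delta> (at t)"
    using 1 T(2) by (simp_all add: speed_def)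
  show "vector_derivative (\<lambda>s. vector_derivative \<gamma> (at s)) (at t) = vector_derivative (\<lambda>s. vector_derivative \<delta> (at s)) (at t)"
    by (rule vector_derivative_local_cong[OF T(1,2) 1])
  have "vector_derivative (unit_tangent \<gamma>) (at t) = vector_derivative (unit_tangent \<delta>) (at t)"
    by (rule vector_derivative_local_cong[OF T(1,2)]) (simp add: unit_tangent_def 1)
  then show "curve_curvature \<gamma> t = curve_curvature \<delta> t" by (simp add: curve_curvature_def sp)
qed

context cover
begin

text \<open>Gauss-Bonnet turns the area term into boundary terms; this is the density left on the
  outer circle, which enters with a minus sign. The parameter b will be the effective coefficient
  b'.\<close>

definition flux :: "real \<Rightarrow> real \<Rightarrow> real \<Rightarrow> (real^2 \<Rightarrow> real^3) \<Rightarrow> real \<Rightarrow> real \<Rightarrow> real" where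
  "flux \<alpha> \<beta> b X R t = (\<alpha> * (curve_curvature (circle_image X R) t)\<^sup>2 + \<beta>) * speed (circle_image X R) t - b * geodesic_form X R t"

text \<open>Left of the band n \<eta> is 0, right of it 2 pi n, and n is a natural number.\<close>

lemma surf_periodic:
  assumes "l * p $ 1 \<notin> {6/5<..<7/5}"
  shows "surf 0 (real n) l p = surf 0 0 l p"
proof (cases "l * p $ 1 \<le> 6/5")
  case True
  then show ?thesis using eta(5) by (simp add: surf_def strip_def)
next
  case False
  then have "\<eta> (l * p $ 1) = 2 * pi" using assms eta(6) by auto
  moreover have "cos (x + real n * (2 * pi)) = cos x" "sin (x + real n * (2 * pi)) = sin x" for x
  proof -
    have e: "x + real n * (2 * pi) = x + 2 * real n * pi" by simp
    show "cos (x + real n * (2 * pi)) = cos x" "sin (x + real n * (2 * pi)) = sin x"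
      unfolding e cos_add sin_add cos_2npi sin_2npi by simp_all
  qed
  ultimately show ?thesis by (simp add: surf_def strip_def spiral_0 revolve_def)
qed

lemma pd_surf_periodic:
  assumes "l * p $ 1 < 6/5 \<or> l * p $ 1 > 7/5"
  shows "pd v (surf 0 (real n) l) p = pd v (surf 0 0 l) p"
proof (rule pd_cong)
  have "open {p::real^2. l * p $ 1 < 6/5}" "open {p::real^2. l * p $ 1 > 7/5}"
    by (intro open_Collect_less continuous_intros)+
  then show "open ({p::real^2. l * p $ 1 < 6/5} \<union> {p. l * p $ 1 > 7/5})" by (rule open_Un)
qed (use assms in \<open>auto intro!: surf_periodic\<close>)

lemma unit_normal_surf_periodic:
  assumes "l * p $ 1 < 6/5 \<or> l * p $ 1 > 7/5"
  shows "unit_normal (surf 0 (real n) l) p = unit_normal (surf 0 0 l) p"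
  unfolding unit_normal_pd pd_surf_periodic[OF assms] ..

lemma flux_periodic:
  assumes "l * (R * cos t) < 6/5 \<or> l * (R * cos t) > 7/5"
  shows "flux \<alpha> \<beta> b (surf 0 (real n) l) R t = flux \<alpha> \<beta> b (surf 0 0 l) R t"
proof -
  define T where "T = {s. l * (R * cos s) < 6/5} \<union> {s. l * (R * cos s) > 7/5}"
  have T: "open T" unfolding T_def
    by (intro open_Un open_Collect_less continuous_intros)
  have t: "t \<in> T" using assms by (simp add: T_def)
  have eq: "\<forall>s\<in>T. circle_image (surf 0 (real n) l) R s = circle_image (surf 0 0 l) R s"
    unfolding circle_image_def by (intro ballI surf_periodic) (auto simp: T_def)
  note c = curve_local_cong[OF T t eq]
  have "unit_normal (surf 0 (real n) l) (vector [R * cos t, R * sin t]) = unit_normal (surf 0 0 l) (vector [R * cos t, R * sin t])"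
    by (rule unit_normal_surf_periodic) (use assms in simp)
  then show ?thesis unfolding flux_def geodesic_form_def Let_def c by simp
qed

text \<open>Within |x| < 3/2 the outer circle is mapped into one of the parallels u1, u0 and
  traversed with angle \<Theta> = x + n \<eta>(x) at x = 2 cos t. The parallel has curvature 1 / r u
  and geodesic curvature \<sigma> cos u / r u, where \<sigma> records the direction of travel. So
  the density is |\<Theta>'|, which is affine in n, times a constant of the parallel.\<close>

lemma flux_straight:
  assumes n: "n \<ge> 0" and l: "l > 0" and t: "\<bar>2 * cos t\<bar> < 3/2"
  defines "u \<equiv> if sin t > 0 then u1 else u0" and "\<sigma> \<equiv> sgn (sin t)"
  shows "flux \<alpha> \<beta> b (surf 0 n l) (2 / l) t
    = 2 * \<bar>sin t\<bar> * (1 + n * \<eta>' (2 * cos t)) * (\<alpha> / r u + \<beta> * r u - \<sigma> * b * cos u)"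
proof -
  define \<rho> where "\<rho> = r u"
  have uI: "u \<in> I" using I by (auto simp: u_def)
  have \<rho>: "\<rho> > 0" using pos(2)[OF uI] by (simp add: \<rho>_def)
  have circ: "(2 * cos s)\<^sup>2 + (2 * sin s)\<^sup>2 = 4" for s :: real
    using sin_cos_squared_add[of s] by algebra
  have sin0: "sin s \<noteq> 0" if "\<bar>2 * cos s\<bar> < 3/2" for s :: real
  proof
    assume "sin s = 0"
    then have "\<bar>cos s\<bar> = 1" using sin_zero_abs_cos_one by blast
    then show False using that by simp
  qed
  have \<sigma>: "\<sigma> \<noteq> 0" "\<sigma> * \<sigma> = 1" "\<sigma> * sin t = \<bar>sin t\<bar>" using sin0[OF t] by (auto simp: \<sigma>_def sgn_real_def)
  \<comment> \<open>Near t the point stays on the same side of the horizontal axis, hence its image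
    on one parallel.\<close>
  define T where "T = {s. \<bar>2 * cos s\<bar> < 3/2} \<inter> {s. \<sigma> * sin s > 0}"
  have T: "open T" unfolding T_def by (intro open_Int open_Collect_less continuous_intros)
  have tT: "t \<in> T" using t sin0[OF t] \<sigma> by (simp add: T_def)
  have hu: "height (2 * cos s) (2 * sin s) = u" if "s \<in> T" for s
  proof -
    have "2 * sin s * width (2 * cos s) = sgn (2 * sin s)"
      by (rule width_boundary[OF circ]) (use that in \<open>simp add: T_def\<close>)
    also have "\<dots> = \<sigma>" using that \<sigma>(1) by (auto simp: T_def \<sigma>_def sgn_real_def split: if_splits)
    finally have "2 * sin s * width (2 * cos s) = \<sigma>" .
    then show ?thesis unfolding height_def using sin0[OF t] by (auto simp: u_def \<sigma>_def sgn_real_def field_simps)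
  qed
  define \<Theta> where "\<Theta> s = 2 * cos s + n * \<eta> (2 * cos s)" for s
  define \<Theta>' where "\<Theta>' s = - 2 * sin s * (1 + n * \<eta>' (2 * cos s))" for s
  have d\<Theta>: "(\<Theta> has_real_derivative \<Theta>' s) (at s)" for s
    unfolding \<Theta>_def \<Theta>'_def by (auto intro!: derivative_eq_intros DERIV_chain2[OF eta(2)] simp: algebra_simps)
  \<comment> \<open>The existence of \<Theta>'' is enough: its value cancels in the cross product of
    the first two derivatives of the curve.\<close>
  obtain \<Theta>'' where d\<Theta>': "(\<Theta>' has_real_derivative \<Theta>'') (at t)"
  proof -
    have "C_k_on (Suc (Suc 2)) \<eta> UNIV" using eta(1) by (simp add: eval_nat_numeral)
    then have "C_k_on (Suc 2) (pd 1 \<eta>) UNIV" by (rule C_k_on_pd)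
    moreover have "pd 1 \<eta> = \<eta>'" by (rule ext) (simp add: pd_eqI[OF eta(2)[unfolded has_field_derivative_def]])
    ultimately have "\<eta>' differentiable at (2 * cos t)" unfolding C_k_on.simps by simp
    then obtain d where d: "(\<eta>' has_real_derivative d) (at (2 * cos t))" by (rule real_differentiableE)
    have "((\<lambda>s. 2 * cos s) has_real_derivative - 2 * sin t) (at t)" by (auto intro!: derivative_eq_intros)
    with d have "((\<lambda>s. \<eta>' (2 * cos s)) has_real_derivative d * (- 2 * sin t)) (at t)" by (rule DERIV_chain2)
    then have "(\<Theta>' has_real_derivative (- 2 * cos t * (1 + n * \<eta>' (2 * cos t)) + n * (d * (- 2 * sin t)) * (- 2 * sin t))) (at t)"
      unfolding \<Theta>'_def by (auto intro!: derivative_eq_intros)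
    then show ?thesis by (rule that)
  qed
  define \<gamma> where "\<gamma> s = (vector [\<rho> * cos (\<Theta> s), \<rho> * sin (\<Theta> s), z u] :: real^3)" for s
  define \<gamma>1 where "\<gamma>1 s = (vector [\<rho> * (- sin (\<Theta> s) * \<Theta>' s), \<rho> * (cos (\<Theta> s) * \<Theta>' s), 0] :: real^3)" for s
  define \<gamma>2 where "\<gamma>2 = (vector [\<rho> * (- sin (\<Theta> t) * \<Theta>'' - cos (\<Theta> t) * \<Theta>' t * \<Theta>' t), \<rho> * (cos (\<Theta> t) * \<Theta>'' - sin (\<Theta> t) * \<Theta>' t * \<Theta>' t), 0] :: real^3)"
  have eq: "\<forall>s\<in>T. circle_image (surf 0 n l) (2 / l) s = \<gamma> s"
    using l hu by (simp add: circle_image_def surf_def spiral_0 strip_def revolve_def \<gamma>_def \<rho>_def \<Theta>_def)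
  have d1: "(\<gamma> has_vector_derivative \<gamma>1 s) (at s)" for s
    unfolding \<gamma>_def[abs_def] \<gamma>1_def
    by (rule has_vector_derivative_vector3) (auto intro!: derivative_eq_intros d\<Theta>)
  have d2: "(\<gamma>1 has_vector_derivative \<gamma>2) (at t)"
    unfolding \<gamma>1_def[abs_def] \<gamma>2_def
    by (rule has_vector_derivative_vector3) (auto intro!: derivative_eq_intros d\<Theta> d\<Theta>' simp: algebra_simps)
  have e1: "1 + n * \<eta>' (2 * cos t) > 0" using n eta(3)[of "2 * cos t"] by (simp add: add_pos_nonneg)
  then have \<Theta>0: "\<Theta>' t \<noteq> 0" using sin0[OF t] by (simp add: \<Theta>'_def)
  have abs\<Theta>: "\<bar>\<Theta>' t\<bar> = 2 * \<bar>sin t\<bar> * (1 + n * \<eta>' (2 * cos t))" and sgn\<Theta>: "\<Theta>' t = - \<sigma> * \<bar>\<Theta>' t\<bar>"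
    using e1 sin0[OF t] by (auto simp: \<Theta>'_def abs_mult \<sigma>_def sgn_real_def)
  have n1: "norm (\<gamma>1 t) = \<rho> * \<bar>\<Theta>' t\<bar>"
  proof -
    have "(norm (\<gamma>1 t))\<^sup>2 = (\<rho> * \<bar>\<Theta>' t\<bar>)\<^sup>2"
      unfolding power2_norm_eq_inner \<gamma>1_def inner_vec_def sum_3 vector_3 inner_real_def power_mult_distrib power2_abs
      using sin_cos_squared_add[of "\<Theta> t"] by algebra
    then show ?thesis by (rule power2_eq_imp_eq) (use \<rho> in auto)
  qed
  have cr: "\<gamma>1 t \<times> \<gamma>2 = (\<rho>\<^sup>2 * \<Theta>' t ^ 3) *\<^sub>R axis 3 1"
  proof -
    have "\<rho> * (- sin (\<Theta> t) * \<Theta>' t) * (\<rho> * (cos (\<Theta> t) * \<Theta>'' - sin (\<Theta> t) * \<Theta>' t * \<Theta>' t))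
       - \<rho> * (cos (\<Theta> t) * \<Theta>' t) * (\<rho> * (- sin (\<Theta> t) * \<Theta>'' - cos (\<Theta> t) * \<Theta>' t * \<Theta>' t)) = \<rho>\<^sup>2 * \<Theta>' t ^ 3"
      using sin_cos_squared_add[of "\<Theta> t"] by algebra
    then show ?thesis by (simp add: \<gamma>1_def \<gamma>2_def cross3_def vec_eq_iff forall_3 axis_def)
  qed
  have nz: "\<gamma>1 t \<noteq> 0" using n1 \<rho> \<Theta>0 by auto
  note cf = curve_formulas[OF T tT d1 d2 nz]
  note cc = curve_local_cong[OF T tT eq]
  have sp: "speed \<gamma> t = \<rho> * \<bar>\<Theta>' t\<bar>" unfolding cf(1) n1 ..
  have cu: "curve_curvature \<gamma> t = 1 / \<rho>"
  proof -
    have "norm (\<gamma>1 t \<times> \<gamma>2) = \<rho>\<^sup>2 * \<bar>\<Theta>' t\<bar> ^ 3" unfolding cr by (simp add: abs_mult power_abs)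
    moreover have "\<rho>\<^sup>2 * A ^ 3 / (\<rho> * A) ^ 3 = 1 / \<rho>" if "A > 0" for A
      using \<rho> that by (simp add: power_mult_distrib power2_eq_square power3_eq_cube)
    ultimately show ?thesis unfolding cf(2) n1 using \<Theta>0 by simp
  qed
  have "unit_normal (surf 0 n l) (vector [2 / l * cos t, 2 / l * sin t])
      = unit_normal revolve (strip n l (vector [2 / l * cos t, 2 / l * sin t]))"
    using l n hu[OF tT] uI by (intro unit_normal_surf) (auto simp: reg_def)
  also have "\<dots> $ 3 = - cos u"
    using l hu[OF tT] uI by (subst normal_rev(2)) (auto simp: param_dom_def strip_def)
  finally have \<nu>: "unit_normal (surf 0 n l) (vector [2 / l * cos t, 2 / l * sin t]) $ 3 = - cos u" .
  have "geodesic_form (surf 0 n l) (2 / l) t = - cos u * (\<rho>\<^sup>2 * \<Theta>' t ^ 3) / (\<rho> * \<bar>\<Theta>' t\<bar>)\<^sup>2"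
    unfolding geodesic_form_def Let_def cc(3) cc(4) unfolding cf(4) unfolding cf(3) n1 cr
    unfolding inner_scaleR_right inner_axis \<nu> by simp
  also have "\<dots> = - cos u * \<Theta>' t"
    using \<rho> \<Theta>0 by (simp add: power_mult_distrib power2_eq_square power3_eq_cube)
  also have "\<dots> = - cos u * (- \<sigma> * \<bar>\<Theta>' t\<bar>)" by (subst sgn\<Theta>) (rule refl)
  finally have geo: "geodesic_form (surf 0 n l) (2 / l) t = \<sigma> * cos u * \<bar>\<Theta>' t\<bar>" by simp
  have "flux \<alpha> \<beta> b (surf 0 n l) (2 / l) t = (\<alpha> * (1 / \<rho>)\<^sup>2 + \<beta>) * (\<rho> * \<bar>\<Theta>' t\<bar>) - b * (\<sigma> * cos u * \<bar>\<Theta>' t\<bar>)"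
    unfolding flux_def cc(1,2) sp cu geo ..
  also have "\<dots> = \<bar>\<Theta>' t\<bar> * (\<alpha> / \<rho> + \<beta> * \<rho> - \<sigma> * b * cos u)"
    using \<rho> by (simp add: power2_eq_square field_simps)
  finally show ?thesis by (simp add: abs\<Theta> \<rho>_def)
qed

lemma flux_growth:
  fixes \<alpha> \<beta> b :: real
  assumes l: "l > 0"
  defines "e1 \<equiv> \<alpha> / r u1 + \<beta> * r u1 - b * cos u1" and "e0 \<equiv> \<alpha> / r u0 + \<beta> * r u0 + b * cos u0"
  shows "flux \<alpha> \<beta> b (surf 0 (real n) l) (2 / l) t = flux \<alpha> \<beta> b (surf 0 0 l) (2 / l) t
    + real n * (if sin t > 0 then e1 else e0) * \<eta>' (2 * cos t) * (2 * \<bar>sin t\<bar>)"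
proof (cases "2 * cos t < 6/5 \<or> 2 * cos t > 7/5")
  case True
  then have "\<eta>' (2 * cos t) = 0" using eta(7) by auto
  moreover have "flux \<alpha> \<beta> b (surf 0 (real n) l) (2 / l) t = flux \<alpha> \<beta> b (surf 0 0 l) (2 / l) t"
    by (rule flux_periodic) (use True l in simp)
  ultimately show ?thesis by simp
next
  case False
  then have t: "\<bar>2 * cos t\<bar> < 3/2" by auto
  then have "sin t \<noteq> 0" using sin_zero_abs_cos_one[of t] by auto
  then show ?thesis
    unfolding flux_straight[OF of_nat_0_le_iff l t] flux_straight[OF order_refl l t]
    by (auto simp: e1_def e0_def algebra_simps)
qed

text \<open>Under x = 2 cos t the upper and the lower arc each cross the band once, and the integral
  of \<eta>' over the band is 2 pi.\<close>

lemma integral_flux_growth: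
  fixes \<alpha> \<beta> b :: real
  assumes l: "l > 0"
  defines "e1 \<equiv> \<alpha> / r u1 + \<beta> * r u1 - b * cos u1" and "e0 \<equiv> \<alpha> / r u0 + \<beta> * r u0 + b * cos u0"
  assumes int: "flux \<alpha> \<beta> b (surf 0 0 l) (2 / l) integrable_on {0..2*pi}"
  shows "integral {0..2*pi} (flux \<alpha> \<beta> b (surf 0 (real n) l) (2 / l)) = integral {0..2*pi} (flux \<alpha> \<beta> b (surf 0 0 l) (2 / l))
    + real n * (2 * pi * (e0 + e1))"
proof -
  define g where "g t = (if sin t > 0 then e1 else e0) * \<eta>' (2 * cos t) * (2 * \<bar>sin t\<bar>)" for t
  have d: "((\<lambda>t. c * \<eta> (2 * cos t)) has_vector_derivative c * (\<eta>' (2 * cos t) * (- 2 * sin t))) (at t within S)" for c t S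
    unfolding has_real_derivative_iff_has_vector_derivative[symmetric]
    by (auto intro!: derivative_eq_intros DERIV_chain2[OF eta(2)])
  have eta2: "\<eta> 2 = 2 * pi" "\<eta> (- 2) = 0" using eta(5,6) by auto
  have "((\<lambda>t. - e1 * (\<eta>' (2 * cos t) * (- 2 * sin t))) has_integral (- e1 * \<eta> (2 * cos pi) - (- e1 * \<eta> (2 * cos 0)))) {0..pi}"
    by (rule fundamental_theorem_of_calculus[OF _ d]) simp
  then have 1: "(g has_integral (2 * pi * e1)) {0..pi}"
    unfolding cos_pi cos_zero mult_1_right mult_minus_right[of 2] eta2
    by (rule has_integral_eq[rotated, THEN has_integral_eq_rhs]) (auto simp: g_def sin_ge_zero dest: sin_ge_zero)
  have "((\<lambda>t. e0 * (\<eta>' (2 * cos t) * (- 2 * sin t))) has_integral (e0 * \<eta> (2 * cos (2*pi)) - (e0 * \<eta> (2 * cos pi)))) {pi..2*pi}"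
    by (rule fundamental_theorem_of_calculus[OF _ d]) simp
  then have 2: "(g has_integral (2 * pi * e0)) {pi..2*pi}"
  proof (rule has_integral_eq[rotated, THEN has_integral_eq_rhs])
    show "e0 * (\<eta>' (2 * cos t) * (- 2 * sin t)) = g t" if "t \<in> {pi..2*pi}" for t
    proof -
      have "sin t \<le> 0" using that sin_le_zero[of t] by (cases "t = 2*pi") auto
      then show ?thesis by (simp add: g_def)
    qed
  qed (simp add: eta2)
  have "(g has_integral (2 * pi * e1 + 2 * pi * e0)) {0..2*pi}"
    by (rule has_integral_combine[OF _ _ 1 2]) auto
  then have "((\<lambda>t. flux \<alpha> \<beta> b (surf 0 0 l) (2 / l) t + real n * g t) has_integral
      (integral {0..2*pi} (flux \<alpha> \<beta> b (surf 0 0 l) (2 / l)) + real n * (2 * pi * e1 + 2 * pi * e0))) {0..2*pi}"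
    by (intro has_integral_add integrable_integral[OF int] has_integral_mult_right)
  then have "integral {0..2*pi} (\<lambda>t. flux \<alpha> \<beta> b (surf 0 0 l) (2 / l) t + real n * g t)
      = integral {0..2*pi} (flux \<alpha> \<beta> b (surf 0 0 l) (2 / l)) + real n * (2 * pi * e1 + 2 * pi * e0)"
    by (rule integral_unique)
  moreover have "flux \<alpha> \<beta> b (surf 0 (real n) l) (2 / l) = (\<lambda>t. flux \<alpha> \<beta> b (surf 0 0 l) (2 / l) t + real n * g t)"
    using flux_growth[OF l] by (auto simp: fun_eq_iff g_def e0_def e1_def)
  ultimately show ?thesis by (simp add: algebra_simps)
qed

end

section \<open>From growth in the number of turns to unbounded energy\<close>

lemma INF_ereal_unbounded:
  fixes f :: "'a \<Rightarrow> real"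
  assumes "\<And>M. \<exists>x\<in>A. f x < M"
  shows "(INF x\<in>A. ereal (f x)) = -\<infinity>"
proof (rule ereal_bot)
  fix B
  obtain x where "x \<in> A" "f x < B" using assms by blast
  then show "(INF x\<in>A. ereal (f x)) \<le> ereal B" by (meson INF_lower2 ereal_less_eq(3) less_imp_le)
qed

text \<open>b' is the effective coefficient of the Gauss curvature: by \<open>pointwise\<close>, a
  (H + c)^2 + b K = b' K on the surface, so Gauss-Bonnet accounts for the whole area term.\<close>

locale energy_cover = cover +
  fixes a c b b' \<alpha> \<beta> :: real
  assumes positive: "\<alpha> > 0" "\<beta> > 0"
    and pointwise: "\<And>u. u \<in> I \<Longrightarrow> a * (- (1 / w u + sin u / r u) / 2 + c)\<^sup>2 + b * (1 / w u * (sin u / r u)) = b' * (1 / w u * (sin u / r u))"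
begin

text \<open>The energy of one extra turn. A full parallel of radius r costs 2 pi r (\<alpha> / r^2 +
  \<beta>), and its total geodesic curvature contributes 2 pi b' cos u, with opposite signs at the
  two ends.\<close>

definition rate :: real where
  "rate = 2 * pi * ((\<alpha> / r u0 + \<beta> * r u0 + b' * cos u0) + (\<alpha> / r u1 + \<beta> * r u1 - b' * cos u1))"

lemma surf_circle: "l > 0 \<Longrightarrow> 0 < R \<Longrightarrow> R \<le> 2 / l \<Longrightarrow> vector [R * cos t, R * sin t] \<in> reg l"
  using annulus_circle[of R R R t] by (intro strip_inside(2)) auto

lemma energy_density:
  assumes "l > 0" "n \<ge> 0" "p \<in> reg l"
  shows "a * (mean_curvature (surf 0 n l) p + c)\<^sup>2 + b * gauss_curvature (surf 0 n l) p = b' * gauss_curvature (surf 0 n l) p"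
  unfolding curvatures_surf[OF assms] by (rule pointwise) (use assms(3) in \<open>simp add: reg_def\<close>)

lemma smooth_surf_le: "k \<le> 4 \<Longrightarrow> C_k_on k (surf 0 n l) (reg l)"
  by (rule C_k_on_le[OF smooth_surf(1)])

lemma flux_parts:
  assumes l: "l > 0" and n: "n \<ge> 0" and R: "0 < R" "R \<le> 2 / l"
  shows "continuous_on {0..2*pi} (\<lambda>t. (\<alpha> * (curve_curvature (circle_image (surf 0 n l) R) t)\<^sup>2 + \<beta>) * speed (circle_image (surf 0 n l) R) t)"
    and "continuous_on {0..2*pi} (geodesic_form (surf 0 n l) R)"
    and "integral {0..2*pi} (flux \<alpha> \<beta> b' (surf 0 n l) R) = curve_energy \<alpha> \<beta> (circle_image (surf 0 n l) R) - b' * integral {0..2*pi} (geodesic_form (surf 0 n l) R)"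
    and "flux \<alpha> \<beta> b' (surf 0 n l) R integrable_on {0..2*pi}"
proof -
  let ?X = "surf 0 n l"
  have C: "C_k_on (Suc (Suc 0)) ?X (reg l)" by (rule smooth_surf_le) simp
  have circ: "vector [R * cos t, R * sin t] \<in> reg l" for t by (rule surf_circle[OF l R])
  note dc = circle_densities_continuous[OF open_reg C circ normal_field_surf_0_nonzero[OF l n] R(1)]
  show 1: "continuous_on {0..2*pi} (\<lambda>t. (\<alpha> * (curve_curvature (circle_image ?X R) t)\<^sup>2 + \<beta>) * speed (circle_image ?X R) t)"
    by (rule dc(1))
  show 2: "continuous_on {0..2*pi} (geodesic_form ?X R)"
    by (rule dc(2))
  note i1 = integrable_continuous_interval[OF 1] and i2 = integrable_continuous_interval[OF 2]
  have i3: "(\<lambda>t. b' * geodesic_form ?X R t) integrable_on {0..2*pi}"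
    by (rule integrable_continuous_interval) (intro continuous_intros 2)
  show "integral {0..2*pi} (flux \<alpha> \<beta> b' ?X R) = curve_energy \<alpha> \<beta> (circle_image ?X R) - b' * integral {0..2*pi} (geodesic_form ?X R)"
    unfolding flux_def[abs_def] curve_energy_def using Henstock_Kurzweil_Integration.integral_diff[OF i1 i3] by simp
  show "flux \<alpha> \<beta> b' ?X R integrable_on {0..2*pi}"
    unfolding flux_def[abs_def] by (rule integrable_diff[OF i1 i3])
qed

text \<open>A circle with l R <= 1 stays to the left of the band, where the extra turns change
  nothing.\<close>

lemma inner_circle_periodic:
  assumes "l > 0" "l * R \<le> 1" "R > 0"
  shows "geodesic_form (surf 0 (real n) l) R t = geodesic_form (surf 0 0 l) R t"
    "curve_energy \<alpha> \<beta> (circle_image (surf 0 (real n) l) R) = curve_energy \<alpha> \<beta> (circle_image (surf 0 0 l) R)"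
proof -
  have s: "l * (R * cos s) < 6/5 \<or> l * (R * cos s) > 7/5" for s
  proof -
    have "l * R * cos s \<le> l * R * 1" using assms by (intro mult_left_mono) auto
    then have "l * (R * cos s) \<le> 1" using assms(2) unfolding mult.assoc by linarith
    then show ?thesis by linarith
  qed
  show "geodesic_form (surf 0 (real n) l) R t = geodesic_form (surf 0 0 l) R t"
    \<comment> \<open>\<open>flux\<close> with \<alpha> = \<beta> = 0 and b = -1 is the geodesic
      form; taken with b = 0 it is the density of the curve energy.\<close>
    using flux_periodic[OF s, of 0 0 "-1" n t] by (simp add: flux_def)
  show "curve_energy \<alpha> \<beta> (circle_image (surf 0 (real n) l) R) = curve_energy \<alpha> \<beta> (circle_image (surf 0 0 l) R)"
    unfolding curve_energy_def using flux_periodic[OF s, of \<alpha> \<beta> 0 n] by (simp add: flux_def)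
qed

lemma surface_energy_annulus:
  assumes l: "l > 0" and n: "n \<ge> 0" and R: "0 < R" "R \<le> 2 / l"
  shows "surface_energy a c b (annulus R (2 / l)) (surf 0 n l)
    = b' * integral {0..2*pi} (geodesic_form (surf 0 n l) R) - b' * integral {0..2*pi} (geodesic_form (surf 0 n l) (2 / l))"
proof -
  have sub: "annulus R (2 / l) \<subseteq> reg l" using strip_inside(2)[OF l] by auto
  have "surface_energy a c b (annulus R (2 / l)) (surf 0 n l)
      = integral (annulus R (2 / l)) (\<lambda>p. b' * (gauss_curvature (surf 0 n l) p * area_element (surf 0 n l) p))"
    unfolding surface_energy_def
    by (rule integral_cong) (use energy_density[OF l n] sub in \<open>simp add: subset_iff mult.assoc\<close>)
  also have "\<dots> = b' * integral (annulus R (2 / l)) (\<lambda>p. gauss_curvature (surf 0 n l) p * area_element (surf 0 n l) p)" by simp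
  also have "integral (annulus R (2 / l)) (\<lambda>p. gauss_curvature (surf 0 n l) p * area_element (surf 0 n l) p)
      = integral {0..2*pi} (geodesic_form (surf 0 n l) R) - integral {0..2*pi} (geodesic_form (surf 0 n l) (2 / l))"
    by (rule gauss_bonnet_annulus[OF R open_reg smooth_surf(1) sub normal_field_surf_0_nonzero[OF l n]])
  finally show ?thesis by (simp add: right_diff_distrib)
qed

text \<open>The geodesic term of the circle of radius R does not change with n, so the outer flux
  accounts for all of the growth.\<close>

lemma energy_growth:
  assumes l: "l > 0" and R: "0 < R" "l * R \<le> 1"
  shows "surface_energy a c b (annulus R (2 / l)) (surf 0 (real n) l) + curve_energy \<alpha> \<beta> (circle_image (surf 0 (real n) l) (2 / l))
    = surface_energy a c b (annulus R (2 / l)) (surf 0 0 l) + curve_energy \<alpha> \<beta> (circle_image (surf 0 0 l) (2 / l)) + real n * rate"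
proof -
  have R2: "R \<le> 2 / l" using l R by (simp add: field_simps)
  have *: "surface_energy a c b (annulus R (2 / l)) (surf 0 k l) + curve_energy \<alpha> \<beta> (circle_image (surf 0 k l) (2 / l))
      = b' * integral {0..2*pi} (geodesic_form (surf 0 k l) R) + integral {0..2*pi} (flux \<alpha> \<beta> b' (surf 0 k l) (2 / l))" if "k \<ge> 0" for k
    using surface_energy_annulus[OF l that R(1) R2] flux_parts(3)[OF l that, of "2 / l"] l by simp
  have "integral {0..2*pi} (flux \<alpha> \<beta> b' (surf 0 (real n) l) (2 / l)) = integral {0..2*pi} (flux \<alpha> \<beta> b' (surf 0 0 l) (2 / l)) + real n * rate"
    unfolding rate_def by (rule integral_flux_growth[OF l flux_parts(4)[OF l order_refl]]) (use l in auto)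
  moreover have "geodesic_form (surf 0 (real n) l) R = geodesic_form (surf 0 0 l) R"
    by (rule ext) (rule inner_circle_periodic(1)[OF l R(2,1)])
  ultimately show ?thesis
    unfolding *[OF of_nat_0_le_iff] *[OF order_refl] by simp
qed

lemma annulus_energy_growth:
  "annulus_energy a c b \<alpha> \<beta> (surf 0 (real n) 1) = annulus_energy a c b \<alpha> \<beta> (surf 0 0 1) + real n * rate"
  using energy_growth[of 1 1 n] inner_circle_periodic(2)[of 1 1 n]
  unfolding annulus_energy_def std_annulus_def by simp

text \<open>\<open>gauss_bonnet_annulus\<close> needs a hole, so the disc is cut at radius 1/2.
  Inside, even after scaling by 2, the band is not reached and the integrand is the same for n turns
  as for none; outside, \<open>energy_growth\<close> applies.\<close>

lemma disc_energy_growth: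
  "disc_energy a c b \<alpha> \<beta> (surf 0 (real n) 2) = disc_energy a c b \<alpha> \<beta> (surf 0 0 2) + real n * rate"
proof -
  define f where "f k p = (a * (mean_curvature (surf 0 k 2) p + c)\<^sup>2 + b * gauss_curvature (surf 0 k 2) p) * area_element (surf 0 k 2) p" for k p
  have sub: "cball 0 1 \<subseteq> reg 2" using strip_inside(2)[of 2] by auto
  have split: "surface_energy a c b std_disc (surf 0 k 2) = integral (cball 0 (1/2)) (f k) + surface_energy a c b (annulus (1/2) 1) (surf 0 k 2)"
    if "k \<ge> 0" for k
  proof -
    note cont = curvature_area_continuous[OF open_reg smooth_surf_le[of 2] normal_field_surf_0_nonzero[OF _ that]]
    have "continuous_on (reg 2) (f k)" unfolding f_def[abs_def]
      by (intro continuous_on_mult continuous_on_add continuous_on_power continuous_on_const cont) auto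
    then have int: "f k integrable_on D" if "compact D" "D \<subseteq> cball 0 1" for D
      using integrable_on_compact[OF that(1)] continuous_on_subset that(2) sub by blast
    have U: "cball 0 1 = cball 0 (1/2) \<union> annulus (1/2) 1" by auto
    have "cball 0 (1/2) \<inter> annulus (1/2) 1 \<subseteq> sphere (0::real^2) (1/2)" by auto
    then have neg: "negligible (cball 0 (1/2) \<inter> annulus (1/2) 1)"
      using negligible_subset[OF negligible_sphere] by blast
    have "integral (cball 0 (1/2) \<union> annulus (1/2) 1) (f k) = integral (cball 0 (1/2)) (f k) + integral (annulus (1/2) 1) (f k)"
    proof (rule integral_Un[OF _ _ neg])
      show "f k integrable_on cball 0 (1/2)" by (rule int) auto
      show "f k integrable_on annulus (1/2) 1" by (rule int[OF compact_annulus]) auto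
    qed
    then show ?thesis unfolding surface_energy_def std_disc_def U f_def .
  qed
  have "integral (cball 0 (1/2)) (f (real n)) = integral (cball 0 (1/2)) (f 0)"
  proof (rule integral_cong)
    fix p :: "real^2" assume p: "p \<in> cball 0 (1/2)"
    then have r: "p \<in> reg 2" using sub by auto
    have "\<bar>p $ 1\<bar> \<le> 1/2" using component_le_norm_cart[of p 1] p by auto
    then have "2 * p $ 1 < 6/5 \<or> 2 * p $ 1 > 7/5" by auto
    then have "area_element (surf 0 (real n) 2) p = area_element (surf 0 0 2) p"
      by (simp add: area_element_def normal_field_pd pd_surf_periodic)
    then show "f (real n) p = f 0 p"
      unfolding f_def curvatures_surf[OF zero_less_numeral of_nat_0_le_iff r] curvatures_surf[OF zero_less_numeral order_refl r] by simp
  qed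
  then show ?thesis
    using energy_growth[of 2 "1/2" n] split[of "real n"] split[of 0] unfolding disc_energy_def by simp
qed

text \<open>E stands for either energy, and \<open>lim\<close> is its convergence as \<epsilon>
  tends to 0 along immersions. The strict inequality at \<epsilon> = 0 survives for some positive
  \<epsilon>, for which the surface is embedded.\<close>

lemma perturb_below:
  assumes D: "compact D" and l: "l > 0" "\<And>p. p \<in> D \<Longrightarrow> norm p \<le> 2 / l"
    and lim: "\<And>e. e > 0 \<Longrightarrow> (\<And>\<epsilon> p. \<epsilon> \<in> {0..e} \<Longrightarrow> p \<in> D \<Longrightarrow> normal_field (surf \<epsilon> (real n) l) p \<noteq> 0) \<Longrightarrow>
      (\<lambda>k. E (surf (e * inverse (real (Suc k))) (real n) l)) \<longlonglongrightarrow> (E (surf 0 (real n) l) :: real)"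
    and "E (surf 0 (real n) l) < M"
  shows "\<exists>X. embedded_C4_surface D X \<and> E X < M"
proof -
  obtain e where e: "e > 0" "\<And>\<epsilon> n l p. \<epsilon> \<in> {0..e} \<Longrightarrow> n \<ge> 0 \<Longrightarrow> l > 0 \<Longrightarrow> norm p \<le> 2 / l \<Longrightarrow> r (strip n l p $ 2) + \<epsilon> * strip n l p $ 1 > 0"
    using spiral_threshold by blast
  have "(\<lambda>k. E (surf (e * inverse (real (Suc k))) (real n) l)) \<longlonglongrightarrow> E (surf 0 (real n) l)"
    using l strip_inside(2)[OF l(1)] by (intro lim e normal_field_surf_nonzero) auto
  then have "\<forall>\<^sub>F k in sequentially. E (surf (e * inverse (real (Suc k))) (real n) l) < M"
    using assms(5) by (rule order_tendstoD(2))
  then obtain k where k: "E (surf (e * inverse (real (Suc k))) (real n) l) < M"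
    using eventually_happens'[OF sequentially_bot] by blast
  have ek: "e * inverse (real (Suc k)) > 0" "e * inverse (real (Suc k)) \<in> {0..e}" using e(1) by (auto simp: field_simps)
  have "embedded_C4_surface D (surf (e * inverse (real (Suc k))) (real n) l)"
    by (rule embedded_surf[OF ek(1) of_nat_0_le_iff l]) (use e(2)[OF ek(2) of_nat_0_le_iff l] in auto)
  then show ?thesis using k by blast
qed

text \<open>The order of choices matters: n pushes the immersed surface below M, and only then is
  \<epsilon> chosen, depending on n.\<close>

lemma unbounded_below:
  assumes "rate < 0"
  shows "\<exists>X\<in>top_annuli. annulus_energy a c b \<alpha> \<beta> X < M" "\<exists>X\<in>top_discs. disc_energy a c b \<alpha> \<beta> X < M"
proof -
  have large: "\<exists>n::nat. E + real n * rate < M" for E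
  proof -
    obtain n :: nat where "real n > (E - M) / (- rate)" using reals_Archimedean2 by blast
    then have "real n * (- rate) > E - M" using assms by (simp add: field_simps)
    then show ?thesis by (intro exI[of _ n]) simp
  qed
  have C: "C_k_on 2 (surf 0 n l) (reg l)" "C_k_on 2 (\<lambda>p. drift (strip n l p)) (reg l)" for n l
    using C_k_on_le[OF smooth_surf(1)] C_k_on_le[OF smooth_surf(2)] by auto
  obtain n where n: "annulus_energy a c b \<alpha> \<beta> (surf 0 (real n) 1) < M"
    unfolding annulus_energy_growth using large by blast
  have "\<exists>X. embedded_C4_surface (annulus 1 2) X \<and> annulus_energy a c b \<alpha> \<beta> X < M"
  proof (rule perturb_below[where E = "annulus_energy a c b \<alpha> \<beta>" and l = 1 and n = n, OF compact_annulus zero_less_one _ _ n])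
    fix e assume e: "e > (0::real)"
      and nz: "\<And>\<epsilon> p. \<epsilon> \<in> {0..e} \<Longrightarrow> p \<in> annulus 1 2 \<Longrightarrow> normal_field (surf \<epsilon> (real n) 1) p \<noteq> 0"
    have sub: "annulus 1 2 \<subseteq> reg 1" using strip_inside(2)[of 1] by auto
    have circ: "vector [R * cos t, R * sin t] \<in> annulus 1 2" if "R = 1 \<or> R = 2" for R t
      using annulus_circle[of 1 R 2 t] that by auto
    have nz': "normal_field (\<lambda>p. surf 0 (real n) 1 p + \<epsilon> *\<^sub>R drift (strip (real n) 1 p)) p \<noteq> 0"
      if "\<epsilon> \<in> {0..e}" "p \<in> annulus 1 2" for \<epsilon> p
      using nz[OF that] unfolding surf_eq[of \<epsilon>] .
    show "(\<lambda>k. annulus_energy a c b \<alpha> \<beta> (surf (e * inverse (real (Suc k))) (real n) 1)) \<longlonglongrightarrow> annulus_energy a c b \<alpha> \<beta> (surf 0 (real n) 1)"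
      unfolding annulus_energy_def std_annulus_def surf_eq[of "e * inverse (real (Suc k))" for k]
    proof (intro tendsto_add)
      show "(\<lambda>k. surface_energy a c b (annulus 1 2) (\<lambda>p. surf 0 (real n) 1 p + (e * inverse (real (Suc k))) *\<^sub>R drift (strip (real n) 1 p)))
          \<longlonglongrightarrow> surface_energy a c b (annulus 1 2) (surf 0 (real n) 1)"
        by (rule surface_energy_limit[OF e compact_annulus sub open_reg C nz'])
      show "(\<lambda>k. curve_energy \<alpha> \<beta> (circle_image (\<lambda>p. surf 0 (real n) 1 p + (e * inverse (real (Suc k))) *\<^sub>R drift (strip (real n) 1 p)) 1))
          \<longlonglongrightarrow> curve_energy \<alpha> \<beta> (circle_image (surf 0 (real n) 1) 1)"
        by (rule curve_energy_limit[OF e _ circ sub open_reg C nz']) auto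
      show "(\<lambda>k. curve_energy \<alpha> \<beta> (circle_image (\<lambda>p. surf 0 (real n) 1 p + (e * inverse (real (Suc k))) *\<^sub>R drift (strip (real n) 1 p)) 2))
          \<longlonglongrightarrow> curve_energy \<alpha> \<beta> (circle_image (surf 0 (real n) 1) 2)"
        by (rule curve_energy_limit[OF e _ circ sub open_reg C nz']) auto
    qed
  qed auto
  then show "\<exists>X\<in>top_annuli. annulus_energy a c b \<alpha> \<beta> X < M"
    unfolding top_annuli_def std_annulus_def by blast
  obtain n where n: "disc_energy a c b \<alpha> \<beta> (surf 0 (real n) 2) < M"
    unfolding disc_energy_growth using large by blast
  have "\<exists>X. embedded_C4_surface std_disc X \<and> disc_energy a c b \<alpha> \<beta> X < M"
    unfolding std_disc_def
  proof (rule perturb_below[where E = "disc_energy a c b \<alpha> \<beta>" and l = 2 and n = n, OF compact_cball zero_less_numeral _ _ n])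
    fix e assume e: "e > (0::real)"
      and nz: "\<And>\<epsilon> p. \<epsilon> \<in> {0..e} \<Longrightarrow> p \<in> cball 0 1 \<Longrightarrow> normal_field (surf \<epsilon> (real n) 2) p \<noteq> 0"
    have sub: "cball 0 1 \<subseteq> reg 2" using strip_inside(2)[of 2] by auto
    have circ: "vector [1 * cos t, 1 * sin t] \<in> cball (0::real^2) 1" for t
      using annulus_circle[of 1 1 1 t] by auto
    have nz': "normal_field (\<lambda>p. surf 0 (real n) 2 p + \<epsilon> *\<^sub>R drift (strip (real n) 2 p)) p \<noteq> 0"
      if "\<epsilon> \<in> {0..e}" "p \<in> cball 0 1" for \<epsilon> p
      using nz[OF that] unfolding surf_eq[of \<epsilon>] .
    show "(\<lambda>k. disc_energy a c b \<alpha> \<beta> (surf (e * inverse (real (Suc k))) (real n) 2)) \<longlonglongrightarrow> disc_energy a c b \<alpha> \<beta> (surf 0 (real n) 2)"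
      unfolding disc_energy_def std_disc_def surf_eq[of "e * inverse (real (Suc k))" for k]
    proof (intro tendsto_add)
      show "(\<lambda>k. surface_energy a c b (cball 0 1) (\<lambda>p. surf 0 (real n) 2 p + (e * inverse (real (Suc k))) *\<^sub>R drift (strip (real n) 2 p)))
          \<longlonglongrightarrow> surface_energy a c b (cball 0 1) (surf 0 (real n) 2)"
        by (rule surface_energy_limit[OF e compact_cball sub open_reg C nz'])
      show "(\<lambda>k. curve_energy \<alpha> \<beta> (circle_image (\<lambda>p. surf 0 (real n) 2 p + (e * inverse (real (Suc k))) *\<^sub>R drift (strip (real n) 2 p)) 1))
          \<longlonglongrightarrow> curve_energy \<alpha> \<beta> (circle_image (surf 0 (real n) 2) 1)"
        by (rule curve_energy_limit[OF e zero_less_one circ sub open_reg C nz'])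
    qed
  qed auto
  then show "\<exists>X\<in>top_discs. disc_energy a c b \<alpha> \<beta> X < M"
    unfolding top_discs_def by blast
qed

end

text \<open>The interface for concrete surfaces: two conditions remain, the pointwise identity with
  some b' and a negative sum over the two ends.\<close>

theorem (in profile) energies_unbounded_below:
  assumes "\<alpha> > 0" "\<beta> > 0"
    and "\<And>u. u \<in> I \<Longrightarrow> a * (- (1 / w u + sin u / r u) / 2 + c)\<^sup>2 + b * (1 / w u * (sin u / r u)) = b' * (1 / w u * (sin u / r u))"
    and "(\<alpha> / r u0 + \<beta> * r u0 + b' * cos u0) + (\<alpha> / r u1 + \<beta> * r u1 - b' * cos u1) < 0"
  shows "(INF X\<in>top_annuli. ereal (annulus_energy a c b \<alpha> \<beta> X)) = -\<infinity>" "(INF X\<in>top_discs. ereal (disc_energy a c b \<alpha> \<beta> X)) = -\<infinity>"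
proof -
  obtain \<eta> \<eta>' where eta: "C_k_on 4 \<eta> UNIV" "\<And>x. (\<eta> has_real_derivative \<eta>' x) (at x)"
    "\<And>x. \<eta>' x \<ge> 0" "\<And>x. \<eta> x \<ge> 0" "\<And>x. x \<le> 6/5 \<Longrightarrow> \<eta> x = 0" "\<And>x. x \<ge> 7/5 \<Longrightarrow> \<eta> x = 2 * pi"
    "\<And>x. x \<notin> {6/5<..<7/5} \<Longrightarrow> \<eta>' x = 0" "continuous_on UNIV \<eta>'"
    using cutoff_exists by metis
  interpret energy_cover r z w w' I u0 u1 \<eta> \<eta>' a c b b' \<alpha> \<beta>
    by unfold_locales (use assms eta in auto)
  have "rate < 0" unfolding rate_def using assms(4) by (intro mult_pos_neg) auto
  then show "(INF X\<in>top_annuli. ereal (annulus_energy a c b \<alpha> \<beta> X)) = -\<infinity>" "(INF X\<in>top_discs. ereal (disc_energy a c b \<alpha> \<beta> X)) = -\<infinity>"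
    using unbounded_below INF_ereal_unbounded by metis+
qed

section \<open>Spheres, catenoids and nodoids\<close>

lemma antiderivative_exists:
  fixes g :: "real \<Rightarrow> real"
  assumes "continuous_on {A..B} g"
  obtains z where "\<And>u. u \<in> {A<..<B} \<Longrightarrow> (z has_real_derivative g u) (at u)"
proof (rule that)
  fix u assume u: "u \<in> {A<..<B}"
  have "((\<lambda>x. integral {A..x} g) has_real_derivative g u) (at u within {A..B})"
    by (rule integral_has_real_derivative[OF assms]) (use u in auto)
  moreover have "at u within {A..B} = at u" by (rule at_within_interior) (use u in auto)
  ultimately show "((\<lambda>x. integral {A..x} g) has_real_derivative g u) (at u)" by simp
qed

text \<open>The sign is asked for only inside the interval, since for the nodoid sin vanishes at
  both ends.\<close>

lemma monotone_deriv_inj_on: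
  fixes z g :: "real \<Rightarrow> real"
  assumes der: "\<And>u. u \<in> {u0..u1} \<Longrightarrow> (z has_real_derivative g u) (at u)"
    and sgn: "(\<forall>u\<in>{u0<..<u1}. g u > 0) \<or> (\<forall>u\<in>{u0<..<u1}. g u < 0)"
  shows "inj_on z {u0..u1}"
proof -
  have cont: "continuous_on {x..y} z" if "u0 \<le> x" "y \<le> u1" for x y
    by (rule continuous_at_imp_continuous_on) (use that in \<open>auto intro!: DERIV_isCont[OF der]\<close>)
  have "z x \<noteq> z y" if "x \<in> {u0..u1}" "y \<in> {u0..u1}" "x < y" for x y
    using sgn
  proof
    assume pos: "\<forall>u\<in>{u0<..<u1}. g u > 0"
    have "z x < z y"
      by (rule DERIV_pos_imp_increasing_open[OF that(3) _ cont])
         (use that pos in \<open>auto intro!: exI[of _ "g _"] der\<close>)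
    then show ?thesis by simp
  next
    assume neg: "\<forall>u\<in>{u0<..<u1}. g u < 0"
    have "z y < z x"
      by (rule DERIV_neg_imp_decreasing_open[OF that(3) _ cont])
         (use that neg in \<open>auto intro!: exI[of _ "g _"] der\<close>)
    then show ?thesis by simp
  qed
  then show ?thesis
    by (intro linorder_inj_onI) auto
qed

text \<open>The radius and the radius of curvature, as functions of the tangent angle, determine the
  rest: the height is an antiderivative of w sin u, and the sign of sin u makes it
  injective.\<close>

lemma profile_from_angle:
  fixes r w :: "real \<Rightarrow> real"
  assumes I: "A < u0" "u0 < u1" "u1 < B"
    and r: "C_k_on 4 r {A<..<B}" "\<And>u. u \<in> {A<..<B} \<Longrightarrow> (r has_real_derivative w u * cos u) (at u)"
    and w: "C_k_on 4 w {A<..<B}" "continuous_on {A..B} w"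
    and pos: "\<And>u. u \<in> {A<..<B} \<Longrightarrow> w u > 0" "\<And>u. u \<in> {A<..<B} \<Longrightarrow> r u > 0"
    and sgn: "(\<forall>u\<in>{u0<..<u1}. sin u > 0) \<or> (\<forall>u\<in>{u0<..<u1}. sin u < 0)"
  obtains z w' where "profile r z w w' {A<..<B} u0 u1"
proof -
  obtain z where z: "\<And>u. u \<in> {A<..<B} \<Longrightarrow> (z has_real_derivative w u * sin u) (at u)"
    by (rule antiderivative_exists[of A B "\<lambda>u. w u * sin u"]) (use w in \<open>auto intro!: continuous_intros\<close>)
  have "C_k_on 3 (\<lambda>u. w u * sin u) {A<..<B}"
    using C_k_on_sin_cos[of "{A<..<B}" 3] by (intro C_k_on_mult C_k_on_le[OF w(1)]) auto
  from C_k_on_real_SucI[OF open_greaterThanLessThan z this] have z4: "C_k_on 4 z {A<..<B}"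
    by (simp add: eval_nat_numeral)
  have "C_k_on (Suc 3) w {A<..<B}" using w(1) by (simp add: eval_nat_numeral)
  then have w': "(w has_real_derivative deriv w u) (at u)" if "u \<in> {A<..<B}" for u
    using that unfolding C_k_on.simps DERIV_deriv_iff_real_differentiable by blast
  have "inj_on z {u0..u1}"
  proof (rule monotone_deriv_inj_on)
    show "(z has_real_derivative w u * sin u) (at u)" if "u \<in> {u0..u1}" for u using z that I by auto
    have "w u > 0" if "u \<in> {u0<..<u1}" for u using pos(1)[of u] that I by auto
    then show "(\<forall>u\<in>{u0<..<u1}. w u * sin u > 0) \<or> (\<forall>u\<in>{u0<..<u1}. w u * sin u < 0)"
      using sgn by (auto simp: zero_less_mult_iff mult_less_0_iff)
  qed
  then have "profile r z w (deriv w) {A<..<B} u0 u1"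
    by unfold_locales (use I r z z4 w' pos in auto)
  then show ?thesis by (rule that)
qed

text \<open>This is the minimum of \<alpha> / r + \<beta> r over r > 0, whence the radius of the
  bounding parallels.\<close>

lemma boundary_density:
  assumes "\<alpha> > 0" "\<beta> > 0"
  shows "\<alpha> / sqrt (\<alpha> / \<beta>) + \<beta> * sqrt (\<alpha> / \<beta>) = 2 * sqrt (\<alpha> * \<beta>)"
proof -
  have "\<alpha> / sqrt (\<alpha> / \<beta>) = sqrt (\<alpha> * \<beta>)" "\<beta> * sqrt (\<alpha> / \<beta>) = sqrt (\<alpha> * \<beta>)"
    using assms by (simp_all add: real_sqrt_divide real_sqrt_mult field_simps)
  then show ?thesis by simp
qed

text \<open>Delaunay surfaces of mean curvature - c have the first integral c r^2 - r sin u = const.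
  The constant c \<rho>^2 makes r = \<rho> wherever the tangent is horizontal, and r below is the
  positive root. As H + c = 0, only b K is left of the area integrand, so b' = b.\<close>

lemma nodoid_unbounded:
  assumes "\<alpha> > 0" "\<beta> > 0" "c > 0" and E: "2 * sqrt (\<alpha> * \<beta>) < \<bar>b\<bar>"
  shows "(INF X\<in>top_annuli. ereal (annulus_energy a c b \<alpha> \<beta> X)) = -\<infinity> \<and> (INF X\<in>top_discs. ereal (disc_energy a c b \<alpha> \<beta> X)) = -\<infinity>"
proof -
  define \<rho> where "\<rho> = sqrt (\<alpha> / \<beta>)"
  have \<rho>: "\<rho> > 0" using assms by (simp add: \<rho>_def)
  define Q where "Q u = sqrt (sin u * sin u + 4 * c\<^sup>2 * \<rho>\<^sup>2)" for u
  define r where "r u = (sin u + Q u) * inverse (2 * c)" for u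
  define w where "w u = r u * inverse (Q u)" for u
  have k: "4 * c\<^sup>2 * \<rho>\<^sup>2 > 0" using \<open>c > 0\<close> \<rho> by simp
  have q: "sin u * sin u + 4 * c\<^sup>2 * \<rho>\<^sup>2 > 0" for u using k by (simp add: add_nonneg_pos)
  have Q: "Q u > 0" for u using q by (simp add: Q_def)
  have r: "r u > 0" for u
  proof -
    have "\<bar>sin u\<bar> < Q u" unfolding Q_def using k by (intro real_less_rsqrt) (simp add: power2_eq_square)
    then have "sin u + Q u > 0" by linarith
    then show ?thesis using \<open>c > 0\<close> by (simp add: r_def)
  qed
  have C: "C_k_on 4 Q S" "C_k_on 4 r S" "C_k_on 4 w S" if "open S" for S
  proof -
    note sc = C_k_on_sin_cos[OF that, of 4]
    show CQ: "C_k_on 4 Q S" unfolding Q_def[abs_def]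
      using sc q by (intro C_k_on_inverse_pos(2) C_k_on_add C_k_on_mult C_k_on_const that) auto
    show Cr: "C_k_on 4 r S" unfolding r_def[abs_def]
      using sc by (intro C_k_on_mult C_k_on_add C_k_on_const CQ that) auto
    show "C_k_on 4 w S" unfolding w_def[abs_def]
      using Q by (intro C_k_on_mult C_k_on_inverse_pos(1) CQ Cr that) auto
  qed
  have rd: "(r has_real_derivative w u * cos u) (at u)" for u
  proof -
    have "(Q has_real_derivative (sin u * cos u) / Q u) (at u)"
      unfolding Q_def[abs_def] using q[of u] by (auto intro!: derivative_eq_intros simp: field_simps)
    then have "(r has_real_derivative (cos u + sin u * cos u / Q u) * inverse (2 * c)) (at u)"
      unfolding r_def[abs_def] by (auto intro!: derivative_eq_intros)
    moreover have "(cos u + sin u * cos u / Q u) * inverse (2 * c) = w u * cos u"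
      using Q[of u] by (simp add: w_def r_def field_simps)
    ultimately show ?thesis by simp
  qed
  have mean: "1 / w u + sin u / r u = 2 * c" for u
  proof -
    have "1 / w u + sin u / r u = (sin u + Q u) / r u" using Q[of u] r[of u] by (simp add: w_def field_simps)
    also have "\<dots> = 2 * c"
    proof -
      have "A / (A * inverse (2 * c)) = 2 * c" if "A \<noteq> 0" for A using \<open>c > 0\<close> that by (simp add: field_simps)
      moreover have "sin u + Q u \<noteq> 0" using r[of u] by (auto simp: r_def)
      ultimately show ?thesis unfolding r_def by blast
    qed
    finally show ?thesis .
  qed
  have pw: "a * (- (1 / w u + sin u / r u) / 2 + c)\<^sup>2 + b * (1 / w u * (sin u / r u)) = b * (1 / w u * (sin u / r u))" for u
    unfolding mean by simp
  have ends: "r 0 = \<rho>" "r pi = \<rho>" "r (2 * pi) = \<rho>"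
    using \<open>c > 0\<close> \<rho> by (simp_all add: r_def Q_def real_sqrt_mult)
  note bd = boundary_density[OF assms(1,2), folded \<rho>_def]
  \<comment> \<open>Places [0, 2 pi] inside the interval from -1 to 9 on which both halves are
    defined.\<close>
  have pi4: "pi < 4" using pi_less_4 .
  have wc: "continuous_on S w" for S using C_k_on_continuous[OF C(3)[OF open_UNIV]] continuous_on_subset by blast
  show ?thesis
  \<comment> \<open>For b < 0 the half with K > 0 is taken, tangent angles 0 to pi; otherwise b > 0
    and the half with K < 0 serves, angles pi to 2 pi. Either way b (cos u0 - cos u1) = - 2
    |b|.\<close>
  proof (cases "b < 0")
    case True
    obtain z w' where "profile r z w w' {-1<..<9} 0 pi"
      by (rule profile_from_angle[of "-1" 0 pi 9 r w])
         (use pi4 C r Q rd wc sin_gt_zero in \<open>auto simp: w_def\<close>)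
    then interpret profile r z w w' "{-1<..<9}" 0 pi .
    have "(\<alpha> / r 0 + \<beta> * r 0 + b * cos 0) + (\<alpha> / r pi + \<beta> * r pi - b * cos pi) < 0"
      unfolding ends bd using True E by simp
    from energies_unbounded_below[OF assms(1,2) pw this] show ?thesis by blast
  next
    case False
    have "sin u < 0" if "u \<in> {pi<..<2*pi}" for u using that sin_gt_zero[of "u - pi"] by (simp add: sin_diff)
    then obtain z w' where "profile r z w w' {-1<..<9} pi (2 * pi)"
      using profile_from_angle[of "-1" pi "2 * pi" 9 r w] pi4 pi_gt_zero C r Q rd wc
      by (auto simp: w_def)
    then interpret profile r z w w' "{-1<..<9}" pi "2 * pi" .
    have "(\<alpha> / r pi + \<beta> * r pi + b * cos pi) + (\<alpha> / r (2 * pi) + \<beta> * r (2 * pi) - b * cos (2 * pi)) < 0"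
      unfolding ends bd using False E by simp
    from energies_unbounded_below[OF assms(1,2) pw this] show ?thesis by blast
  qed
qed

text \<open>On spheres and catenoids a horizontal tangent occurs only at a pole or at infinity, so
  the ends are tilted by a small angle \<tau>; a strict inequality leaves room for it. Its cosine k
  is taken halfway between q / b and 1.\<close>

lemma small_angle:
  fixes q b :: real
  assumes "0 < q" "q < b"
  obtains \<tau> where "0 < \<tau>" "\<tau> < pi / 2" "q < b * cos \<tau>"
proof -
  define x where "x = q / b"
  have x: "0 < x" "x < 1" "q = x * b" using assms by (auto simp: x_def)
  define k where "k = (x + 1) / 2"
  have k: "0 < k" "k < 1" "x < k" using x by (auto simp: k_def)
  have "arccos k < arccos 0" "arccos 1 < arccos k" using k by (intro arccos_less_arccos; simp)+
  moreover have "cos (arccos k) = k" using k by (intro cos_arccos) auto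
  ultimately show ?thesis
    using k x assms by (intro that[of "arccos k"]) (auto simp: mult.commute)
qed

text \<open>The zone of a sphere between two parallels of radius \<rho> on either side of the
  equator: the smaller \<tau>, the larger the sphere and the closer the total curvature of the zone
  to 4 pi. As H^2 = K and \<open>c\<^sub>o\<close> = 0, the effective coefficient is a + b.\<close>

lemma sphere_unbounded:
  assumes "\<alpha> > 0" "\<beta> > 0" and E: "2 * sqrt (\<alpha> * \<beta>) + a + b < 0"
  shows "(INF X\<in>top_annuli. ereal (annulus_energy a 0 b \<alpha> \<beta> X)) = -\<infinity> \<and> (INF X\<in>top_discs. ereal (disc_energy a 0 b \<alpha> \<beta> X)) = -\<infinity>"
proof -
  define \<rho> where "\<rho> = sqrt (\<alpha> / \<beta>)"
  have \<rho>: "\<rho> > 0" using assms by (simp add: \<rho>_def)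
  obtain \<tau> where \<tau>: "0 < \<tau>" "\<tau> < pi / 2" "2 * sqrt (\<alpha> * \<beta>) < - (a + b) * cos \<tau>"
    using small_angle[of "2 * sqrt (\<alpha> * \<beta>)" "- (a + b)"] assms by auto
  have s: "sin \<tau> > 0" using \<tau> by (intro sin_gt_zero) auto
  define R where "R = \<rho> / sin \<tau>"
  have R: "R > 0" using \<rho> s by (simp add: R_def)
  have C: "C_k_on 4 (\<lambda>u. R * sin u) {0<..<pi}"
    using C_k_on_sin_cos[of "{0<..<pi}" 4] by (intro C_k_on_mult C_k_on_const) auto
  obtain z w' where "profile (\<lambda>u. R * sin u) z (\<lambda>_. R) w' {0<..<pi} \<tau> (pi - \<tau>)"
  proof (rule profile_from_angle[OF _ _ _ C])
    show "((\<lambda>u. R * sin u) has_real_derivative R * cos u) (at u)" for u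
      by (auto intro!: derivative_eq_intros)
    have "sin u > 0" if "u \<in> {\<tau><..<pi - \<tau>}" for u using that \<tau> by (intro sin_gt_zero) auto
    then show "(\<forall>u\<in>{\<tau><..<pi - \<tau>}. sin u > 0) \<or> (\<forall>u\<in>{\<tau><..<pi - \<tau>}. sin u < 0)" by blast
  qed (use \<tau> R sin_gt_zero C_k_on_const in auto)
  then interpret profile "\<lambda>u. R * sin u" z "\<lambda>_. R" w' "{0<..<pi}" \<tau> "pi - \<tau>" .
  have pw: "a * (- (1 / R + sin u / (R * sin u)) / 2 + 0)\<^sup>2 + b * (1 / R * (sin u / (R * sin u))) = (a + b) * (1 / R * (sin u / (R * sin u)))"
    if "u \<in> {0<..<pi}" for u
  proof -
    have "sin u / (R * sin u) = 1 / R" using sin_gt_zero[of u] that by simp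
    then show ?thesis by (simp add: power2_eq_square add_divide_distrib)
  qed
  have ends: "R * sin \<tau> = \<rho>" "R * sin (pi - \<tau>) = \<rho>" using s by (simp_all add: R_def)
  have "(\<alpha> / (R * sin \<tau>) + \<beta> * (R * sin \<tau>) + (a + b) * cos \<tau>) + (\<alpha> / (R * sin (pi - \<tau>)) + \<beta> * (R * sin (pi - \<tau>)) - (a + b) * cos (pi - \<tau>)) < 0"
    unfolding ends \<rho>_def boundary_density[OF assms(1,2)] cos_pi_minus using \<tau>(3) by (simp add: algebra_simps)
  from energies_unbounded_below[OF assms(1,2) pw this] show ?thesis by blast
qed

text \<open>A catenary with neck radius d = \<rho> sin \<tau>, described by its tangent angle u
  between pi and 2 pi through r = d / (- sin u). It reaches radius \<rho> at distance \<tau> from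
  either end. As H = 0, only b K remains, and K < 0 suits b > 0.\<close>

lemma catenoid_unbounded:
  assumes "\<alpha> > 0" "\<beta> > 0" and E: "2 * sqrt (\<alpha> * \<beta>) < b"
  shows "(INF X\<in>top_annuli. ereal (annulus_energy a 0 b \<alpha> \<beta> X)) = -\<infinity> \<and> (INF X\<in>top_discs. ereal (disc_energy a 0 b \<alpha> \<beta> X)) = -\<infinity>"
proof -
  define \<rho> where "\<rho> = sqrt (\<alpha> / \<beta>)"
  have \<rho>: "\<rho> > 0" using assms by (simp add: \<rho>_def)
  obtain \<tau> where \<tau>: "0 < \<tau>" "\<tau> < pi / 2" "2 * sqrt (\<alpha> * \<beta>) < b * cos \<tau>"
    using small_angle[of "2 * sqrt (\<alpha> * \<beta>)" b] assms by auto
  have s: "sin \<tau> > 0" using \<tau> by (intro sin_gt_zero) auto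
  define d where "d = \<rho> * sin \<tau>"
  have d: "d > 0" using \<rho> s by (simp add: d_def)
  \<comment> \<open>The margin \<tau> / 2 keeps the closed interval away from the zeros of sin,
    where r would be infinite.\<close>
  define A B where "A = pi + \<tau> / 2" and "B = 2 * pi - \<tau> / 2"
  define r where "r u = d * inverse (- sin u)" for u
  define w where "w u = r u * inverse (- sin u)" for u
  have neg: "- sin u > 0" if "u \<in> {A..B}" for u
    using that \<tau> sin_gt_zero[of "u - pi"] by (simp add: sin_diff A_def B_def)
  have C: "C_k_on 4 r {A<..<B}" "C_k_on 4 w {A<..<B}"
  proof -
    have "C_k_on 4 (\<lambda>u. (- 1) * sin u) {A<..<B}"
      using C_k_on_sin_cos[of "{A<..<B}" 4] by (intro C_k_on_mult C_k_on_const) auto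
    then have i: "C_k_on 4 (\<lambda>u. inverse (- sin u)) {A<..<B}"
      using neg by (intro C_k_on_inverse_pos(1)) auto
    show "C_k_on 4 r {A<..<B}" unfolding r_def[abs_def] by (intro C_k_on_mult C_k_on_const i) auto
    then show "C_k_on 4 w {A<..<B}" unfolding w_def[abs_def] by (intro C_k_on_mult i) auto
  qed
  obtain z w' where "profile r z w w' {A<..<B} (pi + \<tau>) (2 * pi - \<tau>)"
  proof (rule profile_from_angle[OF _ _ _ C(1) _ C(2)])
    show "(r has_real_derivative w u * cos u) (at u)" if "u \<in> {A<..<B}" for u
      unfolding r_def[abs_def] w_def using neg[of u] that
      by (auto intro!: derivative_eq_intros simp: field_simps power2_eq_square)
    show "continuous_on {A..B} w"
      unfolding w_def r_def using neg by (intro continuous_intros) force+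
    show "r u > 0" "w u > 0" if "u \<in> {A<..<B}" for u
      unfolding w_def r_def using neg[of u] that d
      by (auto intro!: mult_pos_pos positive_imp_inverse_positive simp del: inverse_minus_eq)
    have "sin u < 0" if "u \<in> {pi + \<tau><..<2 * pi - \<tau>}" for u using neg[of u] that \<tau> by (simp add: A_def B_def)
    then show "(\<forall>u\<in>{pi + \<tau><..<2 * pi - \<tau>}. sin u > 0) \<or> (\<forall>u\<in>{pi + \<tau><..<2 * pi - \<tau>}. sin u < 0)" by blast
  qed (use \<tau> in \<open>auto simp: A_def B_def\<close>)
  then interpret profile r z w w' "{A<..<B}" "pi + \<tau>" "2 * pi - \<tau>" .
  have pw: "a * (- (1 / w u + sin u / r u) / 2 + 0)\<^sup>2 + b * (1 / w u * (sin u / r u)) = b * (1 / w u * (sin u / r u))"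
    if "u \<in> {A<..<B}" for u
  proof -
    have "1 / w u + sin u / r u = 0" using neg[of u] that d by (simp add: w_def r_def field_simps power2_eq_square)
    then show ?thesis by simp
  qed
  have ends: "r (pi + \<tau>) = \<rho>" "r (2 * pi - \<tau>) = \<rho>"
    using s by (simp_all add: r_def d_def sin_diff)
  have "(\<alpha> / r (pi + \<tau>) + \<beta> * r (pi + \<tau>) + b * cos (pi + \<tau>)) + (\<alpha> / r (2 * pi - \<tau>) + \<beta> * r (2 * pi - \<tau>) - b * cos (2 * pi - \<tau>)) < 0"
    unfolding ends \<rho>_def boundary_density[OF assms(1,2)] using \<tau>(3) by (simp add: cos_diff)
  from energies_unbounded_below[OF assms(1,2) pw this] show ?thesis by blast
qed

theorem lemma5p1:
  fixes a b c\<^sub>o \<alpha> \<beta> :: real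
  assumes "a > 0" and "\<alpha> > 0" and "\<beta> > 0"
  shows
    "(E_under b \<alpha> \<beta> \<ge> 0 \<longrightarrow> (\<forall>X\<in>top_annuli. E_A b \<alpha> \<beta> \<le> annulus_energy a c\<^sub>o b \<alpha> \<beta> X)) \<and>
     (E_under b \<alpha> \<beta> < 0 \<and> c\<^sub>o > 0 \<longrightarrow>
        (INF X\<in>top_annuli. ereal (annulus_energy a c\<^sub>o b \<alpha> \<beta> X)) = -\<infinity> \<and>
        (INF X\<in>top_discs. ereal (disc_energy a c\<^sub>o b \<alpha> \<beta> X)) = -\<infinity>) \<and>
     (E_under b \<alpha> \<beta> < -a \<and> c\<^sub>o = 0 \<and> a + b < 0 \<longrightarrow>
        (INF X\<in>top_annuli. ereal (annulus_energy a c\<^sub>o b \<alpha> \<beta> X)) = -\<infinity> \<and>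
        (INF X\<in>top_discs. ereal (disc_energy a c\<^sub>o b \<alpha> \<beta> X)) = -\<infinity>) \<and>
     (E_under b \<alpha> \<beta> < 0 \<and> c\<^sub>o = 0 \<and> b > 0 \<longrightarrow>
        (INF X\<in>top_annuli. ereal (annulus_energy a c\<^sub>o b \<alpha> \<beta> X)) = -\<infinity> \<and>
        (INF X\<in>top_discs. ereal (disc_energy a c\<^sub>o b \<alpha> \<beta> X)) = -\<infinity>)"
proof (intro conjI[of "_ \<longrightarrow> _"] impI)
  show "\<forall>X\<in>top_annuli. E_A b \<alpha> \<beta> \<le> annulus_energy a c\<^sub>o b \<alpha> \<beta> X" if "E_under b \<alpha> \<beta> \<ge> 0"
    using annulus_energy_lower_bound[OF assms that] by blast
next
  assume "E_under b \<alpha> \<beta> < 0 \<and> c\<^sub>o > 0"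
  then show "(INF X\<in>top_annuli. ereal (annulus_energy a c\<^sub>o b \<alpha> \<beta> X)) = -\<infinity> \<and>
        (INF X\<in>top_discs. ereal (disc_energy a c\<^sub>o b \<alpha> \<beta> X)) = -\<infinity>"
    by (intro nodoid_unbounded assms) (auto simp: E_under_def)
next
  assume *: "E_under b \<alpha> \<beta> < -a \<and> c\<^sub>o = 0 \<and> a + b < 0"
  \<comment> \<open>From a > 0 and a + b < 0 follows b < 0, hence |b| = - b.\<close>
  then have "2 * sqrt (\<alpha> * \<beta>) + a + b < 0" using assms(1) by (auto simp: E_under_def)
  then show "(INF X\<in>top_annuli. ereal (annulus_energy a c\<^sub>o b \<alpha> \<beta> X)) = -\<infinity> \<and>
        (INF X\<in>top_discs. ereal (disc_energy a c\<^sub>o b \<alpha> \<beta> X)) = -\<infinity>"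
    using sphere_unbounded[OF assms(2,3)] * by simp
next
  assume *: "E_under b \<alpha> \<beta> < 0 \<and> c\<^sub>o = 0 \<and> b > 0"
  then have "2 * sqrt (\<alpha> * \<beta>) < b" by (auto simp: E_under_def)
  then show "(INF X\<in>top_annuli. ereal (annulus_energy a c\<^sub>o b \<alpha> \<beta> X)) = -\<infinity> \<and>
        (INF X\<in>top_discs. ereal (disc_energy a c\<^sub>o b \<alpha> \<beta> X)) = -\<infinity>"
    using catenoid_unbounded[OF assms(2,3)] * by simp
qed

end
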